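(* Let $N,M\ge1$ be integers, let $\gamma$ be a positive integer, let $a\in C^{\gamma}(\mathbb{R}^M,\mathbb{R}^N)$, and let $F\in\mathbb{R}^M$ be a constant vector with $F\neq0$. Let $f,g\in L^2(\mathbb{R}_t\times\mathbb{R}^N_x\times\mathbb{R}^M_v)$ satisfy $$\partial_t f+a(v)\cdot\nabla_x f+F\cdot\nabla_v f=g .$$ Assume that for all $v\in\mathbb{R}^M$ and all $\sigma=(\sigma_0,\sigma_1,\dots,\sigma_N)\in S^N$, writing $\widetilde\sigma=(\sigma_1,\dots,\sigma_N)$, $$|\sigma_0+a(v)\cdot\widetilde\sigma|+\sum_{k=1}^{\gamma-1}\left|(F\cdot\nabla_v)^k a(v)\cdot\widetilde\sigma\right|>0 .$$ Let $\psi\in C^1_c(\mathbb{R}^M)$. Then the averaging $$\rho_\psi(t,x)=\int_{\mathbb{R}^M}f(t,x,v)\,\psi(v)\,dv$$ is in $H^{1/\gamma}(\mathbb{R}_t\times\mathbb{R}^N_x)$.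
   Context: $S^N$ is the unit sphere of $\mathbb{R}^{N+1}$. $F\cdot\nabla_v=\sum_{i=1}^M F_i\partial_{v_i}$ is the directional derivative along $F$, and $(F\cdot\nabla_v)^k a$ is its $k$-th iterate applied componentwise to $a$. $a(v)\cdot\nabla_x f=\sum_{i=1}^N a_i(v)\partial_{x_i}f$. The equation is understood in the sense of distributions. *)

theory Defs
  imports "HOL-Analysis.Analysis"
begin

text \<open>Directional derivative \<open>F \<cdot> \<nabla> u\<close>, as an operator on functions.\<close>

definition dir_deriv ::
  "'a::euclidean_space \<Rightarrow> ('a \<Rightarrow> 'b::real_normed_vector) \<Rightarrow> 'a \<Rightarrow> 'b" where
  "dir_deriv F u = (\<lambda>x. frechet_derivative u (at x) F)"

primrec Ck :: "nat \<Rightarrow> ('a::euclidean_space \<Rightarrow> 'b::real_normed_vector) \<Rightarrow> bool" where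
  "Ck 0 u \<longleftrightarrow> continuous_on UNIV u"
| "Ck (Suc k) u \<longleftrightarrow> (\<forall>x. u differentiable (at x)) \<and> (\<forall>w. Ck k (dir_deriv w u))"

definition compactly_supported :: "('a::euclidean_space \<Rightarrow> 'b::real_normed_vector) \<Rightarrow> bool" where
  "compactly_supported u \<longleftrightarrow> compact (closure {x. u x \<noteq> 0})"

definition Ck_compact :: "nat \<Rightarrow> ('a::euclidean_space \<Rightarrow> 'b::real_normed_vector) \<Rightarrow> bool" where
  "Ck_compact k u \<longleftrightarrow> Ck k u \<and> compactly_supported u"

definition test_fun :: "('a::euclidean_space \<Rightarrow> complex) \<Rightarrow> bool" where
  "test_fun \<phi> \<longleftrightarrow> (\<forall>k. Ck k \<phi>) \<and> compactly_supported \<phi>"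

text \<open>Elements of \<open>L\<^sup>2\<close> are handled through representatives.\<close>

definition L2 :: "('a::euclidean_space \<Rightarrow> complex) \<Rightarrow> bool" where
  "L2 u \<longleftrightarrow> u \<in> borel_measurable lborel \<and> integrable lborel (\<lambda>x. (norm (u x))\<^sup>2)"

definition fourier_integral :: "('a::euclidean_space \<Rightarrow> complex) \<Rightarrow> 'a \<Rightarrow> complex" where
  "fourier_integral u \<xi> = (\<integral>x. cis (- (x \<bullet> \<xi>)) * u x \<partial>lborel)"

text \<open>
  \<open>h\<close> represents the Fourier--Plancherel transform of \<open>u \<in> L\<^sup>2\<close>: it is the \<open>L\<^sup>2\<close> limit of the
  Fourier integrals of the truncations of \<open>u\<close> to balls, which lie in \<open>L\<^sup>1 \<inter> L\<^sup>2\<close>. The error is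
  measured by a nonnegative integral, so that an infinite error does not count as zero.
\<close>

definition is_fourier_L2 ::
  "('a::euclidean_space \<Rightarrow> complex) \<Rightarrow> ('a \<Rightarrow> complex) \<Rightarrow> bool" where
  "is_fourier_L2 u h \<longleftrightarrow> L2 u \<and> L2 h \<and>
     ((\<lambda>R. \<integral>\<^sup>+\<xi>. ennreal ((norm (fourier_integral
              (\<lambda>x. indicator (ball 0 R) x * u x) \<xi> - h \<xi>))\<^sup>2) \<partial>lborel) \<longlongrightarrow> 0) at_top"

text \<open>The Sobolev space \<open>H\<^sup>s\<close> for \<open>s \<ge> 0\<close>.\<close>

definition sobolev_H :: "real \<Rightarrow> ('a::euclidean_space \<Rightarrow> complex) set" where
  "sobolev_H s = {u. L2 u \<and> (\<exists>h. is_fourier_L2 u h \<and>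
     integrable lborel (\<lambda>\<xi>. (1 + (norm \<xi>)\<^sup>2) powr s * (norm (h \<xi>))\<^sup>2))}"

text \<open>
  \<open>\<partial>\<^sub>t f + a(v) \<cdot> \<nabla>\<^sub>x f + F \<cdot> \<nabla>\<^sub>v f = g\<close> in the sense of distributions, all derivatives being moved
  onto the test function; \<open>a\<close> does not depend on \<open>x\<close> and \<open>F\<close> is constant, so no derivative falls
  on the coefficients.
\<close>

definition kinetic_eq ::
  "(real^'m \<Rightarrow> real^'n) \<Rightarrow> real^'m \<Rightarrow> (real \<times> (real^'n) \<times> (real^'m) \<Rightarrow> complex)
    \<Rightarrow> (real \<times> (real^'n) \<times> (real^'m) \<Rightarrow> complex) \<Rightarrow> bool" where
  "kinetic_eq a F f g \<longleftrightarrow> (\<forall>\<phi>. test_fun \<phi> \<longrightarrow>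
     - (\<integral>(t, x, v). f (t, x, v) *
          (dir_deriv (1, 0, 0) \<phi> (t, x, v)
           + (\<Sum>i\<in>UNIV. a v $ i *\<^sub>R dir_deriv (0, axis i 1, 0) \<phi> (t, x, v))
           + (\<Sum>j\<in>UNIV. F $ j *\<^sub>R dir_deriv (0, 0, axis j 1) \<phi> (t, x, v))) \<partial>lborel)
     = (\<integral>p. g p * \<phi> p \<partial>lborel))"

definition average ::
  "(real \<times> (real^'n) \<times> (real^'m) \<Rightarrow> complex) \<Rightarrow> (real^'m \<Rightarrow> complex)
    \<Rightarrow> real \<times> (real^'n) \<Rightarrow> complex" where
  "average f \<psi> = (\<lambda>(t, x). \<integral>v. f (t, x, v) * \<psi> v \<partial>lborel)"

end

theory Submission
  imports Defs "HOL-Probability.Characteristic_Functions"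
begin

text \<open>
Write \<open>y = (t, x)\<close> and \<open>c v = (1, a v)\<close>, so that the equation is the transport equation
\<open>c(v) \<cdot> \<nabla>\<^sub>y f + F \<cdot> \<nabla>\<^sub>v f = g\<close>. Its Fourier transform in \<open>y\<close>, at the frequency \<open>\<zeta>\<close>, is
\<open>\<i> (c(v) \<cdot> \<zeta>) f_hat + F \<cdot> \<nabla>\<^sub>v f_hat = g_hat\<close>, and the transform of the average is \<open>\<integral> f_hat \<psi> dv\<close>.

The argument is a duality. For fixed \<open>\<zeta>\<close> the function
\<open>w(v) = \<integral>\<^sub>0\<^sup>1 (1 - r) \<psi>(v - r F) e^(i\<phi>) dr\<close>, with phase \<open>\<phi>(r) = \<integral>\<^sub>0\<^sup>r c(v - q F) \<cdot> \<zeta> dq\<close>, solves the adjoint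
equation \<open>F \<cdot> \<nabla>w - \<i> (c \<cdot> \<zeta>) w = \<psi> - w\<^sub>1\<close>, where \<open>w\<^sub>1\<close> is the same integral without the weight
\<open>1 - r\<close>; see \<open>duhamel_directional_derivative\<close>. The weight vanishes at \<open>r = 1\<close>, so that cutting
the characteristic there leaves no boundary term, only the integral \<open>w\<^sub>1\<close>; and since \<open>r\<close> is bounded, \<open>w\<close>
and \<open>w\<^sub>1\<close> are supported in a fixed ball. Testing the transformed
equation with \<open>w\<close> gives \<open>\<integral> f_hat \<psi> dv = \<integral> f_hat w\<^sub>1 dv - \<integral> g_hat w dv\<close>; see \<open>duhamel_duality\<close>.

Now \<open>w\<close> and \<open>w\<^sub>1\<close> are oscillatory integrals in \<open>r\<close> over \<open>[0, 1]\<close>. The derivatives of orders \<open>1, \<dots>, \<gamma>\<close>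
of their phase are, up to sign, \<open>(F \<cdot> \<nabla>)\<^sup>k c(v - r F) \<cdot> \<zeta>\<close> for \<open>k < \<gamma>\<close>, and the nondegeneracy hypothesis
says that they never vanish together when \<open>\<zeta> \<noteq> 0\<close>. By compactness one of them is at least a fixed multiple of
\<open>|\<zeta>|\<close> near every point, and van der Corput's lemma yields \<open>|w| + |w\<^sub>1| \<le> C (1 + |\<zeta>|\<^sup>2)^(-1/(2\<gamma>))\<close>
uniformly in \<open>v\<close>; see \<open>van_der_Corput\<close> and \<open>duhamel_bound\<close>. The Cauchy--Schwarz inequality in \<open>v\<close> and the
Plancherel inequality in \<open>y\<close> then put \<open>(1 + |\<zeta>|\<^sup>2)^(1/(2\<gamma>))\<close> times the transform of the average in
\<open>L\<^sup>2\<close>; see \<open>weighted_fourier_average_bound\<close>.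

Two approximations make this rigorous. The equation may be tested only with smooth functions, whereas \<open>w\<close> is
in general not smooth. As it has a continuous derivative along \<open>F\<close>, the only one in the equation, it is mollified (\<open>mollification\<close>). And the transform of \<open>f\<close> in \<open>y\<close>
is an integral only after a cutoff: \<open>f\<close> is multiplied by \<open>\<theta>(y)\<close> smooth with compact support, which adds
\<open>f c(v) \<cdot> \<nabla>\<theta>\<close> to the source term. This is harmless because \<open>c\<close> is bounded on the support of \<open>w\<close>. The estimates
are uniform over the dilates \<open>\<theta>(y/n)\<close> and pass to the limit that defines the transform on \<open>L\<^sup>2\<close>
(\<open>sobolev_H_if_truncations_bounded\<close>).
\<close>

section \<open>Calculus of iterated directional derivatives\<close>

lemma Ck_continuous: "Ck k u \<Longrightarrow> continuous_on UNIV u"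
  by (cases k) (auto simp: continuous_at_imp_continuous_on differentiable_imp_continuous_within)

lemma Ck_Suc_imp_Ck: "Ck (Suc k) u \<Longrightarrow> Ck k u"
proof (induction k arbitrary: u)
  case 0
  then show ?case by (metis Ck_continuous Ck.simps(1))
next
  case (Suc k)
  then show ?case by (metis Ck.simps(2))
qed

lemma Ck_Suc_differentiable: "Ck (Suc k) u \<Longrightarrow> u differentiable (at x)"
  by simp

lemma dir_deriv_eq: "(u has_derivative D) (at x) \<Longrightarrow> dir_deriv w u x = D w"
  unfolding dir_deriv_def by (metis frechet_derivative_at)

lemma has_derivative_dir_deriv:
  "u differentiable (at x) \<Longrightarrow> (u has_derivative (\<lambda>w. dir_deriv w u x)) (at x)"
  unfolding dir_deriv_def by (simp add: frechet_derivative_works[symmetric])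

lemma dir_deriv_add_direction:
  "u differentiable (at x) \<Longrightarrow> dir_deriv (w + w') u x = dir_deriv w u x + dir_deriv w' u x"
  using has_derivative_dir_deriv has_derivative_linear linear_add by blast

lemma dir_deriv_scale_direction:
  "u differentiable (at x) \<Longrightarrow> dir_deriv (c *\<^sub>R w) u x = c *\<^sub>R dir_deriv w u x"
  using has_derivative_dir_deriv has_derivative_linear linear_scale by blast

lemma dir_deriv_sum_direction:
  "u differentiable (at x) \<Longrightarrow> dir_deriv (\<Sum>i\<in>I. w i) u x = (\<Sum>i\<in>I. dir_deriv (w i) u x)"
  using has_derivative_dir_deriv[of u x] has_derivative_linear
    linear_sum[of "\<lambda>w. dir_deriv w u x" w I] by blast

lemma Ck_const: "Ck k (\<lambda>x. c)"
proof (induction k arbitrary: c)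
  case (Suc k)
  have "dir_deriv w (\<lambda>x. c) = (\<lambda>x. 0)" for w :: 'a
    by (rule ext) (simp add: dir_deriv_eq[OF has_derivative_const])
  then show ?case using Suc by simp
qed simp

lemma Ck_add: "Ck k u \<Longrightarrow> Ck k v \<Longrightarrow> Ck k (\<lambda>x. u x + v x)"
proof (induction k arbitrary: u v)
  case (Suc k)
  have "dir_deriv w (\<lambda>x. u x + v x) = (\<lambda>x. dir_deriv w u x + dir_deriv w v x)" for w
    by (rule ext, rule dir_deriv_eq, intro has_derivative_add has_derivative_dir_deriv)
      (use Suc.prems in auto)
  then show ?case using Suc by simp
qed (auto intro: continuous_intros)

lemma dir_deriv_mult:
  fixes u v :: "'a::euclidean_space \<Rightarrow> 'b::real_normed_algebra"
  assumes "u differentiable (at x)" "v differentiable (at x)"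
  shows "dir_deriv w (\<lambda>x. u x * v x) x = u x * dir_deriv w v x + dir_deriv w u x * v x"
  by (rule dir_deriv_eq, intro has_derivative_mult has_derivative_dir_deriv assms)

lemma Ck_mult:
  fixes u v :: "'a::euclidean_space \<Rightarrow> 'b::real_normed_algebra"
  shows "Ck k u \<Longrightarrow> Ck k v \<Longrightarrow> Ck k (\<lambda>x. u x * v x)"
proof (induction k arbitrary: u v)
  case (Suc k)
  have "dir_deriv w (\<lambda>x. u x * v x) = (\<lambda>x. u x * dir_deriv w v x + dir_deriv w u x * v x)" for w
    by (rule ext, rule dir_deriv_mult) (use Suc.prems in auto)
  moreover have "Ck k u" "Ck k v" using Suc.prems Ck_Suc_imp_Ck by blast+
  ultimately show ?case using Suc by (auto intro!: Ck_add)
qed (auto intro: continuous_intros)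

lemma Ck_prod:
  fixes u :: "'i \<Rightarrow> 'a::euclidean_space \<Rightarrow> 'b::real_normed_field"
  assumes "finite I" "\<And>i. i \<in> I \<Longrightarrow> Ck k (u i)"
  shows "Ck k (\<lambda>x. \<Prod>i\<in>I. u i x)"
  using assms by (induction I) (auto intro: Ck_const Ck_mult)

lemma dir_deriv_compose_affine:
  assumes L: "bounded_linear L" and "u differentiable (at (c + L x))"
  shows "dir_deriv w (\<lambda>x. u (c + L x)) x = dir_deriv (L w) u (c + L x)"
proof -
  have "((\<lambda>x. c + L x) has_derivative L) (at x)"
    using has_derivative_add[OF has_derivative_const bounded_linear_imp_has_derivative[OF L]] by simp
  from has_derivative_compose[OF this has_derivative_dir_deriv[OF assms(2)]]
  show ?thesis by (rule dir_deriv_eq)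
qed

lemma Ck_compose_affine:
  assumes L: "bounded_linear L"
  shows "Ck k u \<Longrightarrow> Ck k (\<lambda>x. u (c + L x))"
proof (induction k arbitrary: u)
  case 0
  have "continuous_on UNIV (\<lambda>x. c + L x)"
    using L by (intro continuous_intros) (auto intro: linear_continuous_on)
  then show ?case using 0 by (auto intro: continuous_on_compose2)
next
  case (Suc k)
  have D: "((\<lambda>x. c + L x) has_derivative L) (at x)" for x
    using has_derivative_add[OF has_derivative_const bounded_linear_imp_has_derivative[OF L]] by simp
  have "(\<lambda>x. u (c + L x)) differentiable (at x)" for x
    using has_derivative_compose[OF D has_derivative_dir_deriv[of u]] Suc.prems
    unfolding differentiable_def Ck.simps by blast
  moreover have "dir_deriv w (\<lambda>x. u (c + L x)) = (\<lambda>x. dir_deriv (L w) u (c + L x))" for w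
    by (rule ext, rule dir_deriv_compose_affine[OF L]) (use Suc.prems in auto)
  ultimately show ?case using Suc by auto
qed

lemma dir_deriv_linear_compose:
  assumes T: "bounded_linear T" and "u differentiable (at x)"
  shows "dir_deriv w (\<lambda>x. T (u x)) x = T (dir_deriv w u x)"
  by (rule dir_deriv_eq, rule bounded_linear.has_derivative[OF T has_derivative_dir_deriv], fact)

lemma Ck_linear_compose:
  assumes T: "bounded_linear T"
  shows "Ck k u \<Longrightarrow> Ck k (\<lambda>x. T (u x))"
proof (induction k arbitrary: u)
  case 0
  then show ?case using T by (auto intro: bounded_linear.continuous_on)
next
  case (Suc k)
  have "(\<lambda>x. T (u x)) differentiable (at x)" for x
    using bounded_linear.has_derivative[OF T has_derivative_dir_deriv] Suc.prems
    by (fastforce simp: differentiable_def)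
  moreover have "dir_deriv w (\<lambda>x. T (u x)) = (\<lambda>x. T (dir_deriv w u x))" for w
    by (rule ext, rule dir_deriv_linear_compose[OF T]) (use Suc.prems in auto)
  ultimately show ?case using Suc by auto
qed

text \<open>Characters are handled with a free constant factor, because their directional derivatives are again
characters up to a constant; the induction on the order then closes.\<close>
lemma
  fixes \<zeta> :: "'a::euclidean_space"
  shows Ck_cis_inner: "Ck k (\<lambda>y. c * cis (- (y \<bullet> \<zeta>)))"
    and dir_deriv_cis_inner:
      "dir_deriv w (\<lambda>y. c * cis (- (y \<bullet> \<zeta>))) y = (- \<i> * of_real (w \<bullet> \<zeta>) * c) * cis (- (y \<bullet> \<zeta>))"
proof -
  have D: "((\<lambda>y. c * cis (- (y \<bullet> \<zeta>))) has_derivative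
      (\<lambda>w. (- \<i> * of_real (w \<bullet> \<zeta>) * c) * cis (- (y \<bullet> \<zeta>)))) (at y)" for c y
  proof -
    have g: "((\<lambda>y. \<i> * of_real (- (y \<bullet> \<zeta>))) has_derivative (\<lambda>w. \<i> * of_real (- (w \<bullet> \<zeta>)))) (at y)"
      by (intro bounded_linear_imp_has_derivative bounded_linear_compose[OF bounded_linear_mult_right]
          bounded_linear_compose[OF bounded_linear_of_real] bounded_linear_minus bounded_linear_inner_left)
    have e: "(exp has_derivative (*) (exp (\<i> * of_real (- (y \<bullet> \<zeta>))))) (at (\<i> * of_real (- (y \<bullet> \<zeta>))))"
      using DERIV_exp unfolding has_field_derivative_def .
    have m: "((*) c has_derivative (*) c) (at z)" for z
      by (intro bounded_linear_imp_has_derivative bounded_linear_mult_right)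
    show ?thesis unfolding cis_conv_exp
      by (rule has_derivative_eq_rhs, rule has_derivative_compose[OF has_derivative_compose[OF g e] m])
        (simp add: fun_eq_iff mult_ac)
  qed
  show dd: "dir_deriv w (\<lambda>y. c * cis (- (y \<bullet> \<zeta>))) y = (- \<i> * of_real (w \<bullet> \<zeta>) * c) * cis (- (y \<bullet> \<zeta>))"
    for c w y by (rule dir_deriv_eq[OF D])
  show "Ck k (\<lambda>y. c * cis (- (y \<bullet> \<zeta>)))"
  proof (induction k arbitrary: c)
    case 0
    show ?case by (auto intro!: continuous_intros)
  next
    case (Suc k)
    have "dir_deriv w (\<lambda>y. c * cis (- (y \<bullet> \<zeta>))) =
        (\<lambda>y. (- \<i> * of_real (w \<bullet> \<zeta>) * c) * cis (- (y \<bullet> \<zeta>)))" for w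
      by (rule ext) (rule dd)
    moreover have "(\<lambda>y. c * cis (- (y \<bullet> \<zeta>))) differentiable (at x)" for x
      using D[of c x] unfolding differentiable_def by blast
    ultimately show ?case using Suc[of "- \<i> * of_real (_ \<bullet> \<zeta>) * c"] unfolding Ck.simps by metis
  qed
qed

lemma compactly_supportedI:
  assumes "\<And>x. norm x > r \<Longrightarrow> u x = 0"
  shows "compactly_supported u"
proof -
  have "{x. u x \<noteq> 0} \<subseteq> cball 0 r" using assms by (auto simp: mem_cball_0 not_less[symmetric])
  then have "bounded {x. u x \<noteq> 0}" by (rule bounded_subset[OF bounded_cball])
  then show ?thesis unfolding compactly_supported_def by (simp add: compact_closure)
qed

lemma compactly_supportedE:
  assumes "compactly_supported u"
  obtains r where "r > 0" "\<And>x. norm x \<ge> r \<Longrightarrow> u x = 0"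
proof -
  have "bounded {x. u x \<noteq> 0}"
    using assms unfolding compactly_supported_def by (rule bounded_subset[OF compact_imp_bounded closure_subset])
  then obtain b where "b > 0" "\<forall>x\<in>{x. u x \<noteq> 0}. norm x \<le> b" unfolding bounded_pos by blast
  then show ?thesis by (intro that[of "b + 1"]) force+
qed

section \<open>Smooth bump functions\<close>

text \<open>For \<open>p = 1\<close> this is the classical smooth function that vanishes to infinite order at \<open>0\<close>. The polynomial
factor makes the family closed under differentiation.\<close>
definition flat :: "real poly \<Rightarrow> real \<Rightarrow> real" where
  "flat p x = (if x > 0 then poly p (1 / x) * exp (- (1 / x)) else 0)"

text \<open>This is what makes \<open>flat p\<close> and its difference quotient at \<open>0\<close> tend to \<open>0\<close>, with \<open>y = 1 / x\<close>.\<close>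
lemma poly_exp_tendsto_0: "((\<lambda>y::real. poly p y * exp (- y)) \<longlongrightarrow> 0) at_top"
proof -
  have "((\<lambda>y. \<Sum>i\<le>degree p. coeff p i * (y ^ i / exp y)) \<longlongrightarrow> (\<Sum>i\<le>degree p. coeff p i * 0)) at_top"
    by (intro tendsto_intros tendsto_power_div_exp_0)
  then show ?thesis by (simp add: poly_altdef sum_distrib_right exp_minus divide_inverse mult.assoc)
qed

lemma flat_has_derivative:
  "(flat p has_real_derivative flat ([:0, 0, 1:] * (p - pderiv p)) x) (at x)"
proof -
  consider "x > 0" | "x < 0" | "x = 0" by linarith
  then show ?thesis
  proof cases
    case 1
    have "((\<lambda>x. poly p (1 / x) * exp (- (1 / x))) has_real_derivative flat ([:0, 0, 1:] * (p - pderiv p)) x) (at x)"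
    proof (rule DERIV_cong)
      have i: "((\<lambda>x. 1 / x) has_real_derivative - (1 / x\<^sup>2)) (at x)"
        using 1 by (auto intro!: derivative_eq_intros simp: power2_eq_square)
      show "((\<lambda>x. poly p (1 / x) * exp (- (1 / x))) has_real_derivative
          (poly (pderiv p) (1 / x) * - (1 / x\<^sup>2)) * exp (- (1 / x))
            + (exp (- (1 / x)) * - (- (1 / x\<^sup>2))) * poly p (1 / x)) (at x)"
        by (intro DERIV_mult DERIV_chain2[OF poly_DERIV i] DERIV_chain2[OF DERIV_exp DERIV_minus[OF i]])
    qed (use 1 in \<open>simp add: flat_def algebra_simps power2_eq_square\<close>)
    moreover have "\<forall>\<^sub>F y in nhds x. flat p y = poly p (1 / y) * exp (- (1 / y))"
      using eventually_nhds_in_open[of "{0<..}" x] 1 by (auto elim!: eventually_mono simp: flat_def)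
    ultimately show ?thesis by (subst DERIV_cong_ev[OF refl _ refl])
  next
    case 2
    have "\<forall>\<^sub>F y in nhds x. flat p y = 0"
      using eventually_nhds_in_open[of "{..<0}" x] 2 by (auto elim!: eventually_mono simp: flat_def)
    moreover have "((\<lambda>_. 0) has_real_derivative flat ([:0, 0, 1:] * (p - pderiv p)) x) (at x)"
      using 2 by (auto simp: flat_def)
    ultimately show ?thesis by (subst DERIV_cong_ev[OF refl _ refl])
  next
    case 3
    have r: "((\<lambda>h. flat p h / h) \<longlongrightarrow> 0) (at_right 0)"
    proof (rule Lim_transform_eventually)
      have "filterlim (\<lambda>h::real. 1 / h) at_top (at_right 0)"
        using filterlim_inverse_at_top_right by (simp add: inverse_eq_divide)
      from filterlim_compose[OF poly_exp_tendsto_0[of "[:0,1:] * p"] this]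
      show "((\<lambda>h. poly ([:0,1:] * p) (1 / h) * exp (- (1 / h))) \<longlongrightarrow> 0) (at_right 0)" .
      show "\<forall>\<^sub>F h in at_right 0. poly ([:0,1:] * p) (1 / h) * exp (- (1 / h)) = flat p h / h"
        by (auto simp: eventually_at_filter flat_def)
    qed
    have l: "((\<lambda>h. flat p h / h) \<longlongrightarrow> 0) (at_left 0)"
      by (rule tendsto_eventually) (auto simp: eventually_at_filter flat_def)
    have "((\<lambda>h. flat p h / h) \<longlongrightarrow> 0) (at 0)" using l r by (simp add: filterlim_split_at)
    then show ?thesis using 3 by (simp add: DERIV_def flat_def)
  qed
qed

text \<open>The derivative of a member of the family is again a member, which gives all orders at once.\<close>
lemma Ck_flat: "Ck k (flat p)"
proof (induction k arbitrary: p)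
  case 0
  have "isCont (flat p) x" for x by (rule DERIV_isCont[OF flat_has_derivative])
  then show ?case by (simp add: continuous_at_imp_continuous_on)
next
  case (Suc k)
  have D: "(flat p has_derivative (\<lambda>w. flat ([:0, 0, 1:] * (p - pderiv p)) x * w)) (at x)" for x
    using flat_has_derivative[of p x] by (simp add: has_field_derivative_def)
  have "dir_deriv w (flat p) = flat (smult w ([:0, 0, 1:] * (p - pderiv p)))" for w
    by (rule ext, subst dir_deriv_eq[OF D]) (simp add: flat_def)
  then show ?case using Suc D by (auto simp: differentiable_def)
qed

text \<open>A product over the coordinates of \<open>flat 1 (d - x\<^sub>b) \<cdot> flat 1 (d + x\<^sub>b)\<close> is positive exactly on the
cube \<open>|x\<^sub>b| < d\<close>; with \<open>d = r / DIM\<close> that cube lies in the ball of radius \<open>r\<close>, by comparison of the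
norm with the \<open>l\<^sup>1\<close> norm.\<close>
lemma smooth_bump:
  fixes r :: real
  assumes "r > 0"
  obtains \<eta> :: "'a::euclidean_space \<Rightarrow> real"
  where "\<And>k. Ck k \<eta>" "\<And>x. 0 \<le> \<eta> x" "0 < \<eta> 0" "\<And>x. r \<le> norm x \<Longrightarrow> \<eta> x = 0"
proof -
  \<comment> \<open>The cube of half-side r / DIM is contained in the ball of radius r.\<close>
  define d where "d = r / DIM('a)"
  have d: "d > 0" using assms by (simp add: d_def)
  define \<eta> :: "'a \<Rightarrow> real" where
    "\<eta> x = (\<Prod>b\<in>Basis. flat 1 (d + (- b) \<bullet> x) * flat 1 (d + b \<bullet> x))" for x
  show thesis
  proof
    show "Ck k \<eta>" for k
      unfolding \<eta>_def
      by (intro Ck_prod Ck_mult Ck_compose_affine[OF bounded_linear_inner_right Ck_flat]) simp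
    show "0 \<le> \<eta> x" for x unfolding \<eta>_def by (intro prod_nonneg) (auto simp: flat_def)
    show "0 < \<eta> 0" unfolding \<eta>_def by (intro prod_pos) (auto simp: flat_def d)
    fix x :: 'a assume x: "r \<le> norm x"
    have "\<exists>b\<in>Basis. \<bar>x \<bullet> b\<bar> \<ge> d"
    proof (rule ccontr)
      assume "\<not> ?thesis"
      then have "(\<Sum>b\<in>Basis. \<bar>x \<bullet> b\<bar>) < (\<Sum>b\<in>(Basis::'a set). d)"
        by (intro sum_strict_mono) auto
      also have "\<dots> = r" by (simp add: d_def)
      finally show False using norm_le_l1[of x] x by linarith
    qed
    then obtain b where b: "b \<in> Basis" "\<bar>x \<bullet> b\<bar> \<ge> d" by blast
    then have "flat 1 (d + (- b) \<bullet> x) * flat 1 (d + b \<bullet> x) = 0"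
      by (auto simp: flat_def inner_commute)
    then show "\<eta> x = 0" unfolding \<eta>_def using b by (intro prod_zero) auto
  qed
qed

section \<open>Mollification along a direction\<close>

text \<open>Differentiation falls on \<open>\<eta>\<close> alone, so \<open>\<beta>\<close> need only be continuous: this is why convolution
smooths.\<close>
lemma conv_has_derivative:
  fixes \<eta> :: "'b::euclidean_space \<Rightarrow> real" and \<beta> :: "'b \<Rightarrow> complex"
  assumes \<eta>: "Ck 1 \<eta>" and \<beta>: "continuous_on UNIV \<beta>"
  shows "((\<lambda>v. integral (cbox a b) (\<lambda>u. \<eta> (v - u) *\<^sub>R \<beta> u)) has_derivative
      (\<lambda>w. integral (cbox a b) (\<lambda>u. dir_deriv w \<eta> (v - u) *\<^sub>R \<beta> u))) (at v)"
proof -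
  have diff: "\<eta> differentiable (at x)" for x using \<eta> by simp
  have c1: "continuous_on UNIV (dir_deriv w \<eta>)" for w using \<eta> by (simp add: Ck_continuous)
  have c0: "continuous_on UNIV \<eta>" using \<eta> Ck_continuous by blast
  define D where "D x = Blinfun (\<lambda>w. dir_deriv w \<eta> x)" for x
  have bl: "bounded_linear (\<lambda>w. dir_deriv w \<eta> x)" for x
    using has_derivative_dir_deriv[OF diff] has_derivative_bounded_linear by blast
  have D: "blinfun_apply (D x) w = dir_deriv w \<eta> x" for x w
    unfolding D_def by (simp add: bounded_linear_Blinfun_apply bl)
  have Dc: "continuous_on UNIV D"
    by (rule continuous_on_blinfun_componentwise) (simp add: D c1)
  define fx where "fx v u = blinfun_scaleR_left (\<beta> u) o\<^sub>L D (v - u)" for v u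
  have fx: "blinfun_apply (fx v u) w = dir_deriv w \<eta> (v - u) *\<^sub>R \<beta> u" for v u w
    by (simp add: fx_def D)
  have *: "((\<lambda>v. integral (cbox a b) (\<lambda>u. \<eta> (v - u) *\<^sub>R \<beta> u)) has_derivative
      integral (cbox a b) (fx v)) (at v within UNIV)"
  proof (rule leibniz_rule)
    fix x t :: 'b
    have "((\<lambda>x. \<eta> (x - t)) has_derivative (\<lambda>w. dir_deriv w \<eta> (x - t))) (at x)"
      by (rule has_derivative_eq_rhs, rule has_derivative_compose[OF _ has_derivative_dir_deriv[OF diff]])
        (auto intro!: derivative_eq_intros)
    then show "((\<lambda>x. \<eta> (x - t) *\<^sub>R \<beta> t) has_derivative blinfun_apply (fx x t)) (at x within UNIV)"
      unfolding fx by (rule has_derivative_scaleR_left)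
  next
    show "(\<lambda>u. \<eta> (x - u) *\<^sub>R \<beta> u) integrable_on cbox a b" for x
      by (intro integrable_continuous continuous_intros continuous_on_compose2[OF c0]
          continuous_on_subset[OF \<beta>]) auto
    show "continuous_on (UNIV \<times> cbox a b) (\<lambda>(x, t). fx x t)"
      unfolding fx_def split_beta
      by (intro continuous_intros continuous_on_compose2[OF Dc] continuous_on_compose2[OF \<beta>]) auto
  qed auto
  have "blinfun_apply (integral (cbox a b) (fx v)) w =
      integral (cbox a b) (\<lambda>u. dir_deriv w \<eta> (v - u) *\<^sub>R \<beta> u)" for w
  proof -
    have "continuous_on (cbox a b) (fx v)"
      unfolding fx_def
      by (intro continuous_intros continuous_on_compose2[OF Dc] continuous_on_subset[OF \<beta>]) auto
    then have "fx v integrable_on cbox a b" by (rule integrable_continuous)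
    from integral_linear[OF this blinfun.bounded_linear_left, of w]
    show ?thesis by (simp add: o_def fx)
  qed
  then have "blinfun_apply (integral (cbox a b) (fx v)) =
      (\<lambda>w. integral (cbox a b) (\<lambda>u. dir_deriv w \<eta> (v - u) *\<^sub>R \<beta> u))" by blast
  with * show ?thesis by simp
qed

lemma Ck_conv:
  fixes \<eta> :: "'b::euclidean_space \<Rightarrow> real" and \<beta> :: "'b \<Rightarrow> complex"
  assumes \<beta>: "continuous_on UNIV \<beta>"
  shows "(\<And>j. Ck j \<eta>) \<Longrightarrow> Ck k (\<lambda>v. integral (cbox a b) (\<lambda>u. \<eta> (v - u) *\<^sub>R \<beta> u))"
proof (induction k arbitrary: \<eta>)
  case 0
  have "Ck 1 \<eta>" using 0 by blast
  from conv_has_derivative[OF this \<beta>] show ?case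
    by (auto intro!: continuous_at_imp_continuous_on has_derivative_continuous)
next
  case (Suc k)
  have D: "((\<lambda>v. integral (cbox a b) (\<lambda>u. \<eta> (v - u) *\<^sub>R \<beta> u)) has_derivative
      (\<lambda>w. integral (cbox a b) (\<lambda>u. dir_deriv w \<eta> (v - u) *\<^sub>R \<beta> u))) (at v)" for v
    using Suc.prems by (intro conv_has_derivative \<beta>)
  have "Ck j (dir_deriv w \<eta>)" for j w using Suc.prems[of "Suc j"] by simp
  then have "Ck k (\<lambda>v. integral (cbox a b) (\<lambda>u. dir_deriv w \<eta> (v - u) *\<^sub>R \<beta> u))" for w
    by (rule Suc.IH)
  moreover have "dir_deriv w (\<lambda>v. integral (cbox a b) (\<lambda>u. \<eta> (v - u) *\<^sub>R \<beta> u)) =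
      (\<lambda>v. integral (cbox a b) (\<lambda>u. dir_deriv w \<eta> (v - u) *\<^sub>R \<beta> u))" for w
    by (rule ext) (rule dir_deriv_eq[OF D])
  ultimately show ?case using D by (auto simp: differentiable_def)
qed

lemma lborel_distr_reflect:
  fixes c :: "'a::euclidean_space"
  shows "distr lborel borel (\<lambda>x. c - x) = lborel"
  using lborel_affine[of "-1" c] by (simp add: density_1)

lemma lborel_integral_reflect:
  fixes f :: "'a::euclidean_space \<Rightarrow> 'c::{banach, second_countable_topology}"
  assumes [measurable]: "f \<in> borel_measurable borel"
  shows "(\<integral>u. f (c - u) \<partial>lborel) = (\<integral>u. f u \<partial>lborel)"
proof -
  have "(\<integral>u. f u \<partial>lborel) = (\<integral>u. f u \<partial>distr lborel borel (\<lambda>x::'a. c - x))"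
    by (simp only: lborel_distr_reflect)
  also have "\<dots> = (\<integral>u. f (c - u) \<partial>lborel)" by (rule integral_distr) auto
  finally show ?thesis by simp
qed

lemma integrable_continuous_bounded_support:
  fixes f :: "'a::euclidean_space \<Rightarrow> 'c::{banach, second_countable_topology}"
  assumes "continuous_on UNIV f" and "\<And>x. r < norm x \<Longrightarrow> f x = 0"
  shows "integrable lborel f"
proof -
  have "integrable lborel (\<lambda>x. indicator (cball 0 r) x *\<^sub>R f x)"
    using assms by (intro borel_integrable_compact) (auto intro: continuous_on_subset)
  also have "(\<lambda>x. indicator (cball 0 r) x *\<^sub>R f x) = f"
    using assms(2) by (force simp: indicator_def)
  finally show ?thesis .
qed

lemma bounded_continuous_bounded_support:
  fixes f :: "'a::euclidean_space \<Rightarrow> 'c::real_normed_vector"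
  assumes "continuous_on UNIV f" and "\<And>x. r < norm x \<Longrightarrow> f x = 0"
  obtains C where "C \<ge> 0" "\<And>x. norm (f x) \<le> C"
proof -
  have "compact (f ` cball 0 r)"
    using assms(1) by (intro compact_continuous_image) (auto intro: continuous_on_subset)
  then have "bounded (f ` cball 0 r)" by (rule compact_imp_bounded)
  then obtain C where C: "\<And>x. x \<in> cball 0 r \<Longrightarrow> norm (f x) \<le> C" "C > 0" unfolding bounded_pos by blast
  have "norm (f x) \<le> C" for x
    using C assms(2)[of x] by (cases "r < norm x") auto
  with C show ?thesis using that[of C] by simp
qed

lemma mollifier:
  fixes r :: real
  assumes "r > 0"
  obtains \<eta> :: "'a::euclidean_space \<Rightarrow> real"
  where "\<And>k. Ck k \<eta>" "\<And>x. 0 \<le> \<eta> x" "\<And>x. r \<le> norm x \<Longrightarrow> \<eta> x = 0"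
    "integrable lborel \<eta>" "(\<integral>x. \<eta> x \<partial>lborel) = 1"
proof -
  obtain \<eta> :: "'a \<Rightarrow> real" where \<eta>: "\<And>k. Ck k \<eta>" "\<And>x. 0 \<le> \<eta> x" "0 < \<eta> 0" "\<And>x. r \<le> norm x \<Longrightarrow> \<eta> x = 0"
    using smooth_bump[OF assms] by blast
  have c: "continuous_on UNIV \<eta>" using \<eta>(1) Ck_continuous by blast
  have int: "integrable lborel \<eta>"
    by (rule integrable_continuous_bounded_support[OF c, of r]) (use \<eta>(4) in auto)
  have "(\<integral>x. \<eta> x \<partial>lborel) \<noteq> 0"
  proof
    assume "(\<integral>x. \<eta> x \<partial>lborel) = 0"
    then have "AE x in lborel. \<eta> x = 0"
      using integral_nonneg_eq_0_iff_AE[OF int] \<eta>(2) by simp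
    then have "AE x in lborel. x \<in> {x. \<eta> x = 0}" by simp
    moreover have "closed {x. \<eta> x = 0}" by (intro closed_Collect_eq c continuous_on_const)
    ultimately have "0 \<in> {x. \<eta> x = 0}" using mem_closed_if_AE_lebesgue[of "{x. \<eta> x = 0}"]
      by (metis (no_types, lifting) AE_completion)
    then show False using \<eta>(3) by simp
  qed
  then have pos: "(\<integral>x. \<eta> x \<partial>lborel) > 0"
    using Bochner_Integration.integral_nonneg[of lborel \<eta>, OF \<eta>(2)] by linarith
  show thesis
  proof
    let ?c = "1 / (\<integral>x. \<eta> x \<partial>lborel)"
    show "Ck k (\<lambda>x. ?c * \<eta> x)" for k by (intro Ck_mult Ck_const \<eta>(1))
  qed (use \<eta> int pos in auto)
qed

text \<open>The functions \<open>\<eta> n\<close> are probability densities that concentrate at \<open>0\<close>, so the convolution averages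
the values of \<open>f\<close> near \<open>v\<close>.\<close>
lemma continuous_conv_approx:
  fixes f :: "'b::euclidean_space \<Rightarrow> complex" and \<eta> :: "nat \<Rightarrow> 'b \<Rightarrow> real"
  assumes f: "continuous_on UNIV f"
    and \<eta>: "\<And>n. continuous_on UNIV (\<eta> n)" "\<And>n x. 0 \<le> \<eta> n x" "\<And>n x. 1 / real (Suc n) \<le> norm x \<Longrightarrow> \<eta> n x = 0"
      "\<And>n. (\<integral>x. \<eta> n x \<partial>lborel) = 1"
  shows "(\<lambda>n. \<integral>u. \<eta> n u *\<^sub>R f (v - u) \<partial>lborel) \<longlonglongrightarrow> f v"
proof (rule LIMSEQ_I)
  fix e :: real assume e: "e > 0"
  have "isCont f v" using f by (simp add: continuous_on_eq_continuous_at)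
  then obtain d where d: "d > 0" "\<And>x. norm (x - v) < d \<Longrightarrow> norm (f x - f v) < e / 2"
    using e unfolding continuous_at_eps_delta dist_norm by (meson half_gt_zero)
  obtain N where N: "1 / real (Suc N) < d" using d(1) nat_approx_posE by blast
  have sup: "\<eta> n u = 0" if "1 < norm u" for n u
  proof (rule \<eta>(3))
    have "1 / real (Suc n) \<le> 1" by simp
    then show "1 / real (Suc n) \<le> norm u" using that by linarith
  qed
  have i1: "integrable lborel (\<lambda>u. \<eta> n u *\<^sub>R f (v - u))" for n
    by (rule integrable_continuous_bounded_support[where r = 1])
      (auto intro!: continuous_intros \<eta> continuous_on_compose2[OF f] simp: sup)
  have i2: "integrable lborel (\<eta> n)" for n
    by (rule integrable_continuous_bounded_support[where r = 1]) (auto intro!: \<eta> simp: sup)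
  show "\<exists>N. \<forall>n\<ge>N. norm ((\<integral>u. \<eta> n u *\<^sub>R f (v - u) \<partial>lborel) - f v) < e"
  proof (intro exI allI impI)
    fix n assume n: "n \<ge> N"
    have le: "norm (\<eta> n u *\<^sub>R (f (v - u) - f v)) \<le> \<eta> n u * (e / 2)" for u
    proof (cases "1 / real (Suc n) \<le> norm u")
      case True
      then show ?thesis using \<eta>(3) by simp
    next
      case False
      have "1 / real (Suc n) \<le> 1 / real (Suc N)" using n by (simp add: frac_le)
      then have "norm u < d" using False N by linarith
      then have "norm (f (v - u) - f v) < e / 2" using d(2)[of "v - u"] by simp
      then show ?thesis using \<eta>(2)[of n u] mult_left_mono[of "norm (f (v - u) - f v)" "e / 2" "\<eta> n u"] by simp
    qed
    have "(\<integral>u. \<eta> n u *\<^sub>R f (v - u) \<partial>lborel) - f v = (\<integral>u. \<eta> n u *\<^sub>R f (v - u) \<partial>lborel) - (\<integral>u. \<eta> n u \<partial>lborel) *\<^sub>R f v"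
      using \<eta>(4) by simp
    also have "\<dots> = (\<integral>u. \<eta> n u *\<^sub>R (f (v - u) - f v) \<partial>lborel)"
      using i1 i2 by (simp add: scaleR_diff_right)
    finally have "norm ((\<integral>u. \<eta> n u *\<^sub>R f (v - u) \<partial>lborel) - f v) \<le> (\<integral>u. norm (\<eta> n u *\<^sub>R (f (v - u) - f v)) \<partial>lborel)"
      by (metis integral_norm_bound)
    also have "\<dots> \<le> (\<integral>u. \<eta> n u * (e / 2) \<partial>lborel)"
    proof (rule integral_mono)
      have "integrable lborel (\<lambda>u. \<eta> n u *\<^sub>R (f (v - u) - f v))"
        using i1 i2 by (simp add: scaleR_diff_right)
      then show "integrable lborel (\<lambda>u. norm (\<eta> n u *\<^sub>R (f (v - u) - f v)))" by (rule integrable_norm)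
    qed (use i2 le in auto)
    also have "\<dots> = e / 2" using \<eta>(4) by simp
    finally show "norm ((\<integral>u. \<eta> n u *\<^sub>R f (v - u) \<partial>lborel) - f v) < e" using e by linarith
  qed
qed

text \<open>Convolution commutes with the derivative along \<open>F\<close>. When \<open>\<beta>\<close> is written at the translated argument, the
derivative can be put on \<open>\<beta>\<close>, which yields the convolution of \<open>D\<close>; when \<open>\<eta>\<close> carries it, smoothness
follows. So test functions approximate \<open>\<beta>\<close> together with its derivative along \<open>F\<close>, although \<open>\<beta>\<close> may
fail to be differentiable in the other directions. The bounds and the common support allow dominated convergence
against locally integrable functions.\<close>
lemma mollification:
  fixes \<beta> D :: "'b::euclidean_space \<Rightarrow> complex" and F :: 'b
  assumes \<beta>: "continuous_on UNIV \<beta>" and D: "continuous_on UNIV D"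
    and deriv: "\<And>v. ((\<lambda>s. \<beta> (v + s *\<^sub>R F)) has_vector_derivative D v) (at 0)"
    and supp: "\<And>v. r < norm v \<Longrightarrow> \<beta> v = 0" "\<And>v. r < norm v \<Longrightarrow> D v = 0" and r: "r > 0"
  obtains \<beta>n C where "\<And>n. test_fun (\<beta>n n)"
    "\<And>v. (\<lambda>n. \<beta>n n v) \<longlonglongrightarrow> \<beta> v" "\<And>v. (\<lambda>n. dir_deriv F (\<beta>n n) v) \<longlonglongrightarrow> D v"
    "\<And>n v. norm (\<beta>n n v) \<le> C * indicator (cball 0 (r + 1)) v"
    "\<And>n v. norm (dir_deriv F (\<beta>n n) v) \<le> C * indicator (cball 0 (r + 1)) v"
proof -
  have "\<forall>n. \<exists>\<eta>::'b \<Rightarrow> real. (\<forall>k. Ck k \<eta>) \<and> (\<forall>x. 0 \<le> \<eta> x) \<and> (\<forall>x. 1 / real (Suc n) \<le> norm x \<longrightarrow> \<eta> x = 0)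
      \<and> integrable lborel \<eta> \<and> (\<integral>x. \<eta> x \<partial>lborel) = 1"
    by (rule allI, rule mollifier[of "1 / real (Suc _)"], simp, blast)
  then obtain \<eta> :: "nat \<Rightarrow> 'b \<Rightarrow> real" where \<eta>: "\<And>n k. Ck k (\<eta> n)" "\<And>n x. 0 \<le> \<eta> n x"
      "\<And>n x. 1 / real (Suc n) \<le> norm x \<Longrightarrow> \<eta> n x = 0"
      "\<And>n. integrable lborel (\<eta> n)" "\<And>n. (\<integral>x. \<eta> n x \<partial>lborel) = 1"
    by metis
  have \<eta>c: "continuous_on UNIV (\<eta> n)" for n using \<eta>(1) Ck_continuous by blast
  have sup: "\<eta> n u = 0" if "1 < norm u" for n u
  proof (rule \<eta>(3))
    have "1 / real (Suc n) \<le> 1" by simp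
    then show "1 / real (Suc n) \<le> norm u" using that by linarith
  qed
  define \<beta>n where "\<beta>n n v = (\<integral>u. \<eta> n u *\<^sub>R \<beta> (v - u) \<partial>lborel)" for n v
  define Dn where "Dn n v = (\<integral>u. \<eta> n u *\<^sub>R D (v - u) \<partial>lborel)" for n v
  obtain C1 where C1: "C1 \<ge> 0" "\<And>v. norm (\<beta> v) \<le> C1"
    using bounded_continuous_bounded_support[OF \<beta> supp(1)] by blast
  obtain C2 where C2: "C2 \<ge> 0" "\<And>v. norm (D v) \<le> C2"
    using bounded_continuous_bounded_support[OF D supp(2)] by blast
  have bound: "norm (\<integral>u. \<eta> n u *\<^sub>R f (v - u) \<partial>lborel) \<le> max C1 C2 * indicator (cball 0 (r + 1)) v"
    if f: "continuous_on UNIV f" "\<And>v. r < norm v \<Longrightarrow> f v = 0" "\<And>v. norm (f v) \<le> max C1 C2" for f :: "'b \<Rightarrow> complex" and n v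
  proof (cases "norm v \<le> r + 1")
    case False
    have "\<eta> n u *\<^sub>R f (v - u) = 0" for u
    proof (cases "1 < norm u")
      case b: False
      have "norm v \<le> norm (v - u) + norm u" by norm
      then have "r < norm (v - u)" using b False by linarith
      then show ?thesis using f(2) by simp
    qed (simp add: sup)
    then have "(\<integral>u. \<eta> n u *\<^sub>R f (v - u) \<partial>lborel) = 0" by (simp only: Bochner_Integration.integral_zero)
    then show ?thesis using C1 by simp
  next
    case True
    have "norm (\<integral>u. \<eta> n u *\<^sub>R f (v - u) \<partial>lborel) \<le> (\<integral>u. \<eta> n u * max C1 C2 \<partial>lborel)"
    proof (rule order.trans[OF integral_norm_bound integral_mono])
      have "integrable lborel (\<lambda>u. \<eta> n u *\<^sub>R f (v - u))"
        by (rule integrable_continuous_bounded_support[where r = 1])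
          (auto intro!: continuous_intros \<eta>c continuous_on_compose2[OF f(1)] simp: sup)
      then show "integrable lborel (\<lambda>u. norm (\<eta> n u *\<^sub>R f (v - u)))" by (rule integrable_norm)
      show "norm (\<eta> n u *\<^sub>R f (v - u)) \<le> \<eta> n u * max C1 C2" for u
        using mult_left_mono[OF f(3)[of "v - u"] \<eta>(2)[of n u]] \<eta>(2)[of n u] by simp
    qed (use \<eta>(4) in simp)
    then show ?thesis using True \<eta>(5) by (simp add: mem_cball_0)
  qed
  define s where "s = (r + 1) *\<^sub>R (One::'b)"
  have inbox: "u \<in> cbox (- s) s" if "norm u \<le> r + 1" for u
    using that Basis_le_norm[of _ u] by (fastforce simp: mem_box s_def abs_le_iff inner_simps)
  have "\<beta>n n v = integral (cbox (- s) s) (\<lambda>u. \<eta> n (v - u) *\<^sub>R \<beta> u)" for n v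
  proof -
    let ?h = "\<lambda>u. \<eta> n (v - u) *\<^sub>R \<beta> u"
    have c: "continuous_on UNIV ?h"
      by (intro continuous_intros continuous_on_compose2[OF \<eta>c] \<beta>) auto
    have int: "integrable lborel ?h"
      by (rule integrable_continuous_bounded_support[OF c, of r]) (simp add: supp)
    have "\<beta>n n v = (\<integral>u. ?h (v - u) \<partial>lborel)" unfolding \<beta>n_def by simp
    also have "\<dots> = (\<integral>u. ?h u \<partial>lborel)"
      by (rule lborel_integral_reflect) (rule borel_measurable_continuous_onI[OF c])
    also have "\<dots> = integral UNIV ?h" using integral_lborel[OF int] by simp
    also have "\<dots> = integral UNIV (\<lambda>u. if u \<in> cbox (- s) s then ?h u else 0)"
      by (rule arg_cong[where f = "integral UNIV"]) (use inbox supp(1) in \<open>force simp: not_le\<close>)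
    also have "\<dots> = integral (cbox (- s) s) ?h" by (rule integral_restrict_UNIV)
    finally show ?thesis .
  qed
  then have \<beta>n_eq: "\<beta>n n = (\<lambda>v. integral (cbox (- s) s) (\<lambda>u. \<eta> n (v - u) *\<^sub>R \<beta> u))" for n by blast
  have smooth: "Ck k (\<beta>n n)" for k n unfolding \<beta>n_eq by (rule Ck_conv[OF \<beta> \<eta>(1)])
  have line: "((\<lambda>s. \<beta> (v + s *\<^sub>R F)) has_vector_derivative D (v + t *\<^sub>R F)) (at t)" for v t
  proof -
    have "((\<lambda>s. \<beta> ((v + t *\<^sub>R F) + s *\<^sub>R F)) has_vector_derivative D (v + t *\<^sub>R F)) (at (t - t))"
      using deriv[of "v + t *\<^sub>R F"] by simp
    moreover have "((\<lambda>s. s - t) has_real_derivative 1) (at t)" by (auto intro!: derivative_eq_intros)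
    ultimately have "((\<lambda>s. \<beta> ((v + t *\<^sub>R F) + (s - t) *\<^sub>R F)) has_vector_derivative 1 *\<^sub>R D (v + t *\<^sub>R F)) (at t)"
      using vector_diff_chain_at[of "\<lambda>s. s - t" 1 t "\<lambda>s. \<beta> ((v + t *\<^sub>R F) + s *\<^sub>R F)" "D (v + t *\<^sub>R F)"]
      by (simp add: o_def has_real_derivative_iff_has_vector_derivative)
    then show ?thesis by (simp add: algebra_simps)
  qed
  have "dir_deriv F (\<beta>n n) v = Dn n v" for n v
  proof -
    let ?B = "cbox (- One) (One::'b)"
    have res: "(\<integral>u. \<eta> n u *\<^sub>R f (v - u) \<partial>lborel) = integral ?B (\<lambda>u. \<eta> n u *\<^sub>R f (v - u))"
      if f: "continuous_on UNIV f" for f :: "'b \<Rightarrow> complex" and v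
    proof -
      let ?h = "\<lambda>u. \<eta> n u *\<^sub>R f (v - u)"
      have c: "continuous_on UNIV ?h"
        by (intro continuous_intros continuous_on_compose2[OF f] \<eta>c) auto
      have int: "integrable lborel ?h"
        by (rule integrable_continuous_bounded_support[OF c, of 1]) (simp add: sup)
      have "u \<in> ?B" if "norm u \<le> 1" for u :: 'b
        using that Basis_le_norm[of _ u] by (fastforce simp: mem_box abs_le_iff inner_simps)
      then have "integral UNIV ?h = integral UNIV (\<lambda>u. if u \<in> ?B then ?h u else 0)"
        by (intro arg_cong[where f = "integral UNIV"]) (use sup in \<open>force simp: not_le\<close>)
      then show ?thesis using integral_lborel[OF int] by (simp only: integral_restrict_UNIV)
    qed
    have "((\<lambda>s. integral ?B (\<lambda>u. \<eta> n u *\<^sub>R \<beta> (v + s *\<^sub>R F - u))) has_vector_derivative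
        integral ?B (\<lambda>u. \<eta> n u *\<^sub>R D (v + 0 *\<^sub>R F - u))) (at 0 within UNIV)"
    proof (rule leibniz_rule_vector_derivative)
      fix x :: real and t :: 'b
      show "((\<lambda>x. \<eta> n t *\<^sub>R \<beta> (v + x *\<^sub>R F - t)) has_vector_derivative \<eta> n t *\<^sub>R D (v + x *\<^sub>R F - t)) (at x within UNIV)"
        using bounded_linear.has_vector_derivative[OF bounded_linear_scaleR_right line[of "v - t" x], of "\<eta> n t"]
        by (simp add: algebra_simps)
      show "(\<lambda>u. \<eta> n u *\<^sub>R \<beta> (v + x *\<^sub>R F - u)) integrable_on ?B"
        by (intro integrable_continuous continuous_intros continuous_on_compose2[OF \<beta>] continuous_on_subset[OF \<eta>c]) auto
      show "continuous_on (UNIV \<times> ?B) (\<lambda>(x, t). \<eta> n t *\<^sub>R D (v + x *\<^sub>R F - t))"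
        unfolding split_beta
        by (intro continuous_intros continuous_on_compose2[OF D] continuous_on_compose2[OF \<eta>c]) auto
    qed auto
    then have 1: "((\<lambda>s. \<beta>n n (v + s *\<^sub>R F)) has_vector_derivative Dn n v) (at 0)"
      unfolding \<beta>n_def Dn_def res[OF \<beta>] res[OF D] by simp
    have "\<beta>n n differentiable (at v)" using smooth[of 1 n] by simp
    from has_derivative_dir_deriv[OF this]
    have "(\<beta>n n has_derivative (\<lambda>w. dir_deriv w (\<beta>n n) v)) (at (v + 0 *\<^sub>R F))" by simp
    moreover have "((\<lambda>s::real. v + s *\<^sub>R F) has_derivative (\<lambda>s. s *\<^sub>R F)) (at 0)"
      by (auto intro!: derivative_eq_intros)
    ultimately have "((\<lambda>s. \<beta>n n (v + s *\<^sub>R F)) has_derivative (\<lambda>s. dir_deriv (s *\<^sub>R F) (\<beta>n n) v)) (at 0)"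
      using has_derivative_compose by blast
    then have "((\<lambda>s. \<beta>n n (v + s *\<^sub>R F)) has_vector_derivative dir_deriv F (\<beta>n n) v) (at 0)"
      unfolding has_vector_derivative_def
      using dir_deriv_scale_direction[OF \<open>\<beta>n n differentiable (at v)\<close>] by simp
    with 1 show ?thesis using vector_derivative_unique_at by blast
  qed
  then have Dn: "dir_deriv F (\<beta>n n) = Dn n" for n by blast
  have b1: "norm (\<beta>n n v) \<le> max C1 C2 * indicator (cball 0 (r + 1)) v" for n v
    unfolding \<beta>n_def by (rule bound[OF \<beta> supp(1)]) (use C1(2) max.coboundedI1 in auto)
  have b2: "norm (Dn n v) \<le> max C1 C2 * indicator (cball 0 (r + 1)) v" for n v
    unfolding Dn_def by (rule bound[OF D supp(2)]) (use C2(2) max.coboundedI2 in auto)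
  show thesis
  proof (rule that)
    show "test_fun (\<beta>n n)" for n
      unfolding test_fun_def
    proof (intro conjI allI smooth)
      show "compactly_supported (\<beta>n n)"
      proof (rule compactly_supportedI)
        fix x :: 'b assume "r + 1 < norm x"
        then show "\<beta>n n x = 0" using b1[of n x] by simp
      qed
    qed
    show "(\<lambda>n. \<beta>n n v) \<longlonglongrightarrow> \<beta> v" for v
      unfolding \<beta>n_def by (rule continuous_conv_approx[OF \<beta> \<eta>c \<eta>(2,3,5)])
    show "(\<lambda>n. dir_deriv F (\<beta>n n) v) \<longlonglongrightarrow> D v" for v
      unfolding Dn Dn_def by (rule continuous_conv_approx[OF D \<eta>c \<eta>(2,3,5)])
  qed (use b1 b2 Dn in auto)
qed

section \<open>Van der Corput estimates\<close>

text \<open>Where the phase has no critical point, \<open>e^(iQ)\<close> is the derivative of \<open>e^(iQ) / (\<i> q)\<close> up to an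
error \<open>e^(iQ) q' / (\<i> q\<^sup>2)\<close>.\<close>
lemma oscillatory_by_parts:
  fixes Q q q1 :: "real \<Rightarrow> real"
  assumes ab: "a \<le> b"
    and Q: "\<And>x. x \<in> {a..b} \<Longrightarrow> (Q has_real_derivative q x) (at x within {a..b})"
    and q: "\<And>x. x \<in> {a..b} \<Longrightarrow> (q has_real_derivative q1 x) (at x within {a..b})"
    and q1: "continuous_on {a..b} q1"
    and \<delta>: "\<delta> > 0" "\<And>x. x \<in> {a..b} \<Longrightarrow> \<delta> \<le> \<bar>q x\<bar>"
  shows "norm (integral {a..b} (\<lambda>x. cis (Q x))) \<le> 2 / \<delta> + integral {a..b} (\<lambda>x. \<bar>q1 x\<bar> / (q x)\<^sup>2)"
proof -
  have Qc: "continuous_on {a..b} Q" and qc: "continuous_on {a..b} q"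
    using DERIV_continuous_on[OF Q] DERIV_continuous_on[OF q] by auto
  have nz: "q x \<noteq> 0" if "x \<in> {a..b}" for x using \<delta> that by fastforce
  define G where "G x = cis (Q x) * of_real (inverse (q x))" for x
  have D: "(G has_vector_derivative \<i> * cis (Q x) - cis (Q x) * of_real (q1 x / (q x)\<^sup>2)) (at x within {a..b})"
    if x: "x \<in> {a..b}" for x
  proof -
    have 1: "((\<lambda>x. cis (Q x)) has_vector_derivative of_real (q x) * (\<i> * cis (Q x))) (at x within {a..b})"
      using has_derivative_cis[OF Q[OF x, unfolded has_field_derivative_def]]
      unfolding has_vector_derivative_def by (simp add: scaleR_conv_of_real mult_ac)
    have "((\<lambda>x. inverse (q x)) has_real_derivative - (q1 x / (q x)\<^sup>2)) (at x within {a..b})"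
      using DERIV_inverse_fun[OF q[OF x] nz[OF x]] by (simp add: field_simps power2_eq_square)
    then have 2: "((\<lambda>x. complex_of_real (inverse (q x))) has_vector_derivative of_real (- (q1 x / (q x)\<^sup>2))) (at x within {a..b})"
      by (rule has_vector_derivative_of_real)
    from has_vector_derivative_mult[OF 1 2] show ?thesis
      unfolding G_def by (rule has_vector_derivative_eq_rhs) (use nz[OF x] in \<open>simp add: field_simps\<close>)
  qed
  have *: "((\<lambda>x. \<i> * cis (Q x) - cis (Q x) * of_real (q1 x / (q x)\<^sup>2)) has_integral (G b - G a)) {a..b}"
    by (rule fundamental_theorem_of_calculus[OF ab D])
  have i1: "(\<lambda>x. cis (Q x)) integrable_on {a..b}"
    by (intro integrable_continuous_real continuous_intros Qc)
  have i2: "(\<lambda>x. cis (Q x) * of_real (q1 x / (q x)\<^sup>2)) integrable_on {a..b}"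
    by (intro integrable_continuous_real continuous_intros Qc q1 qc) (use nz in auto)
  have i3: "(\<lambda>x. \<bar>q1 x\<bar> / (q x)\<^sup>2) integrable_on {a..b}"
    by (intro integrable_continuous_real continuous_intros q1 qc) (use nz in auto)
  have "\<i> * integral {a..b} (\<lambda>x. cis (Q x)) - integral {a..b} (\<lambda>x. cis (Q x) * of_real (q1 x / (q x)\<^sup>2)) = G b - G a"
    using integral_unique[OF *] i1 i2 by (simp add: integral_diff)
  then have "\<i> * integral {a..b} (\<lambda>x. cis (Q x)) = G b - G a + integral {a..b} (\<lambda>x. cis (Q x) * of_real (q1 x / (q x)\<^sup>2))"
    by (simp add: algebra_simps)
  then have "norm (integral {a..b} (\<lambda>x. cis (Q x))) \<le> norm (G b) + norm (G a) + norm (integral {a..b} (\<lambda>x. cis (Q x) * of_real (q1 x / (q x)\<^sup>2)))"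
    by (metis (no_types, lifting) norm_ii norm_mult mult_1 norm_triangle_ineq norm_triangle_ineq4 add_mono_thms_linordered_semiring(3) order.trans)
  moreover have "norm (G x) \<le> 1 / \<delta>" if "x \<in> {a..b}" for x
    using \<delta>(1) \<delta>(2)[OF that] by (simp add: G_def norm_mult norm_inverse norm_divide field_simps abs_inverse)
  moreover have "norm (integral {a..b} (\<lambda>x. cis (Q x) * of_real (q1 x / (q x)\<^sup>2))) \<le> integral {a..b} (\<lambda>x. \<bar>q1 x\<bar> / (q x)\<^sup>2)"
    by (rule integral_norm_bound_integral[OF i2 i3]) (simp add: norm_mult norm_divide norm_power)
  ultimately show ?thesis using ab by (smt (verit, best) atLeastAtMost_iff field_sum_of_halves add_divide_distrib)
qed

lemma abs_ge_imp_constant_sign: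
  fixes g :: "real \<Rightarrow> real"
  assumes g: "continuous_on {a..b} g" and \<mu>: "\<mu> > 0" "\<And>x. x \<in> {a..b} \<Longrightarrow> \<mu> \<le> \<bar>g x\<bar>"
  shows "(\<forall>x\<in>{a..b}. \<mu> \<le> g x) \<or> (\<forall>x\<in>{a..b}. g x \<le> - \<mu>)"
proof (rule ccontr)
  assume "\<not> ?thesis"
  then obtain x y where xy: "x \<in> {a..b}" "y \<in> {a..b}" "g x < \<mu>" "- \<mu> < g y" by fastforce
  then have s: "g x < 0" "0 < g y" using \<mu>(2)[of x] \<mu>(2)[of y] \<mu>(1) by linarith+
  have "connected (g ` {a..b})" by (rule connected_continuous_image[OF g]) simp
  then have "0 \<in> g ` {a..b}" using s xy unfolding connected_iff_interval
    by (meson image_eqI less_imp_le)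
  then show False using \<mu> by fastforce
qed

text \<open>A function whose derivative stays away from \<open>0\<close> is strictly monotone with a definite rate. The point
\<open>x\<^sub>0\<close> is its zero, or the endpoint nearest to one if it has none; away from \<open>x\<^sub>0\<close> the function is large.\<close>
lemma linear_growth_from_point:
  fixes p p' :: "real \<Rightarrow> real"
  assumes ab: "a \<le> b" and \<mu>: "\<mu> > 0"
    and p: "\<And>x. x \<in> {a..b} \<Longrightarrow> (p has_real_derivative p' x) (at x within {a..b})"
    and p': "continuous_on {a..b} p'" "\<And>x. x \<in> {a..b} \<Longrightarrow> \<mu> \<le> \<bar>p' x\<bar>"
  obtains x0 where "x0 \<in> {a..b}" "\<And>x. x \<in> {a..b} \<Longrightarrow> \<mu> * \<bar>x - x0\<bar> \<le> \<bar>p x\<bar>"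
proof -
  have main: "\<exists>x0\<in>{a..b}. \<forall>x\<in>{a..b}. \<mu> * \<bar>x - x0\<bar> \<le> \<bar>r x\<bar>"
    if r: "\<And>x. x \<in> {a..b} \<Longrightarrow> (r has_real_derivative r' x) (at x within {a..b})"
      and r': "\<And>x. x \<in> {a..b} \<Longrightarrow> \<mu> \<le> r' x" for r r' :: "real \<Rightarrow> real"
  proof -
    have grow: "\<mu> * (y - x) \<le> r y - r x" if xy: "a \<le> x" "x \<le> y" "y \<le> b" for x y
    proof -
      have "\<exists>z\<in>{x..y}. r y - r x = (\<lambda>h. h * r' z) (y - x)"
      proof (rule mvt_very_simple[OF xy(2)])
        fix z assume "x \<le> z" "z \<le> y"
        then have "(r has_real_derivative r' z) (at z within {x..y})"
          using xy by (intro DERIV_subset[OF r]) auto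
        then show "(r has_derivative (\<lambda>h. h * r' z)) (at z within {x..y})"
          by (simp add: has_field_derivative_def mult.commute[of _ "r' z"])
      qed
      then obtain z where "z \<in> {x..y}" "r y - r x = (y - x) * r' z" by blast
      moreover have "(y - x) * \<mu> \<le> (y - x) * r' z" using r'[of z] xy \<open>z \<in> {x..y}\<close> by (intro mult_left_mono) auto
      ultimately show ?thesis by (simp add: mult.commute)
    qed
    have rc: "continuous_on {a..b} r" using DERIV_continuous_on[OF r] by auto
    consider "0 \<le> r a" | "r b \<le> 0" | "r a < 0" "0 < r b" by linarith
    then show ?thesis
    proof cases
      case 1
      have "\<mu> * \<bar>x - a\<bar> \<le> \<bar>r x\<bar>" if "x \<in> {a..b}" for x
        using grow[of a x] that 1 by auto
      then show ?thesis using ab by (intro bexI[of _ a]) auto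
    next
      case 2
      have "\<mu> * \<bar>x - b\<bar> \<le> \<bar>r x\<bar>" if "x \<in> {a..b}" for x
        using grow[of x b] that 2 by auto
      then show ?thesis using ab by (intro bexI[of _ b]) auto
    next
      case 3
      obtain z where z: "a \<le> z" "z \<le> b" "r z = 0"
        using IVT'[of r a 0 b] 3 ab rc by auto
      have "\<mu> * \<bar>x - z\<bar> \<le> \<bar>r x\<bar>" if "x \<in> {a..b}" for x
        using grow[of x z] grow[of z x] that z by (cases "x \<le> z") auto
      then show ?thesis using z by (intro bexI[of _ z]) auto
    qed
  qed
  from abs_ge_imp_constant_sign[OF p'(1) \<mu> p'(2)]
  have "\<exists>x0\<in>{a..b}. \<forall>x\<in>{a..b}. \<mu> * \<bar>x - x0\<bar> \<le> \<bar>p x\<bar>"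
  proof
    assume "\<forall>x\<in>{a..b}. \<mu> \<le> p' x"
    then show ?thesis using main[of p p'] p by blast
  next
    assume "\<forall>x\<in>{a..b}. p' x \<le> - \<mu>"
    then show ?thesis using main[of "\<lambda>x. - p x" "\<lambda>x. - p' x"] p by (force intro: DERIV_minus)
  qed
  then show thesis using that by blast
qed

text \<open>The exceptional interval of half-length \<open>l\<close> around \<open>x\<^sub>0\<close> is estimated by its length, and
the two remaining intervals by hypothesis. This is the splitting in the induction of van der Corput's lemma.\<close>
lemma norm_integral_away_from_point:
  fixes u :: "real \<Rightarrow> complex"
  assumes u: "continuous_on {a..b} u" "\<And>x. x \<in> {a..b} \<Longrightarrow> norm (u x) \<le> 1"
    and x0: "x0 \<in> {a..b}" and l: "0 \<le> l" and B: "0 \<le> B"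
    and away: "\<And>c d. c \<le> d \<Longrightarrow> {c..d} \<subseteq> {a..b} \<Longrightarrow> (\<And>x. x \<in> {c..d} \<Longrightarrow> l \<le> \<bar>x - x0\<bar>) \<Longrightarrow>
      norm (integral {c..d} u) \<le> B"
  shows "norm (integral {a..b} u) \<le> 2 * B + 2 * l"
proof -
  define c where "c = max a (x0 - l)"
  define d where "d = min b (x0 + l)"
  have o: "a \<le> c" "c \<le> d" "d \<le> b" "d - c \<le> 2 * l" using x0 l by (auto simp: c_def d_def)
  have i: "u integrable_on {a..b}" using u(1) by (rule integrable_continuous_real)
  have i2: "u integrable_on {c..b}" using i o by (meson integrable_subinterval_real atLeastatMost_subset_iff order.refl)
  have eq: "integral {a..b} u = integral {a..c} u + (integral {c..d} u + integral {d..b} u)"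
    using Henstock_Kurzweil_Integration.integral_combine[of a c b u] Henstock_Kurzweil_Integration.integral_combine[of c d b u] i i2 o by auto
  have "norm (integral {a..c} u) \<le> B"
  proof (cases "a \<le> x0 - l")
    case True
    then show ?thesis using x0 l by (intro away) (auto simp: c_def)
  next
    case False
    then show ?thesis using B by (simp add: c_def)
  qed
  moreover have "norm (integral {d..b} u) \<le> B"
  proof (cases "x0 + l \<le> b")
    case True
    then show ?thesis using x0 l by (intro away) (auto simp: d_def)
  next
    case False
    then show ?thesis using B by (simp add: d_def)
  qed
  moreover have "norm (integral {c..d} u) \<le> 1 * (d - c)"
    using o u by (intro integral_bound) (auto intro: continuous_on_subset)
  moreover have "norm (integral {a..b} u) \<le>
      norm (integral {a..c} u) + (norm (integral {c..d} u) + norm (integral {d..b} u))"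
    unfolding eq by (intro order.trans[OF norm_triangle_ineq] add_left_mono norm_triangle_ineq)
  moreover have "norm (integral {c..d} u) \<le> 2 * l"
    using order.trans[OF calculation(3), of "2 * l"] o(4) by simp
  ultimately have "norm (integral {a..b} u) \<le> B + (2 * l + B)"
    by (meson add_mono order.trans)
  then show ?thesis by simp
qed

text \<open>The phase \<open>Q\<close> is \<open>n + 1\<close> times continuously differentiable on \<open>I\<close>, with derivatives \<open>q 0, \<dots>, q n\<close>.\<close>
definition derivative_chain :: "real set \<Rightarrow> nat \<Rightarrow> (real \<Rightarrow> real) \<Rightarrow> (nat \<Rightarrow> real \<Rightarrow> real) \<Rightarrow> bool" where
  "derivative_chain I n Q q \<longleftrightarrow>
    (\<forall>x\<in>I. (Q has_real_derivative q 0 x) (at x within I)) \<and>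
    (\<forall>j<n. \<forall>x\<in>I. (q j has_real_derivative q (Suc j) x) (at x within I)) \<and>
    continuous_on I (q n)"

lemma derivative_chain_subset:
  assumes "derivative_chain I n Q q" "J \<subseteq> I"
  shows "derivative_chain J n Q q"
  using assms DERIV_subset[of _ _ _ I J] continuous_on_subset[of I _ J]
  unfolding derivative_chain_def by blast

lemma derivative_chain_continuous:
  assumes "derivative_chain I n Q q"
  shows "continuous_on I Q" and "j \<le> n \<Longrightarrow> continuous_on I (q j)"
proof -
  show "continuous_on I Q"
    using assms DERIV_continuous_on[of I Q "q 0"] unfolding derivative_chain_def by blast
  show "continuous_on I (q j)" if "j \<le> n"
    using assms that DERIV_continuous_on[of I "q j" "q (Suc j)"] le_neq_implies_less[of j n]
    unfolding derivative_chain_def by (cases "j = n") auto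
qed

lemma derivative_chain_mono:
  "derivative_chain I n Q q \<Longrightarrow> m \<le> n \<Longrightarrow> derivative_chain I m Q q"
  using derivative_chain_continuous(2)[of I n Q q m] unfolding derivative_chain_def by auto

text \<open>Induction on the order of the derivative that is bounded below. Off an interval of length
\<open>2 \<delta> / \<mu>\<close> the derivative of one order less is at least \<open>\<delta>\<close>, so the induction hypothesis applies there,
and \<open>\<delta>\<close> is chosen to balance the two contributions. In the base case the second derivative of the phase has
constant sign, so that the error term of the integration by parts is itself an exact derivative.\<close>
lemma van_der_Corput:
  fixes q :: "nat \<Rightarrow> real \<Rightarrow> real"
  assumes "a \<le> b" "\<mu> > 0" "derivative_chain {a..b} (Suc n) Q q" "\<forall>x\<in>{a..b}. \<mu> \<le> \<bar>q (Suc n) x\<bar>"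
  shows "norm (integral {a..b} (\<lambda>x. cis (Q x))) \<le> (12 * 2 ^ n - 2) * \<mu> powr (- 1 / real (n + 2))"
  using assms
proof (induction n arbitrary: a b \<mu>)
  case 0
  note ab = 0(1) and \<mu> = 0(2) and chain = 0(3)
  have Q: "\<forall>x\<in>{a..b}. (Q has_real_derivative q 0 x) (at x within {a..b})"
    and q: "\<forall>x\<in>{a..b}. (q 0 has_real_derivative q (Suc 0) x) (at x within {a..b})"
    and q1: "continuous_on {a..b} (q (Suc 0))" "\<forall>x\<in>{a..b}. \<mu> \<le> \<bar>q (Suc 0) x\<bar>"
    using chain 0(4) unfolding derivative_chain_def by auto
  have Qc: "continuous_on {a..b} Q" and qc: "continuous_on {a..b} (q 0)"
    using derivative_chain_continuous[OF chain] by auto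
  obtain x0 where x0: "x0 \<in> {a..b}" "\<And>x. x \<in> {a..b} \<Longrightarrow> \<mu> * \<bar>x - x0\<bar> \<le> \<bar>q 0 x\<bar>"
    using linear_growth_from_point[OF ab \<mu>, of "q 0" "q (Suc 0)"] q q1 by auto
  \<comment> \<open>This choice balances \<open>1 / \<delta>\<close>, from the integration by parts, with \<open>\<delta> / \<mu>\<close>, the exceptional length.\<close>
  define \<delta> where "\<delta> = sqrt \<mu>"
  have \<delta>: "\<delta> > 0" "\<delta> * \<delta> = \<mu>" using \<mu> by (auto simp: \<delta>_def)
  have "norm (integral {a..b} (\<lambda>x. cis (Q x))) \<le> 2 * (4 / \<delta>) + 2 * (\<delta> / \<mu>)"
  proof (rule norm_integral_away_from_point[OF _ _ x0(1)])
    fix c d assume cd: "c \<le> d" "{c..d} \<subseteq> {a..b}" "\<And>x. x \<in> {c..d} \<Longrightarrow> \<delta> / \<mu> \<le> \<bar>x - x0\<bar>"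
    have ge: "\<delta> \<le> \<bar>q 0 x\<bar>" if "x \<in> {c..d}" for x
    proof -
      have "\<delta> \<le> \<mu> * \<bar>x - x0\<bar>" using cd(3)[OF that] \<mu> by (simp add: field_simps)
      also have "\<dots> \<le> \<bar>q 0 x\<bar>" using x0(2) that cd(2) by blast
      finally show ?thesis .
    qed
    have sub: "(f has_real_derivative f') (at x within {a..b}) \<Longrightarrow> (f has_real_derivative f') (at x within {c..d})" for f f' x
      using cd(2) DERIV_subset by blast
    have q1c: "continuous_on {c..d} (q (Suc 0))" using q1(1) cd(2) continuous_on_subset by blast
    have nz: "q 0 x \<noteq> 0" if "x \<in> {c..d}" for x using ge[OF that] \<delta> by auto
    have "((\<lambda>x. q (Suc 0) x / (q 0 x)\<^sup>2) has_integral (- inverse (q 0 d)) - (- inverse (q 0 c))) {c..d}"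
    proof (rule fundamental_theorem_of_calculus[OF cd(1)])
      fix x assume x: "x \<in> {c..d}"
      have "(q 0 has_real_derivative q (Suc 0) x) (at x within {c..d})" using q x cd(2) sub by blast
      from DERIV_minus[OF DERIV_inverse_fun[OF this nz[OF x]]]
      show "((\<lambda>x. - inverse (q 0 x)) has_vector_derivative q (Suc 0) x / (q 0 x)\<^sup>2) (at x within {c..d})"
        by (simp add: has_real_derivative_iff_has_vector_derivative[symmetric] field_simps power2_eq_square)
    qed
    then have ftc: "integral {c..d} (\<lambda>x. q (Suc 0) x / (q 0 x)\<^sup>2) = inverse (q 0 c) - inverse (q 0 d)"
      by (simp add: integral_unique)
    have inv: "\<bar>inverse (q 0 x)\<bar> \<le> 1 / \<delta>" if "x \<in> {c..d}" for x
      using ge[OF that] \<delta>(1) by (simp add: abs_inverse field_simps)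
    have "integral {c..d} (\<lambda>x. \<bar>q (Suc 0) x\<bar> / (q 0 x)\<^sup>2) \<le> 2 / \<delta>"
    proof -
      consider "\<forall>x\<in>{a..b}. \<mu> \<le> q (Suc 0) x" | "\<forall>x\<in>{a..b}. q (Suc 0) x \<le> - \<mu>"
        using abs_ge_imp_constant_sign[OF q1(1) \<mu>] q1(2) by blast
      then have "integral {c..d} (\<lambda>x. \<bar>q (Suc 0) x\<bar> / (q 0 x)\<^sup>2) = \<bar>integral {c..d} (\<lambda>x. q (Suc 0) x / (q 0 x)\<^sup>2)\<bar>"
      proof cases
        case 1
        then have pos: "0 \<le> q (Suc 0) x" if "x \<in> {c..d}" for x using that cd(2) \<mu> by fastforce
        then have "integral {c..d} (\<lambda>x. \<bar>q (Suc 0) x\<bar> / (q 0 x)\<^sup>2) = integral {c..d} (\<lambda>x. q (Suc 0) x / (q 0 x)\<^sup>2)"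
          by (intro integral_cong) simp
        moreover have "0 \<le> integral {c..d} (\<lambda>x. \<bar>q (Suc 0) x\<bar> / (q 0 x)\<^sup>2)"
          by (rule integral_nonneg) (auto intro!: integrable_continuous_real continuous_intros q1c continuous_on_subset[OF qc cd(2)] simp: nz)
        ultimately show ?thesis by linarith
      next
        case 2
        then have pos: "q (Suc 0) x \<le> 0" if "x \<in> {c..d}" for x using that cd(2) \<mu> by fastforce
        then have "integral {c..d} (\<lambda>x. \<bar>q (Suc 0) x\<bar> / (q 0 x)\<^sup>2) = integral {c..d} (\<lambda>x. - (q (Suc 0) x / (q 0 x)\<^sup>2))"
          by (intro integral_cong) simp
        moreover have "0 \<le> integral {c..d} (\<lambda>x. \<bar>q (Suc 0) x\<bar> / (q 0 x)\<^sup>2)"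
          by (rule integral_nonneg) (auto intro!: integrable_continuous_real continuous_intros q1c continuous_on_subset[OF qc cd(2)] simp: nz)
        ultimately show ?thesis by simp
      qed
      also have "\<dots> \<le> 2 / \<delta>" 
        unfolding ftc using inv[of c] inv[of d] cd(1) abs_triangle_ineq4[of "inverse (q 0 c)" "inverse (q 0 d)"]
        by (smt (verit) add_divide_distrib atLeastAtMost_iff)
      finally show ?thesis .
    qed
    moreover have "norm (integral {c..d} (\<lambda>x. cis (Q x))) \<le> 2 / \<delta> + integral {c..d} (\<lambda>x. \<bar>q (Suc 0) x\<bar> / (q 0 x)\<^sup>2)"
      by (rule oscillatory_by_parts[OF cd(1) _ _ q1c \<delta>(1) ge]) (use sub Q q cd(2) in blast)+
    ultimately show "norm (integral {c..d} (\<lambda>x. cis (Q x))) \<le> 4 / \<delta>" by linarith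
  qed (use \<delta> \<mu> in \<open>auto intro!: continuous_intros Qc\<close>)
  also have "\<dots> = 10 / \<delta>" using \<delta> \<mu> by (simp add: field_simps)
  also have "\<dots> = (12 * 2 ^ 0 - 2) * \<mu> powr (- 1 / real (0 + 2))"
    using \<mu> by (simp add: \<delta>_def powr_half_sqrt powr_minus_divide)
  finally show ?case .
next
  case (Suc n)
  note ab = Suc.prems(1) and \<mu> = Suc.prems(2) and chain = Suc.prems(3)
  have q: "\<forall>x\<in>{a..b}. (q (Suc n) has_real_derivative q (Suc (Suc n)) x) (at x within {a..b})"
    and qn: "continuous_on {a..b} (q (Suc (Suc n)))" "\<forall>x\<in>{a..b}. \<mu> \<le> \<bar>q (Suc (Suc n)) x\<bar>"
    using chain Suc.prems(4) unfolding derivative_chain_def by auto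
  have Qc: "continuous_on {a..b} Q" using derivative_chain_continuous[OF chain] by auto
  define C :: real where "C = 12 * 2 ^ n - 2"
  have C: "C \<ge> 0" using two_realpow_ge_one[of n] unfolding C_def by linarith
  obtain x0 where x0: "x0 \<in> {a..b}" "\<And>x. x \<in> {a..b} \<Longrightarrow> \<mu> * \<bar>x - x0\<bar> \<le> \<bar>q (Suc n) x\<bar>"
    using linear_growth_from_point[OF ab \<mu>, of "q (Suc n)" "q (Suc (Suc n))"] q qn by auto
  \<comment> \<open>Here \<open>\<delta>^(-1/(n+2))\<close> and \<open>\<delta> / \<mu>\<close> are both \<open>\<mu>^(-1/(n+3))\<close>.\<close>
  define \<delta> where "\<delta> = \<mu> powr (real (n + 2) / real (n + 3))"
  have \<delta>: "\<delta> > 0" using \<mu> by (simp add: \<delta>_def)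
  have e1: "\<delta> powr (- 1 / real (n + 2)) = \<mu> powr (- 1 / real (n + 3))"
    unfolding \<delta>_def powr_powr by (rule arg_cong[where f = "(powr) \<mu>"]) (simp add: field_simps)
  have "\<delta> / \<mu> = \<mu> powr (real (n + 2) / real (n + 3) - 1)"
    using \<mu> by (simp add: \<delta>_def powr_diff)
  also have "real (n + 2) / real (n + 3) - 1 = - 1 / real (n + 3)" by (simp add: field_simps)
  finally have e2: "\<delta> / \<mu> = \<mu> powr (- 1 / real (n + 3))" .
  have "norm (integral {a..b} (\<lambda>x. cis (Q x))) \<le> 2 * (C * \<delta> powr (- 1 / real (n + 2))) + 2 * (\<delta> / \<mu>)"
  proof (rule norm_integral_away_from_point[OF _ _ x0(1)])
    fix c d assume cd: "c \<le> d" "{c..d} \<subseteq> {a..b}" "\<And>x. x \<in> {c..d} \<Longrightarrow> \<delta> / \<mu> \<le> \<bar>x - x0\<bar>"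
    have ge: "\<delta> \<le> \<bar>q (Suc n) x\<bar>" if "x \<in> {c..d}" for x
    proof -
      have "\<delta> \<le> \<mu> * \<bar>x - x0\<bar>" using cd(3)[OF that] \<mu> by (simp add: field_simps)
      also have "\<dots> \<le> \<bar>q (Suc n) x\<bar>" using x0(2) that cd(2) by blast
      finally show ?thesis .
    qed
    show "norm (integral {c..d} (\<lambda>x. cis (Q x))) \<le> C * \<delta> powr (- 1 / real (n + 2))"
      unfolding C_def using ge derivative_chain_subset[OF derivative_chain_mono[OF chain] cd(2), of "Suc n"]
      by (intro Suc.IH[OF cd(1) \<delta>]) auto
  qed (use \<delta> \<mu> C in \<open>auto intro!: continuous_intros Qc\<close>)
  also have "\<dots> = (12 * 2 ^ Suc n - 2) * \<mu> powr (- 1 / real (Suc n + 2))"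
    unfolding e1 e2 by (simp add: C_def algebra_simps numeral_eq_Suc)
  finally show ?case .
qed

text \<open>This covers a lower bound on the first derivative of the phase. In place of the monotonicity of that
derivative, which van der Corput's lemma would require, an upper bound on the second derivative is used.\<close>
lemma nonstationary_bound:
  fixes Q q q1 :: "real \<Rightarrow> real"
  assumes ab: "a \<le> b"
    and Q: "\<And>x. x \<in> {a..b} \<Longrightarrow> (Q has_real_derivative q x) (at x within {a..b})"
    and q: "\<And>x. x \<in> {a..b} \<Longrightarrow> (q has_real_derivative q1 x) (at x within {a..b})"
    and q1: "continuous_on {a..b} q1" "\<And>x. x \<in> {a..b} \<Longrightarrow> \<bar>q1 x\<bar> \<le> K"
    and \<delta>: "\<delta> > 0" "\<And>x. x \<in> {a..b} \<Longrightarrow> \<delta> \<le> \<bar>q x\<bar>"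
  shows "norm (integral {a..b} (\<lambda>x. cis (Q x))) \<le> 2 / \<delta> + K / \<delta>\<^sup>2 * (b - a)"
proof -
  have qc: "continuous_on {a..b} q" using DERIV_continuous_on[OF q] by auto
  have nz: "q x \<noteq> 0" if "x \<in> {a..b}" for x using \<delta> that by fastforce
  have "0 \<le> K" using q1(2)[of a] ab by auto
  have le: "\<bar>q1 x\<bar> / (q x)\<^sup>2 \<le> K / \<delta>\<^sup>2" if x: "x \<in> {a..b}" for x
  proof (rule frac_le)
    show "\<delta>\<^sup>2 \<le> (q x)\<^sup>2" using \<delta> x by (simp add: abs_le_square_iff[symmetric])
  qed (use q1(2) x \<delta> \<open>0 \<le> K\<close> in auto)
  have "integral {a..b} (\<lambda>x. \<bar>q1 x\<bar> / (q x)\<^sup>2) \<le> integral {a..b} (\<lambda>x. K / \<delta>\<^sup>2)"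
    by (rule integral_le) (auto intro!: integrable_continuous_real continuous_intros q1(1) qc le simp: nz)
  also have "\<dots> = K / \<delta>\<^sup>2 * (b - a)" using ab by simp
  finally show ?thesis using oscillatory_by_parts[OF ab Q q q1(1) \<delta>] by linarith
qed

text \<open>The first two summands come from \<open>nonstationary_bound\<close> and the others from \<open>van_der_Corput\<close>, with lower bounds
of size \<open>e\<close>. What matters is that the constant depends on \<open>\<gamma>\<close>, \<open>e\<close> and \<open>B\<close> alone.\<close>
definition oscillation_const :: "nat \<Rightarrow> real \<Rightarrow> real \<Rightarrow> real" where
  "oscillation_const \<gamma> e B = 2 / e + B / e\<^sup>2 + (\<Sum>n<\<gamma>. (12 * 2 ^ n - 2) * e powr (- 1 / real (n + 2)))"

lemma oscillation_const_nonneg: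
  assumes "e > 0" "B \<ge> 0"
  shows "2 / e + B / e\<^sup>2 \<le> oscillation_const \<gamma> e B"
    and "n < \<gamma> \<Longrightarrow> (12 * 2 ^ n - 2) * e powr (- 1 / real (n + 2)) \<le> oscillation_const \<gamma> e B"
    and "0 \<le> oscillation_const \<gamma> e B"
proof -
  have pos: "0 \<le> (12 * 2 ^ n - 2) * e powr (- 1 / real (n + 2))" for n
  proof (rule mult_nonneg_nonneg)
    show "0 \<le> 12 * 2 ^ n - (2::real)" using two_realpow_ge_one[of n] by linarith
  qed simp
  then have s: "0 \<le> (\<Sum>n<\<gamma>. (12 * 2 ^ n - 2) * e powr (- 1 / real (n + 2)))" by (intro sum_nonneg)
  have "0 \<le> 2 / e + B / e\<^sup>2" using assms by simp
  then show "2 / e + B / e\<^sup>2 \<le> oscillation_const \<gamma> e B" "0 \<le> oscillation_const \<gamma> e B"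
    using s unfolding oscillation_const_def by linarith+
  show "(12 * 2 ^ n - 2) * e powr (- 1 / real (n + 2)) \<le> oscillation_const \<gamma> e B" if "n < \<gamma>"
  proof -
    have "(12 * 2 ^ n - 2) * e powr (- 1 / real (n + 2)) \<le> (\<Sum>n<\<gamma>. (12 * 2 ^ n - 2) * e powr (- 1 / real (n + 2)))"
      by (rule member_le_sum) (use that pos in auto)
    then show ?thesis using \<open>0 \<le> 2 / e + B / e\<^sup>2\<close> unfolding oscillation_const_def by linarith
  qed
qed

text \<open>The derivative of order \<open>k + 1\<close> of the phase gives the decay \<open>\<Lambda>^(-1/(k+1))\<close>. The
slowest possible rate, \<open>k + 1 = \<gamma>\<close>, bounds all of them as \<open>\<Lambda> \<ge> 1\<close>.\<close>
lemma oscillatory_piece: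
  fixes q :: "nat \<Rightarrow> real \<Rightarrow> real"
  assumes e: "e > 0" and B: "B \<ge> 0" and \<gamma>: "\<gamma> \<ge> 1" and ab: "a \<le> b" "b - a \<le> 1" and \<Lambda>: "\<Lambda> \<ge> 1" and k: "k < \<gamma>"
    and chain: "derivative_chain {a..b} \<gamma> Q q"
    and q1: "\<forall>x\<in>{a..b}. \<bar>q 1 x\<bar> \<le> B * \<Lambda>" and qk: "\<forall>x\<in>{a..b}. e * \<Lambda> \<le> \<bar>q k x\<bar>"
  shows "norm (integral {a..b} (\<lambda>x. cis (Q x))) \<le> oscillation_const \<gamma> e B * \<Lambda> powr (- 1 / real \<gamma>)"
proof -
  let ?C = "oscillation_const \<gamma> e B"
  have eL: "e * \<Lambda> > 0" using e \<Lambda> by simp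
  have "norm (integral {a..b} (\<lambda>x. cis (Q x))) \<le> ?C * \<Lambda> powr (- 1 / real (Suc k))"
  proof (cases k)
    case 0
    have "norm (integral {a..b} (\<lambda>x. cis (Q x))) \<le> 2 / (e * \<Lambda>) + (B * \<Lambda>) / (e * \<Lambda>)\<^sup>2 * (b - a)"
    proof (rule nonstationary_bound[OF ab(1), where q = "q 0" and ?q1.0 = "q 1"])
      show "continuous_on {a..b} (q 1)" using derivative_chain_continuous(2)[OF chain \<gamma>] .
    qed (use chain q1 qk 0 \<gamma> eL in \<open>auto simp: derivative_chain_def\<close>)
    also have "\<dots> \<le> 2 / (e * \<Lambda>) + (B * \<Lambda>) / (e * \<Lambda>)\<^sup>2 * 1"
      using ab B \<Lambda> by (intro add_left_mono mult_left_mono) auto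
    also have "\<dots> = (2 / e + B / e\<^sup>2) / \<Lambda>" using e \<Lambda> by (simp add: field_simps power2_eq_square)
    also have "\<dots> \<le> ?C / \<Lambda>" using oscillation_const_nonneg(1)[OF e B] \<Lambda> by (intro divide_right_mono) auto
    also have "\<dots> = ?C * \<Lambda> powr (- 1 / real (Suc k))"
      using \<Lambda> 0 by (simp add: powr_minus_divide)
    finally show ?thesis .
  next
    case (Suc n)
    have "norm (integral {a..b} (\<lambda>x. cis (Q x))) \<le> (12 * 2 ^ n - 2) * (e * \<Lambda>) powr (- 1 / real (n + 2))"
      using qk Suc derivative_chain_mono[OF chain, of "Suc n"] k
      by (intro van_der_Corput[OF ab(1) eL]) auto
    also have "\<dots> = (12 * 2 ^ n - 2) * e powr (- 1 / real (n + 2)) * \<Lambda> powr (- 1 / real (Suc k))"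
      using e \<Lambda> by (simp add: powr_mult Suc)
    also have "\<dots> \<le> ?C * \<Lambda> powr (- 1 / real (Suc k))"
      by (intro mult_right_mono oscillation_const_nonneg(2)[OF e B]) (use k Suc in auto)
    finally show ?thesis .
  qed
  also have "\<dots> \<le> ?C * \<Lambda> powr (- 1 / real \<gamma>)"
    using oscillation_const_nonneg(3)[OF e B] \<Lambda> k
    by (intro mult_left_mono powr_mono) (auto simp: field_simps)
  finally show ?thesis .
qed

text \<open>Which derivative is large may change from point to point. Since all derivatives are bounded by
\<open>B \<Lambda>\<close>, one that is at least \<open>2 e \<Lambda>\<close> at a point stays at least \<open>e \<Lambda>\<close> up to the distance \<open>e / B\<close>; so
about \<open>B / e\<close> pieces of \<open>[0, s]\<close> suffice, a number that depends neither on \<open>\<Lambda>\<close> nor on the phase.\<close>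
lemma oscillatory_unit_interval:
  fixes q :: "nat \<Rightarrow> real \<Rightarrow> real"
  assumes e: "e > 0" and B: "B \<ge> 0" and \<gamma>: "\<gamma> \<ge> 1" and s: "0 \<le> s" "s \<le> 1" and \<Lambda>: "\<Lambda> \<ge> 1"
    and chain: "derivative_chain {0..1} \<gamma> Q q"
    and qB: "\<forall>j\<in>{1..\<gamma>}. \<forall>x\<in>{0..1}. \<bar>q j x\<bar> \<le> B * \<Lambda>"
    and nd: "\<forall>x\<in>{0..1}. \<exists>k<\<gamma>. 2 * e * \<Lambda> \<le> \<bar>q k x\<bar>"
  shows "norm (integral {0..s} (\<lambda>x. cis (Q x)))
    \<le> real (Suc (nat \<lceil>B / e\<rceil>)) * oscillation_const \<gamma> e B * \<Lambda> powr (- 1 / real \<gamma>)"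
proof -
  let ?C = "oscillation_const \<gamma> e B * \<Lambda> powr (- 1 / real \<gamma>)"
  \<comment> \<open>On a piece of length at most \<open>1 / P\<close> a derivative changes by at most \<open>B \<Lambda> / P \<le> e \<Lambda>\<close>.\<close>
  define P where "P = Suc (nat \<lceil>B / e\<rceil>)"
  have P: "B / real P \<le> e"
  proof -
    have "B / e \<le> real P" unfolding P_def by linarith
    then show ?thesis using e by (simp add: field_simps P_def)
  qed
  have P0: "real P > 0" by (simp add: P_def)
  have Qc: "continuous_on {0..1} Q" using derivative_chain_continuous(1)[OF chain] .
  define x where "x i = s * real i / real P" for i
  have x_in: "x i \<in> {0..1}" if "i \<le> P" for i
  proof -
    have "s * real i \<le> 1 * real P" using s that by (intro mult_mono) auto
    then show ?thesis using s P0 by (simp add: x_def field_simps)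
  qed
  have x_step: "x (Suc i) - x i = s / real P" for i by (simp add: x_def algebra_simps add_divide_distrib)
  have x_le: "x i \<le> x (Suc i)" for i using x_step[of i] s P0 by (smt (verit) divide_nonneg_nonneg)
  have piece_i: "norm (integral {x i..x (Suc i)} (\<lambda>x. cis (Q x))) \<le> ?C" if i: "i < P" for i
  proof -
    let ?I = "{x i..x (Suc i)}"
    have I: "?I \<subseteq> {0..1}" using x_in[of i] x_in[of "Suc i"] i by auto
    obtain k where k: "k < \<gamma>" "2 * e * \<Lambda> \<le> \<bar>q k (x i)\<bar>" using nd x_in[of i] i by fastforce
    have qk: "e * \<Lambda> \<le> \<bar>q k y\<bar>" if y: "y \<in> ?I" for y
    proof -
      have "\<exists>z\<in>{x i..y}. q k y - q k (x i) = (\<lambda>h. h * q (Suc k) z) (y - x i)"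
      proof (rule mvt_very_simple)
        show "x i \<le> y" using y by simp
        fix z assume z: "x i \<le> z" "z \<le> y"
        then have "z \<in> {0..1}" using y I by (metis (no_types, lifting) atLeastAtMost_iff order.trans subsetD)
        then have "(q k has_real_derivative q (Suc k) z) (at z within {0..1})"
          using chain k unfolding derivative_chain_def by blast
        then have "(q k has_real_derivative q (Suc k) z) (at z within {x i..y})"
          by (rule DERIV_subset) (use y I in auto)
        then show "(q k has_derivative (\<lambda>h. h * q (Suc k) z)) (at z within {x i..y})"
          by (simp add: has_field_derivative_def mult.commute[of _ "q (Suc k) z"])
      qed
      then obtain z where z: "z \<in> {x i..y}" "q k y - q k (x i) = (y - x i) * q (Suc k) z" by blast
      have z01: "z \<in> {0..1}" using z y I by (metis (no_types, lifting) atLeastAtMost_iff order.trans subsetD)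
      have "\<bar>q k y - q k (x i)\<bar> = \<bar>y - x i\<bar> * \<bar>q (Suc k) z\<bar>" by (simp add: z(2) abs_mult)
      also have "\<dots> \<le> (1 / real P) * (B * \<Lambda>)"
      proof (rule mult_mono)
        have "\<bar>y - x i\<bar> \<le> s / real P" using y x_step[of i] by auto
        also have "\<dots> \<le> 1 / real P" using s by (simp add: divide_right_mono)
        finally show "\<bar>y - x i\<bar> \<le> 1 / real P" .
        show "\<bar>q (Suc k) z\<bar> \<le> B * \<Lambda>" using qB k z01 by auto
      qed auto
      also have "\<dots> = B / real P * \<Lambda>" by simp
      also have "\<dots> \<le> e * \<Lambda>" using P \<Lambda> by (intro mult_right_mono) auto
      finally show ?thesis using k(2) by linarith
    qed
    have "s / real P \<le> 1 / 1" using s by (intro frac_le) (auto simp: P_def)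
    then show ?thesis
      using qB I \<gamma> qk x_step[of i]
      by (intro oscillatory_piece[OF e B \<gamma> x_le _ \<Lambda> k(1) derivative_chain_subset[OF chain I]]) force+
  qed
  have "norm (integral {0..x i} (\<lambda>x. cis (Q x))) \<le> real i * ?C" if "i \<le> P" for i
    using that
  proof (induction i)
    case 0
    then show ?case by (simp add: x_def)
  next
    case (Suc i)
    have "(\<lambda>x. cis (Q x)) integrable_on {0..x (Suc i)}"
      using x_in[of "Suc i"] Suc.prems
      by (intro integrable_continuous_real continuous_intros continuous_on_subset[OF Qc]) auto
    moreover have "0 \<le> x i" using x_in[of i] Suc.prems by simp
    ultimately have "integral {0..x (Suc i)} (\<lambda>x. cis (Q x)) =
        integral {0..x i} (\<lambda>x. cis (Q x)) + integral {x i..x (Suc i)} (\<lambda>x. cis (Q x))"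
      using x_le[of i] by (simp add: Henstock_Kurzweil_Integration.integral_combine)
    then have "norm (integral {0..x (Suc i)} (\<lambda>x. cis (Q x))) \<le>
        norm (integral {0..x i} (\<lambda>x. cis (Q x))) + norm (integral {x i..x (Suc i)} (\<lambda>x. cis (Q x)))"
      by (metis norm_triangle_ineq)
    also have "\<dots> \<le> real i * ?C + ?C"
      using Suc piece_i[of i] by (intro add_mono) auto
    finally show ?case by (simp add: algebra_simps)
  qed
  from this[of P] show ?thesis using P0 by (simp add: x_def P_def mult.assoc)
qed

text \<open>Integration by parts against the primitive of \<open>u\<close> trades the amplitude for its size and that of its
derivative.\<close>
lemma oscillatory_amplitude:
  fixes u \<psi> \<psi>' :: "real \<Rightarrow> complex"
  assumes u: "continuous_on {0..1} u" "\<And>s. s \<in> {0..1} \<Longrightarrow> norm (integral {0..s} u) \<le> B"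
    and \<psi>: "\<And>x. x \<in> {0..1} \<Longrightarrow> (\<psi> has_vector_derivative \<psi>' x) (at x within {0..1})"
    and \<psi>': "continuous_on {0..1} \<psi>'"
    and M: "\<And>x. x \<in> {0..1} \<Longrightarrow> norm (\<psi> x) \<le> M" "\<And>x. x \<in> {0..1} \<Longrightarrow> norm (\<psi>' x) \<le> M"
  shows "norm (integral {0..1} (\<lambda>x. \<psi> x * u x)) \<le> 2 * M * B"
proof -
  define H where "H s = integral {0..s} u" for s
  have H: "(H has_vector_derivative u x) (at x within {0..1})" if "x \<in> {0..1}" for x
    unfolding H_def by (rule integral_has_vector_derivative[OF u(1) that])
  have Hc: "continuous_on {0..1} H" and \<psi>c: "continuous_on {0..1} \<psi>"
    unfolding continuous_on_eq_continuous_within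
    using has_vector_derivative_continuous[OF H] has_vector_derivative_continuous[OF \<psi>] by blast+
  have "((\<lambda>x. \<psi> x * u x + \<psi>' x * H x) has_integral (\<psi> 1 * H 1 - \<psi> 0 * H 0)) {0..1}"
    by (rule fundamental_theorem_of_calculus) (auto intro!: has_vector_derivative_mult \<psi> H)
  moreover have i2: "(\<lambda>x. \<psi>' x * H x) integrable_on {0..1}" and i1: "(\<lambda>x. \<psi> x * u x) integrable_on {0..1}"
    by (intro integrable_continuous_real continuous_intros \<psi>' Hc \<psi>c u)+
  moreover have "H 0 = 0" by (simp add: H_def)
  ultimately have "integral {0..1} (\<lambda>x. \<psi> x * u x) = \<psi> 1 * H 1 - integral {0..1} (\<lambda>x. \<psi>' x * H x)"
    using Henstock_Kurzweil_Integration.integral_add[OF i1 i2] by (simp add: integral_unique algebra_simps)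
  then have "norm (integral {0..1} (\<lambda>x. \<psi> x * u x)) \<le> norm (\<psi> 1 * H 1) + norm (integral {0..1} (\<lambda>x. \<psi>' x * H x))"
    by (metis norm_triangle_ineq4)
  moreover have M0: "0 \<le> M" using order.trans[OF norm_ge_zero M(1)[of 0]] by simp
  moreover have "norm (\<psi> 1 * H 1) \<le> M * B"
    unfolding norm_mult using M(1)[of 1] u(2)[of 1] M0 by (intro mult_mono) (auto simp: H_def)
  moreover have "norm (integral {0..1} (\<lambda>x. \<psi>' x * H x)) \<le> (M * B) * (1 - 0)"
  proof (rule integral_bound)
    fix t :: real assume "t \<in> {0..1}"
    then show "norm (\<psi>' t * H t) \<le> M * B"
      unfolding norm_mult using M(2)[of t] u(2)[of t] M0 by (intro mult_mono) (auto simp: H_def)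
  qed (auto intro!: continuous_intros \<psi>' Hc)
  ultimately show ?thesis by simp
qed

section \<open>A Plancherel inequality\<close>

text \<open>Lebesgue measure is a product over an orthonormal basis, so integrals of products of functions of one
coordinate factor. This reduces the Gaussian integral to one dimension.\<close>
lemma
  fixes f :: "'a::euclidean_space \<Rightarrow> real \<Rightarrow> complex"
  assumes f: "\<And>b. b \<in> Basis \<Longrightarrow> integrable lborel (f b)"
  shows lborel_integral_prod: "(\<integral>x. (\<Prod>b\<in>Basis. f b (x \<bullet> b)) \<partial>lborel) = (\<Prod>b\<in>Basis. \<integral>x. f b x \<partial>lborel)" (is ?eq)
    and lborel_integrable_prod: "integrable lborel (\<lambda>x. \<Prod>b\<in>Basis. f b (x \<bullet> b))" (is ?int)
proof -
  interpret P: product_sigma_finite "\<lambda>_::'a. lborel :: real measure" ..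
  have [measurable]: "f b \<in> borel_measurable borel" if "b \<in> Basis" for b
    using borel_measurable_integrable[OF f[OF that]] by simp
  let ?S = "\<lambda>g. \<Sum>b\<in>Basis. g b *\<^sub>R (b::'a)"
  let ?P = "\<Pi>\<^sub>M b\<in>(Basis::'a set). (lborel :: real measure)"
  have m: "?S \<in> ?P \<rightarrow>\<^sub>M borel" by measurable
  have comp: "?S g \<bullet> b = g b" if "b \<in> Basis" for g b using that by simp
  have eq: "(\<lambda>g. \<Prod>b\<in>Basis. f b (?S g \<bullet> b)) = (\<lambda>g. \<Prod>b\<in>Basis. f b (g b))"
    by (intro ext prod.cong refl) (simp only: comp)
  have i: "integrable ?P (\<lambda>g. \<Prod>b\<in>Basis. f b (g b))"
    by (rule P.product_integrable_prod) (auto intro: f)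
  show ?int
    by (subst lborel_eq, subst integrable_distr_eq[OF m]) (simp, simp only: eq i)
  have "(\<integral>x. (\<Prod>b\<in>Basis. f b (x \<bullet> b)) \<partial>lborel) = (\<integral>g. (\<Prod>b\<in>Basis. f b (?S g \<bullet> b)) \<partial>?P)"
    by (subst lborel_eq, subst integral_distr[OF m]) simp_all
  also have "\<dots> = (\<Prod>b\<in>Basis. \<integral>x. f b x \<partial>lborel)"
    unfolding eq by (rule P.product_integral_prod) (auto intro: f)
  finally show ?eq .
qed

definition gauss :: "real \<Rightarrow> 'a::euclidean_space \<Rightarrow> real" where
  "gauss s \<xi> = (\<Prod>b\<in>Basis. exp (- ((\<xi> \<bullet> b) / s)\<^sup>2 / 2))"

text \<open>The Fourier transform of \<open>gauss s\<close>: a centred Gaussian of variance \<open>1 / s\<^sup>2\<close> in each coordinate. Its mass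
\<open>(2 pi)^(DIM)\<close> does not depend on \<open>s\<close>, which is all that the Plancherel inequality needs.\<close>
definition gauss_hat :: "real \<Rightarrow> 'a::euclidean_space \<Rightarrow> real" where
  "gauss_hat s z = (\<Prod>b\<in>Basis. 2 * pi * normal_density 0 (1 / s) (z \<bullet> b))"

text \<open>By scaling, this is the characteristic function of the standard normal distribution.\<close>
lemma gaussian_fourier_1d:
  assumes s: "s > 0"
  shows "integrable lborel (\<lambda>x. cis (- (z * x)) * of_real (exp (- (x / s)\<^sup>2 / 2)))"
    and "(\<integral>x. cis (- (z * x)) * of_real (exp (- (x / s)\<^sup>2 / 2)) \<partial>lborel) = of_real (2 * pi * normal_density 0 (1 / s) z)"
proof -
  have e: "exp (- (x / s)\<^sup>2 / 2) = sqrt (2 * pi) * std_normal_density (0 + (1 / s) * x)" for x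
    by (simp add: std_normal_density_def)
  have "integrable lborel (\<lambda>x. std_normal_density (0 + (1 / s) * x))"
    by (rule lborel_integrable_real_affine[OF integrable_normal_density[OF zero_less_one]]) (use s in simp)
  then have i: "integrable lborel (\<lambda>x. exp (- (x / s)\<^sup>2 / 2))" unfolding e by (rule integrable_mult_right)
  show int: "integrable lborel (\<lambda>x. cis (- (z * x)) * of_real (exp (- (x / s)\<^sup>2 / 2)))"
    by (rule Bochner_Integration.integrable_bound[OF i])
      (use s in \<open>auto simp: norm_mult intro!: borel_measurable_continuous_onI continuous_intros\<close>)
  have "complex_of_real (exp (- (s * z)\<^sup>2 / 2)) = char std_normal_distribution (- (s * z))"
    unfolding char_std_normal_distribution by simp
  also have "\<dots> = (\<integral>y. std_normal_density y *\<^sub>R iexp (- (s * z) * y) \<partial>lborel)"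
    unfolding char_def by (subst integral_density) auto
  finally have c: "(\<integral>y. std_normal_density y *\<^sub>R iexp (- (s * z) * y) \<partial>lborel) = of_real (exp (- (s * z)\<^sup>2 / 2))" by simp
  have "(\<integral>x. cis (- (z * x)) * of_real (exp (- (x / s)\<^sup>2 / 2)) \<partial>lborel)
      = s *\<^sub>R (\<integral>x. cis (- (z * (0 + s * x))) * of_real (exp (- ((0 + s * x) / s)\<^sup>2 / 2)) \<partial>lborel)"
    using s by (subst lborel_integral_real_affine[of s _ 0]) auto
  also have "(\<integral>x. cis (- (z * (0 + s * x))) * of_real (exp (- ((0 + s * x) / s)\<^sup>2 / 2)) \<partial>lborel)
     = (\<integral>x. of_real (sqrt (2 * pi)) * (std_normal_density x *\<^sub>R iexp (- (s * z) * x)) \<partial>lborel)"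
    using s by (intro Bochner_Integration.integral_cong refl)
      (simp add: std_normal_density_def cis_conv_exp scaleR_conv_of_real mult_ac)
  also have "\<dots> = of_real (sqrt (2 * pi)) * of_real (exp (- (s * z)\<^sup>2 / 2))" by (simp only: integral_mult_right_zero c)
  also have "s *\<^sub>R (complex_of_real (sqrt (2 * pi)) * of_real (exp (- (s * z)\<^sup>2 / 2))) =
     of_real (s * sqrt (2 * pi) * exp (- (s * z)\<^sup>2 / 2))" by (simp add: scaleR_conv_of_real)
  also have "s * sqrt (2 * pi) * exp (- (s * z)\<^sup>2 / 2) = 2 * pi * normal_density 0 (1 / s) z"
  proof -
    have "2 * pi * (1 / sqrt (2 * pi * (1 / s)\<^sup>2)) = s * sqrt (2 * pi)"
      using s real_sqrt_mult_self[of "2 * pi"] by (simp add: real_sqrt_mult real_sqrt_divide power_divide field_simps)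
    moreover have "- (s * z)\<^sup>2 / 2 = - (z - 0)\<^sup>2 / (2 * (1 / s)\<^sup>2)"
      using s by (simp add: power_mult_distrib power_divide field_simps)
    ultimately show ?thesis unfolding normal_density_def by (metis mult.assoc)
  qed
  finally show "(\<integral>x. cis (- (z * x)) * of_real (exp (- (x / s)\<^sup>2 / 2)) \<partial>lborel) = of_real (2 * pi * normal_density 0 (1 / s) z)" .
qed

lemma cis_sum: "finite A \<Longrightarrow> cis (\<Sum>a\<in>A. f a) = (\<Prod>a\<in>A. cis (f a))"
  by (induction A rule: finite_induct) (auto simp: cis_mult[symmetric])

lemma
  fixes z :: "'a::euclidean_space"
  assumes s: "s > 0"
  shows gauss_fourier: "(\<integral>\<xi>. cis (- (z \<bullet> \<xi>)) * of_real (gauss s \<xi>) \<partial>lborel) = of_real (gauss_hat s z)"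
    and integrable_gauss_cis: "integrable lborel (\<lambda>\<xi>. cis (- (z \<bullet> \<xi>)) * of_real (gauss s \<xi>))"
proof -
  have e: "cis (- (z \<bullet> \<xi>)) * of_real (gauss s \<xi>) =
      (\<Prod>b\<in>Basis. cis (- ((z \<bullet> b) * (\<xi> \<bullet> b))) * of_real (exp (- ((\<xi> \<bullet> b) / s)\<^sup>2 / 2)))" for \<xi> :: 'a
    by (simp add: gauss_def prod.distrib cis_sum[symmetric] euclidean_inner[of z \<xi>] sum_negf)
  show "(\<integral>\<xi>. cis (- (z \<bullet> \<xi>)) * of_real (gauss s \<xi>) \<partial>lborel) = of_real (gauss_hat s z)"
    unfolding e
    by (subst lborel_integral_prod[of "\<lambda>b x. cis (- ((z \<bullet> b) * x)) * of_real (exp (- (x / s)\<^sup>2 / 2))"])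
      (simp_all only: gaussian_fourier_1d[OF s], simp add: gauss_hat_def)
  show "integrable lborel (\<lambda>\<xi>. cis (- (z \<bullet> \<xi>)) * of_real (gauss s \<xi>))"
    unfolding e
    by (rule lborel_integrable_prod[of "\<lambda>b x. cis (- ((z \<bullet> b) * x)) * of_real (exp (- (x / s)\<^sup>2 / 2))"])
      (simp only: gaussian_fourier_1d[OF s])
qed

lemma gauss_pos: "gauss s \<xi> > 0"
  by (auto simp: gauss_def intro!: prod_pos)

lemma gauss_hat_nonneg: "gauss_hat s z \<ge> 0"
  by (auto simp: gauss_hat_def intro!: prod_nonneg)

lemma measurable_gauss [measurable]: "gauss s \<in> borel_measurable borel"
  unfolding gauss_def[abs_def] by measurable

lemma measurable_gauss_hat [measurable]: "gauss_hat s \<in> borel_measurable borel"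
  unfolding gauss_hat_def[abs_def] by measurable

lemma integrable_gauss: "s > 0 \<Longrightarrow> integrable lborel (gauss s)"
  using integrable_norm[OF integrable_gauss_cis[of s 0]]
  by (simp add: norm_mult abs_of_pos[OF gauss_pos])

lemma nn_integral_gauss_hat:
  assumes s: "s > 0"
  shows "(\<integral>\<^sup>+z. ennreal (gauss_hat s (z::'a::euclidean_space)) \<partial>lborel) = ennreal ((2 * pi) ^ DIM('a))"
proof -
  have 1: "(\<integral>\<^sup>+x. ennreal (2 * pi * normal_density 0 (1 / s) x) \<partial>lborel) = ennreal (2 * pi)"
    using s by (subst nn_integral_eq_integral) auto
  have "(\<integral>\<^sup>+z. ennreal (gauss_hat s (z::'a)) \<partial>lborel) =
      (\<integral>\<^sup>+z. (\<Prod>b\<in>Basis. ennreal (2 * pi * normal_density 0 (1 / s) ((z::'a) \<bullet> b))) \<partial>lborel)"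
    unfolding gauss_hat_def by (subst prod_ennreal) auto
  also have "\<dots> = (\<Prod>b\<in>(Basis::'a set). \<integral>\<^sup>+x. ennreal (2 * pi * normal_density 0 (1 / s) x) \<partial>lborel)"
    by (rule nn_integral_lborel_prod) auto
  also have "\<dots> = ennreal ((2 * pi) ^ DIM('a))" unfolding 1 by (simp add: prod_ennreal ennreal_power)
  finally show ?thesis .
qed

lemma nn_integral_lborel_reflect:
  fixes f :: "'a::euclidean_space \<Rightarrow> ennreal"
  assumes [measurable]: "f \<in> borel_measurable borel"
  shows "(\<integral>\<^sup>+u. f (c - u) \<partial>lborel) = (\<integral>\<^sup>+u. f u \<partial>lborel)"
proof -
  have "(\<integral>\<^sup>+u. f u \<partial>lborel) = (\<integral>\<^sup>+u. f u \<partial>distr lborel borel (\<lambda>x::'a. c - x))"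
    by (simp only: lborel_distr_reflect)
  also have "\<dots> = (\<integral>\<^sup>+u. f (c - u) \<partial>lborel)" by (rule nn_integral_distr) auto
  finally show ?thesis by simp
qed

lemma nn_integral_lborel_translate:
  fixes f :: "'a::euclidean_space \<Rightarrow> ennreal"
  assumes [measurable]: "f \<in> borel_measurable borel"
  shows "(\<integral>\<^sup>+u. f (u - c) \<partial>lborel) = (\<integral>\<^sup>+u. f u \<partial>lborel)"
proof -
  have "(\<integral>\<^sup>+u. f u \<partial>lborel) = (\<integral>\<^sup>+u. f u \<partial>distr lborel borel ((+) (- c)))"
    by (simp only: lborel_distr_plus)
  also have "\<dots> = (\<integral>\<^sup>+u. f (u - c) \<partial>lborel)" by (subst nn_integral_distr) (auto simp: add.commute)
  finally show ?thesis by simp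
qed

lemma measurable_fourier_integral [measurable]:
  assumes [measurable]: "u \<in> borel_measurable borel"
  shows "fourier_integral u \<in> borel_measurable borel"
  unfolding fourier_integral_def[abs_def] cis_conv_exp by measurable

lemma fourier_integral_diff:
  assumes "integrable lborel u" "integrable lborel v"
  shows "fourier_integral (\<lambda>x. u x - v x) \<xi> = fourier_integral u \<xi> - fourier_integral v \<xi>"
proof -
  have i: "integrable lborel (\<lambda>x. cis (- (x \<bullet> \<xi>)) * w x)" if w: "integrable lborel w" for w :: "'a \<Rightarrow> complex"
    by (rule Bochner_Integration.integrable_bound[OF integrable_norm[OF w]])
      (use w in \<open>auto simp: norm_mult cis_conv_exp\<close>)
  show ?thesis unfolding fourier_integral_def right_diff_distrib
    by (rule Bochner_Integration.integral_diff) (intro i assms)+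
qed

text \<open>The squared \<open>L\<^sup>2\<close> norm, as an extended nonnegative number so that it is meaningful for every measurable
function.\<close>
abbreviation sq_integral :: "('a::euclidean_space \<Rightarrow> complex) \<Rightarrow> ennreal" where
  "sq_integral u \<equiv> \<integral>\<^sup>+x. ennreal ((norm (u x))\<^sup>2) \<partial>lborel"

text \<open>With the Gaussian weight every integral converges absolutely. Two applications of Fubini's theorem turn the
left-hand side into \<open>\<integral>\<integral> u(x) cnj(u(y)) gauss_hat(x - y) dx dy\<close>. The kernel is nonnegative of mass
\<open>(2 pi)^(DIM)\<close>, and \<open>|u(x) u(y)| \<le> (|u(x)|\<^sup>2 + |u(y)|\<^sup>2) / 2\<close> gives the bound (Schur's test).\<close>
lemma weighted_plancherel:
  fixes u :: "'a::euclidean_space \<Rightarrow> complex"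
  assumes u: "integrable lborel u" and s: "s > 0"
  shows "(\<integral>\<^sup>+\<xi>. ennreal ((norm (fourier_integral u \<xi>))\<^sup>2 * gauss s \<xi>) \<partial>lborel)
     \<le> ennreal ((2 * pi) ^ DIM('a)) * sq_integral u"
proof -
  have [measurable]: "u \<in> borel_measurable borel" using borel_measurable_integrable[OF u] by simp
  define U where "U = fourier_integral u"
  have [measurable]: "U \<in> borel_measurable borel" unfolding U_def by measurable
  have [measurable]: "cis \<in> borel_measurable borel" "cnj \<in> borel_measurable borel"
    by (intro borel_measurable_continuous_onI linear_continuous_on bounded_linear_cnj continuous_intros)+
  define N where "N = (\<integral>x. norm (u x) \<partial>lborel)"
  have N0: "N \<ge> 0" unfolding N_def by simp
  have UN: "norm (U \<xi>) \<le> N" for \<xi>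
    unfolding U_def fourier_integral_def N_def
    by (rule order.trans[OF integral_norm_bound]) (simp add: norm_mult)
  have gi: "integrable lborel (gauss s :: 'a \<Rightarrow> real)" by (rule integrable_gauss[OF s])
  have gu: "integrable (lborel \<Otimes>\<^sub>M lborel) (\<lambda>(x, \<xi>). norm (u x) * gauss s (\<xi>::'a))"
  proof (rule lborel_pair.Fubini_integrable)
    show "integrable lborel (\<lambda>x. LINT y|lborel. norm (case (x, y) of (x, \<xi>) \<Rightarrow> cmod (u x) * gauss s (\<xi>::'a)))"
      using u by (simp add: abs_mult)
    show "AE x in lborel. integrable lborel (\<lambda>y. case (x, y) of (x, \<xi>) \<Rightarrow> cmod (u x) * gauss s (\<xi>::'a))"
      using gi by simp
  qed measurable
  have i1: "integrable (lborel \<Otimes>\<^sub>M lborel) (\<lambda>(x, \<xi>). u x * (of_real (gauss s \<xi>) * cis (- (x \<bullet> \<xi>)) * cnj (U \<xi>)))"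
  proof (rule Bochner_Integration.integrable_bound)
    show "integrable (lborel \<Otimes>\<^sub>M lborel) (\<lambda>p. N * (case p of (x, \<xi>) \<Rightarrow> norm (u x) * gauss s (\<xi>::'a)))"
      using gu by (rule integrable_mult_right)
    have "norm (u x * (of_real (gauss s \<xi>) * cis (- (x \<bullet> \<xi>)) * cnj (U \<xi>))) \<le> norm (N * (norm (u x) * gauss s \<xi>))" for x \<xi>
    proof -
      have "norm (u x * (of_real (gauss s \<xi>) * cis (- (x \<bullet> \<xi>)) * cnj (U \<xi>))) = norm (U \<xi>) * (norm (u x) * gauss s \<xi>)"
        using gauss_pos[of s \<xi>] by (simp add: norm_mult)
      also have "\<dots> \<le> N * (norm (u x) * gauss s \<xi>)"
        using gauss_pos[of s \<xi>] UN by (intro mult_right_mono) auto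
      finally show ?thesis by simp
    qed
    then show "AE p in lborel \<Otimes>\<^sub>M lborel. norm (case p of (x, \<xi>) \<Rightarrow> u x * (of_real (gauss s \<xi>) * cis (- (x \<bullet> \<xi>)) * cnj (U \<xi>)))
        \<le> norm (N * (case p of (x, \<xi>) \<Rightarrow> norm (u x) * gauss s (\<xi>::'a)))"
      by (intro AE_I2) (auto simp: split_beta)
  qed measurable
  define W where "W x = (\<integral>\<xi>. of_real (gauss s \<xi>) * cis (- (x \<bullet> \<xi>)) * cnj (U \<xi>) \<partial>lborel)" for x
  have A: "(\<integral>\<xi>. of_real (gauss s \<xi>) * (U \<xi> * cnj (U \<xi>)) \<partial>lborel) = (\<integral>x. u x * W x \<partial>lborel)"
  proof -
    have "(\<integral>\<xi>. of_real (gauss s \<xi>) * (U \<xi> * cnj (U \<xi>)) \<partial>lborel) =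
       (\<integral>\<xi>. (\<integral>x. u x * (of_real (gauss s \<xi>) * cis (- (x \<bullet> \<xi>)) * cnj (U \<xi>)) \<partial>lborel) \<partial>lborel)"
    proof (rule Bochner_Integration.integral_cong[OF refl])
      fix \<xi> :: 'a
      have "of_real (gauss s \<xi>) * (U \<xi> * cnj (U \<xi>)) = U \<xi> * (of_real (gauss s \<xi>) * cnj (U \<xi>))" by simp
      also have "\<dots> = (\<integral>x. cis (- (x \<bullet> \<xi>)) * u x * (of_real (gauss s \<xi>) * cnj (U \<xi>)) \<partial>lborel)"
        by (subst (1) U_def) (simp only: fourier_integral_def integral_mult_left_zero)
      finally show "of_real (gauss s \<xi>) * (U \<xi> * cnj (U \<xi>)) = (\<integral>x. u x * (of_real (gauss s \<xi>) * cis (- (x \<bullet> \<xi>)) * cnj (U \<xi>)) \<partial>lborel)"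
        by (simp only: mult_ac)
    qed
    also have "\<dots> = (\<integral>x. (\<integral>\<xi>. u x * (of_real (gauss s \<xi>) * cis (- (x \<bullet> \<xi>)) * cnj (U \<xi>)) \<partial>lborel) \<partial>lborel)"
      by (rule lborel_pair.Fubini_integral) (rule i1)
    also have "\<dots> = (\<integral>x. u x * W x \<partial>lborel)" unfolding W_def by (simp only: integral_mult_right_zero)
    finally show ?thesis .
  qed
  have W: "W x = (\<integral>y. cnj (u y) * of_real (gauss_hat s (x - y)) \<partial>lborel)" for x
  proof -
    have i2: "integrable (lborel \<Otimes>\<^sub>M lborel) (\<lambda>(y, \<xi>). cnj (u y) * (cis (- ((x - y) \<bullet> \<xi>)) * of_real (gauss s (\<xi>::'a))))"
      by (rule Bochner_Integration.integrable_bound[OF gu])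
        (auto simp: norm_mult split_beta less_imp_le[OF gauss_pos])
    have "W x = (\<integral>\<xi>. (\<integral>y. cnj (u y) * (cis (- ((x - y) \<bullet> \<xi>)) * of_real (gauss s \<xi>)) \<partial>lborel) \<partial>lborel)"
      unfolding W_def
    proof (rule Bochner_Integration.integral_cong[OF refl])
      fix \<xi> :: 'a
      have "cnj (U \<xi>) = (\<integral>y. cnj (cis (- (y \<bullet> \<xi>)) * u y) \<partial>lborel)"
        unfolding U_def fourier_integral_def by (rule Bochner_Integration.integral_cnj[symmetric])
      then have "of_real (gauss s \<xi>) * cis (- (x \<bullet> \<xi>)) * cnj (U \<xi>) =
         (\<integral>y. of_real (gauss s \<xi>) * cis (- (x \<bullet> \<xi>)) * cnj (cis (- (y \<bullet> \<xi>)) * u y) \<partial>lborel)"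
        by (simp only: integral_mult_right_zero)
      also have "\<dots> = (\<integral>y. cnj (u y) * (cis (- ((x - y) \<bullet> \<xi>)) * of_real (gauss s \<xi>)) \<partial>lborel)"
        by (intro Bochner_Integration.integral_cong refl)
          (simp add: cis_cnj inner_diff_left cis_mult)
      finally show "of_real (gauss s \<xi>) * cis (- (x \<bullet> \<xi>)) * cnj (U \<xi>) =
         (\<integral>y. cnj (u y) * (cis (- ((x - y) \<bullet> \<xi>)) * of_real (gauss s \<xi>)) \<partial>lborel)" .
    qed
    also have "\<dots> = (\<integral>y. (\<integral>\<xi>. cnj (u y) * (cis (- ((x - y) \<bullet> \<xi>)) * of_real (gauss s \<xi>)) \<partial>lborel) \<partial>lborel)"
      by (rule lborel_pair.Fubini_integral) (rule i2)
    also have "\<dots> = (\<integral>y. cnj (u y) * of_real (gauss_hat s (x - y)) \<partial>lborel)"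
      by (simp only: integral_mult_right_zero gauss_fourier[OF s])
    finally show ?thesis .
  qed
  let ?K = "ennreal ((2 * pi) ^ DIM('a))"
  let ?E = "sq_integral u"
  have nnW: "ennreal (norm (W x)) \<le> (\<integral>\<^sup>+y. ennreal (norm (u y) * gauss_hat s (x - y)) \<partial>lborel)" for x
  proof (cases "integrable lborel (\<lambda>y. cnj (u y) * of_real (gauss_hat s (x - y)))")
    case True
    from integral_norm_bound_ennreal[OF this] show ?thesis
      unfolding W by (simp add: norm_mult gauss_hat_nonneg)
  next
    case False
    then show ?thesis unfolding W by (simp add: not_integrable_integral_eq)
  qed
  have "(\<integral>\<^sup>+\<xi>. ennreal ((norm (U \<xi>))\<^sup>2 * gauss s \<xi>) \<partial>lborel) = ennreal (\<integral>\<xi>. (norm (U \<xi>))\<^sup>2 * gauss s \<xi> \<partial>lborel)"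
  proof (rule nn_integral_eq_integral)
    show "integrable lborel (\<lambda>\<xi>. (norm (U \<xi>))\<^sup>2 * gauss s \<xi>)"
    proof (rule Bochner_Integration.integrable_bound[OF integrable_mult_right[OF gi, of "N\<^sup>2"]])
      have "norm ((norm (U \<xi>))\<^sup>2 * gauss s \<xi>) \<le> norm (N\<^sup>2 * gauss s \<xi>)" for \<xi>
        using gauss_pos[of s \<xi>] UN[of \<xi>] by (simp add: abs_mult power_mono mult_right_mono)
      then show "AE \<xi> in lborel. norm ((norm (U \<xi>))\<^sup>2 * gauss s \<xi>) \<le> norm (N\<^sup>2 * gauss s \<xi>)" by simp
    qed measurable
  qed (auto simp: less_imp_le[OF gauss_pos])
  also have "(\<integral>\<xi>. (norm (U \<xi>))\<^sup>2 * gauss s \<xi> \<partial>lborel) = norm (\<integral>\<xi>. complex_of_real ((norm (U \<xi>))\<^sup>2 * gauss s \<xi>) \<partial>lborel)"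
    unfolding integral_complex_of_real norm_of_real
    by (intro abs_of_nonneg[symmetric] Bochner_Integration.integral_nonneg) (auto simp: less_imp_le[OF gauss_pos])
  also have "(\<integral>\<xi>. complex_of_real ((norm (U \<xi>))\<^sup>2 * gauss s \<xi>) \<partial>lborel) = (\<integral>x. u x * W x \<partial>lborel)"
    unfolding A[symmetric] by (intro Bochner_Integration.integral_cong refl) (simp add: complex_norm_square mult.commute del: of_real_power)
  also have "ennreal (norm (\<integral>x. u x * W x \<partial>lborel)) \<le> (\<integral>\<^sup>+x. ennreal (norm (u x * W x)) \<partial>lborel)"
    by (cases "integrable lborel (\<lambda>x. u x * W x)")
      (auto intro: integral_norm_bound_ennreal simp: not_integrable_integral_eq)
  also have "\<dots> \<le> (\<integral>\<^sup>+x. (\<integral>\<^sup>+y. ennreal (norm (u x)) * ennreal (norm (u y) * gauss_hat s (x - y)) \<partial>lborel) \<partial>lborel)"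
  proof (rule nn_integral_mono)
    fix x
    have "ennreal (norm (u x * W x)) = ennreal (norm (u x)) * ennreal (norm (W x))" by (simp add: norm_mult ennreal_mult)
    also have "\<dots> \<le> ennreal (norm (u x)) * (\<integral>\<^sup>+y. ennreal (norm (u y) * gauss_hat s (x - y)) \<partial>lborel)"
      by (intro mult_left_mono nnW) simp
    also have "\<dots> = (\<integral>\<^sup>+y. ennreal (norm (u x)) * ennreal (norm (u y) * gauss_hat s (x - y)) \<partial>lborel)"
      by (rule nn_integral_cmult[symmetric]) simp
    finally show "ennreal (norm (u x * W x)) \<le> (\<integral>\<^sup>+y. ennreal (norm (u x)) * ennreal (norm (u y) * gauss_hat s (x - y)) \<partial>lborel)" .
  qed
  also have "\<dots> \<le> (\<integral>\<^sup>+x. (\<integral>\<^sup>+y. ennreal ((norm (u x))\<^sup>2 / 2) * ennreal (gauss_hat s (x - y))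
      + ennreal ((norm (u y))\<^sup>2 / 2) * ennreal (gauss_hat s (x - y)) \<partial>lborel) \<partial>lborel)"
  proof (intro nn_integral_mono)
    fix x y
    have "norm (u x) * norm (u y) \<le> (norm (u x))\<^sup>2 / 2 + (norm (u y))\<^sup>2 / 2"
      using sum_squares_bound[of "norm (u x)" "norm (u y)"] by simp
    then have "norm (u x) * norm (u y) * gauss_hat s (x - y) \<le> ((norm (u x))\<^sup>2 / 2 + (norm (u y))\<^sup>2 / 2) * gauss_hat s (x - y)"
      by (intro mult_right_mono gauss_hat_nonneg)
    then show "ennreal (norm (u x)) * ennreal (norm (u y) * gauss_hat s (x - y)) \<le> ennreal ((norm (u x))\<^sup>2 / 2) * ennreal (gauss_hat s (x - y))
      + ennreal ((norm (u y))\<^sup>2 / 2) * ennreal (gauss_hat s (x - y))"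
      by (simp add: ennreal_mult[symmetric] ennreal_plus[symmetric] gauss_hat_nonneg algebra_simps del: ennreal_plus)
  qed
  also have "\<dots> = (\<integral>\<^sup>+x. (\<integral>\<^sup>+y. ennreal ((norm (u x))\<^sup>2 / 2) * ennreal (gauss_hat s (x - y)) \<partial>lborel) \<partial>lborel)
      + (\<integral>\<^sup>+x. (\<integral>\<^sup>+y. ennreal ((norm (u y))\<^sup>2 / 2) * ennreal (gauss_hat s (x - y)) \<partial>lborel) \<partial>lborel)"
    by (simp add: nn_integral_add)
  also have "(\<integral>\<^sup>+x. (\<integral>\<^sup>+y. ennreal ((norm (u x))\<^sup>2 / 2) * ennreal (gauss_hat s (x - y)) \<partial>lborel) \<partial>lborel) =
      (\<integral>\<^sup>+x. ennreal ((norm (u x))\<^sup>2 / 2) \<partial>lborel) * ?K"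
    using nn_integral_lborel_reflect[of "\<lambda>z::'a. ennreal (gauss_hat s z)"]
    by (simp add: nn_integral_cmult nn_integral_multc nn_integral_gauss_hat[OF s])
  also have "(\<integral>\<^sup>+x. (\<integral>\<^sup>+y. ennreal ((norm (u y))\<^sup>2 / 2) * ennreal (gauss_hat s (x - y)) \<partial>lborel) \<partial>lborel) =
      (\<integral>\<^sup>+y. (\<integral>\<^sup>+x. ennreal ((norm (u y))\<^sup>2 / 2) * ennreal (gauss_hat s (x - y)) \<partial>lborel) \<partial>lborel)"
    by (rule lborel_pair.Fubini') measurable
  also have "\<dots> = (\<integral>\<^sup>+x. ennreal ((norm (u x))\<^sup>2 / 2) \<partial>lborel) * ?K"
    using nn_integral_lborel_translate[of "\<lambda>z::'a. ennreal (gauss_hat s z)"]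
    by (simp add: nn_integral_cmult nn_integral_multc nn_integral_gauss_hat[OF s])
  also have "(\<integral>\<^sup>+x. ennreal ((norm (u x))\<^sup>2 / 2) \<partial>lborel) * ?K + (\<integral>\<^sup>+x. ennreal ((norm (u x))\<^sup>2 / 2) \<partial>lborel) * ?K = ?K * ?E"
  proof -
    have "(\<integral>\<^sup>+x. ennreal ((norm (u x))\<^sup>2 / 2) \<partial>lborel) + (\<integral>\<^sup>+x. ennreal ((norm (u x))\<^sup>2 / 2) \<partial>lborel) = ?E"
      by (subst nn_integral_add[symmetric]) (auto simp: ennreal_plus[symmetric] simp del: ennreal_plus)
    then show ?thesis unfolding distrib_right[symmetric] by (simp only: mult.commute)
  qed
  finally show ?thesis unfolding U_def .
qed

text \<open>The Gaussian weights increase to \<open>1\<close> pointwise as \<open>s\<close> grows, and the bounds do not depend on \<open>s\<close>; so Fatou's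
lemma applies.\<close>
lemma plancherel_inequality:
  fixes u :: "'a::euclidean_space \<Rightarrow> complex"
  assumes u: "integrable lborel u"
  shows "sq_integral (fourier_integral u)
     \<le> ennreal ((2 * pi) ^ DIM('a)) * sq_integral u"
proof -
  have [measurable]: "u \<in> borel_measurable borel" using borel_measurable_integrable[OF u] by simp
  have lim: "(\<lambda>n. ennreal ((norm (fourier_integral u \<xi>))\<^sup>2 * gauss (real (Suc n)) \<xi>)) \<longlonglongrightarrow> ennreal ((norm (fourier_integral u \<xi>))\<^sup>2)" for \<xi>
  proof -
    have "(\<lambda>n. exp (- (c / real (Suc n))\<^sup>2 / 2)) \<longlonglongrightarrow> exp (- (0::real)\<^sup>2 / 2)" for c :: real
      by (intro tendsto_intros LIMSEQ_Suc[OF lim_const_over_n])  simp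
    then have "(\<lambda>n. gauss (real (Suc n)) \<xi>) \<longlonglongrightarrow> (\<Prod>b\<in>(Basis::'a set). exp (- (0::real)\<^sup>2 / 2))"
      unfolding gauss_def by (intro tendsto_prod)
    then have "(\<lambda>n. (norm (fourier_integral u \<xi>))\<^sup>2 * gauss (real (Suc n)) \<xi>) \<longlonglongrightarrow> (norm (fourier_integral u \<xi>))\<^sup>2 * 1"
      by (intro tendsto_intros) simp
    then show ?thesis by (intro tendsto_ennrealI) simp
  qed
  have "sq_integral (fourier_integral u) =
     (\<integral>\<^sup>+\<xi>. liminf (\<lambda>n. ennreal ((norm (fourier_integral u \<xi>))\<^sup>2 * gauss (real (Suc n)) \<xi>)) \<partial>lborel)"
    by (intro nn_integral_cong lim_imp_Liminf[OF _ lim, symmetric]) simp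
  also have "\<dots> \<le> liminf (\<lambda>n. \<integral>\<^sup>+\<xi>. ennreal ((norm (fourier_integral u \<xi>))\<^sup>2 * gauss (real (Suc n)) \<xi>) \<partial>lborel)"
    by (rule nn_integral_liminf) measurable
  also have "\<dots> \<le> liminf (\<lambda>n::nat. ennreal ((2 * pi) ^ DIM('a)) * sq_integral u)"
    by (intro Liminf_mono always_eventually allI weighted_plancherel[OF u]) simp
  also have "\<dots> = ennreal ((2 * pi) ^ DIM('a)) * sq_integral u"
    by (simp add: Liminf_const)
  finally show ?thesis .
qed


section \<open>The Fourier transform on L2 and a criterion for Sobolev regularity\<close>

text \<open>The completeness of \<open>L\<^sup>2\<close>, in the form needed. The weights \<open>2\<^sup>n\<close> are affordable because the squared
norms of the increments decay like \<open>4^(-n)\<close>; summability of \<open>2\<^sup>n |g_(n+1) - g\<^sub>n|\<^sup>2\<close> makes the increments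
themselves decay geometrically at almost every point.\<close>
lemma L2_Cauchy_AE_limit:
  fixes g :: "nat \<Rightarrow> 'a \<Rightarrow> complex"
  assumes [measurable]: "\<And>n. g n \<in> borel_measurable M"
    and C: "C < \<infinity>" "\<And>n. (\<integral>\<^sup>+x. ennreal ((norm (g (Suc n) x - g n x))\<^sup>2) \<partial>M) \<le> C * ennreal ((1 / 4) ^ n)"
  obtains h where "h \<in> borel_measurable M" "AE x in M. (\<lambda>n. g n x) \<longlonglongrightarrow> h x"
proof
  define h where "h x = lim (\<lambda>n. g n x)" for x
  show "h \<in> borel_measurable M" unfolding h_def[abs_def] by measurable
  let ?D = "\<lambda>n x. ennreal (2 ^ n * (norm (g (Suc n) x - g n x))\<^sup>2)"
  have "(\<integral>\<^sup>+x. (\<Sum>n. ?D n x) \<partial>M) = (\<Sum>n. \<integral>\<^sup>+x. ?D n x \<partial>M)"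
    by (rule nn_integral_suminf) measurable
  also have "\<dots> \<le> (\<Sum>n. C * ennreal ((1 / 2) ^ n))"
  proof (rule suminf_le)
    fix n
    have "(\<integral>\<^sup>+x. ?D n x \<partial>M) = ennreal (2 ^ n) * (\<integral>\<^sup>+x. ennreal ((norm (g (Suc n) x - g n x))\<^sup>2) \<partial>M)"
      by (simp add: ennreal_mult nn_integral_cmult)
    also have "\<dots> \<le> ennreal (2 ^ n) * (C * ennreal ((1 / 4) ^ n))" by (intro mult_left_mono C) simp
    also have "\<dots> = C * ennreal (2 ^ n * (1 / 4) ^ n)" by (simp add: ennreal_mult mult_ac)
    also have "(2::real) ^ n * (1 / 4) ^ n = (1 / 2) ^ n" by (simp add: power_mult_distrib[symmetric])
    finally show "(\<integral>\<^sup>+x. ?D n x \<partial>M) \<le> C * ennreal ((1 / 2) ^ n)" .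
  qed auto
  also have "\<dots> = C * ennreal (\<Sum>n. (1 / 2) ^ n)"
    by (simp add: suminf_ennreal2)
  also have "\<dots> < \<infinity>" using C(1) by (simp add: ennreal_mult_less_top)
  finally have "AE x in M. (\<Sum>n. ?D n x) \<noteq> \<infinity>" by (intro nn_integral_PInf_AE) auto
  then show "AE x in M. (\<lambda>n. g n x) \<longlonglongrightarrow> h x"
  proof eventually_elim
    case (elim x)
    let ?d = "\<lambda>n. norm (g (Suc n) x - g n x)"
    have "summable (\<lambda>n. 2 ^ n * (?d n)\<^sup>2)" by (rule summable_suminf_not_top) (use elim in auto)
    then obtain K where K: "\<And>n. 2 ^ n * (?d n)\<^sup>2 \<le> K" "K > 0"
      using summable_imp_Bseq[of "\<lambda>n. 2 ^ n * (?d n)\<^sup>2"] by (auto simp: Bseq_def)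
    have "summable (\<lambda>n. sqrt K * (1 / sqrt 2) ^ n)"
      by (intro summable_mult summable_geometric) simp
    then have "summable (\<lambda>n. g (Suc n) x - g n x)"
    proof (rule summable_comparison_test'[where N = 0])
      fix n :: nat
      have "(?d n)\<^sup>2 \<le> K * (1 / 2) ^ n" using K(1)[of n] by (simp add: field_simps power_divide)
      then have "?d n \<le> sqrt (K * (1 / 2) ^ n)" by (rule real_le_rsqrt)
      also have "\<dots> = sqrt K * (1 / sqrt 2) ^ n" by (simp add: real_sqrt_mult real_sqrt_power real_sqrt_divide)
      finally show "?d n \<le> sqrt K * (1 / sqrt 2) ^ n" .
    qed
    then have "convergent (\<lambda>n. \<Sum>i<n. g (Suc i) x - g i x)" by (simp add: summable_iff_convergent)
    moreover have "(\<lambda>n. \<Sum>i<n. g (Suc i) x - g i x) = (\<lambda>n. g n x - g 0 x)"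
      by (rule ext) (rule sum_lessThan_telescope)
    ultimately have "convergent (\<lambda>n. g n x - g 0 x)" by simp
    then have "convergent (\<lambda>n. (g n x - g 0 x) + g 0 x)" by (intro convergent_add convergent_const)
    then show ?case unfolding h_def by (simp add: convergent_LIMSEQ_iff)
  qed
qed

lemma norm_sq_add_le: "(norm (a + b :: 'a::real_normed_vector))\<^sup>2 \<le> 2 * (norm a)\<^sup>2 + 2 * (norm b)\<^sup>2"
proof -
  have "(norm (a + b))\<^sup>2 \<le> (norm a + norm b)\<^sup>2" by (intro power_mono norm_triangle_ineq) simp
  also have "\<dots> \<le> 2 * (norm a)\<^sup>2 + 2 * (norm b)\<^sup>2"
    using sum_squares_bound[of "norm a" "norm b"] by (simp add: power2_sum)
  finally show ?thesis .
qed

lemma nn_integral_norm_sq_add_le: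
  fixes a b :: "'a \<Rightarrow> complex"
  assumes [measurable]: "a \<in> borel_measurable M" "b \<in> borel_measurable M"
  shows "(\<integral>\<^sup>+x. ennreal ((norm (a x + b x))\<^sup>2) \<partial>M) \<le>
    2 * (\<integral>\<^sup>+x. ennreal ((norm (a x))\<^sup>2) \<partial>M) + 2 * (\<integral>\<^sup>+x. ennreal ((norm (b x))\<^sup>2) \<partial>M)"
proof -
  have "(\<integral>\<^sup>+x. ennreal ((norm (a x + b x))\<^sup>2) \<partial>M) \<le>
      (\<integral>\<^sup>+x. 2 * ennreal ((norm (a x))\<^sup>2) + 2 * ennreal ((norm (b x))\<^sup>2) \<partial>M)"
  proof (rule nn_integral_mono)
    fix x
    have "ennreal ((norm (a x + b x))\<^sup>2) \<le> ennreal (2 * (norm (a x))\<^sup>2 + 2 * (norm (b x))\<^sup>2)"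
      by (intro ennreal_leI norm_sq_add_le)
    also have "\<dots> = 2 * ennreal ((norm (a x))\<^sup>2) + 2 * ennreal ((norm (b x))\<^sup>2)"
      by (simp add: ennreal_plus ennreal_mult)
    finally show "ennreal ((norm (a x + b x))\<^sup>2) \<le> 2 * ennreal ((norm (a x))\<^sup>2) + 2 * ennreal ((norm (b x))\<^sup>2)" .
  qed
  also have "\<dots> = 2 * (\<integral>\<^sup>+x. ennreal ((norm (a x))\<^sup>2) \<partial>M) + 2 * (\<integral>\<^sup>+x. ennreal ((norm (b x))\<^sup>2) \<partial>M)"
    by (simp add: nn_integral_add nn_integral_cmult)
  finally show ?thesis .
qed

text \<open>On a bounded set \<open>|u| \<le> 1 + |u|\<^sup>2\<close> is integrable.\<close>
lemma integrable_L2_times_bounded_support: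
  fixes u :: "'a::euclidean_space \<Rightarrow> complex" and \<theta> :: "'a \<Rightarrow> complex"
  assumes u: "L2 u" and [measurable]: "\<theta> \<in> borel_measurable borel"
    and C: "\<And>x. norm (\<theta> x) \<le> C" and r: "\<And>x. r \<le> norm x \<Longrightarrow> \<theta> x = 0"
  shows "integrable lborel (\<lambda>x. \<theta> x * u x)"
proof -
  have [measurable]: "u \<in> borel_measurable borel" using u by (simp add: L2_def)
  have C0: "C \<ge> 0" using C[of 0] norm_ge_zero order.trans by blast
  show ?thesis
  proof (rule Bochner_Integration.integrable_bound)
    show "integrable lborel (\<lambda>x. C * (indicator (cball 0 r) x + (norm (u x))\<^sup>2))"
      using u by (intro integrable_mult_right Bochner_Integration.integrable_add integrable_real_indicator)
        (auto simp: L2_def intro: emeasure_compact_finite[simplified])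
    have "norm (\<theta> x * u x) \<le> C * (indicator (cball 0 r) x + (norm (u x))\<^sup>2)" for x
    proof (cases "r \<le> norm x")
      case True
      then show ?thesis using r C0 by (simp add: indicator_def)
    next
      case False
      have "norm (u x) \<le> 1 + (norm (u x))\<^sup>2" using sum_squares_bound[of 1 "norm (u x)", simplified] norm_ge_zero[of "u x"] by linarith
      then have "norm (\<theta> x) * norm (u x) \<le> C * (1 + (norm (u x))\<^sup>2)" using C[of x] C0 by (intro mult_mono) auto
      then show ?thesis using False by (simp add: norm_mult)
    qed
    then show "AE x in lborel. norm (\<theta> x * u x) \<le> norm (C * (indicator (cball 0 r) x + (norm (u x))\<^sup>2))"
      using C0 by (intro AE_I2) (smt (verit) real_norm_def)
  qed measurable
qed

lemma L2_iff_nn: "L2 u \<longleftrightarrow> u \<in> borel_measurable borel \<and> sq_integral u < \<infinity>"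
  unfolding L2_def by (auto simp: integrable_iff_bounded)

lemma L2_tendsto_zero:
  fixes u :: "'a::euclidean_space \<Rightarrow> complex" and \<theta> :: "nat \<Rightarrow> 'a \<Rightarrow> complex"
  assumes u: "L2 u" and [measurable]: "\<And>n. \<theta> n \<in> borel_measurable borel"
    and C: "\<And>n x. norm (\<theta> n x) \<le> C" and lim: "\<And>x. (\<lambda>n. \<theta> n x) \<longlonglongrightarrow> 0"
  shows "(\<lambda>n. \<integral>\<^sup>+x. ennreal ((norm (\<theta> n x * u x))\<^sup>2) \<partial>lborel) \<longlonglongrightarrow> 0"
proof -
  have [measurable]: "u \<in> borel_measurable borel" using u by (simp add: L2_def)
  have "(\<lambda>n. \<integral>\<^sup>+x. ennreal ((norm (\<theta> n x * u x))\<^sup>2) \<partial>lborel) \<longlonglongrightarrow> (\<integral>\<^sup>+x. 0 \<partial>(lborel :: 'a measure))"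
  proof (rule nn_integral_dominated_convergence[where w = "\<lambda>x. ennreal (C\<^sup>2 * (norm (u x))\<^sup>2)"])
    show "(\<integral>\<^sup>+x. ennreal (C\<^sup>2 * (norm (u x))\<^sup>2) \<partial>lborel) < \<infinity>"
      using u by (simp add: ennreal_mult nn_integral_cmult L2_iff_nn ennreal_mult_less_top)
    have "(norm (\<theta> n x * u x))\<^sup>2 \<le> C\<^sup>2 * (norm (u x))\<^sup>2" for n x
      using C[of n x] by (simp add: norm_mult power_mult_distrib mult_right_mono power_mono)
    then show "AE x in lborel. ennreal ((norm (\<theta> n x * u x))\<^sup>2) \<le> ennreal (C\<^sup>2 * (norm (u x))\<^sup>2)" for n
      by (intro AE_I2 ennreal_leI)
    have "(\<lambda>n. (norm (\<theta> n x * u x))\<^sup>2) \<longlonglongrightarrow> (norm (0 * u x))\<^sup>2" for x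
      by (intro tendsto_intros lim)
    then have "(\<lambda>n. ennreal ((norm (\<theta> n x * u x))\<^sup>2)) \<longlonglongrightarrow> ennreal 0" for x
      by (intro tendsto_ennrealI) simp
    then show "AE x in lborel. (\<lambda>n. ennreal ((norm (\<theta> n x * u x))\<^sup>2)) \<longlonglongrightarrow> 0" by simp
  qed measurable
  then show ?thesis by simp
qed

text \<open>By the Plancherel inequality, the transforms of two truncations differ in \<open>L\<^sup>2\<close> by at most a constant
times the mass of \<open>u\<close> outside the smaller ball, which tends to \<open>0\<close>. Along fast growing radii the transforms converge almost
everywhere, and Fatou's lemma compares every truncation with the limit.\<close>
lemma fourier_L2_exists:
  fixes u :: "'a::euclidean_space \<Rightarrow> complex"
  assumes u: "L2 u"
  obtains h where "is_fourier_L2 u h"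
proof -
  have [measurable]: "u \<in> borel_measurable borel" using u by (simp add: L2_def)
  let ?c = "ennreal ((2 * pi) ^ DIM('a))"
  define T where "T R x = indicator (ball 0 R) x * u x" for R :: real and x
  define tail where "tail R = sq_integral (\<lambda>x. indicator (- ball 0 R) x * u x)" for R :: real
  have [measurable]: "ball (0::'a) R \<in> sets borel" for R by simp
  have [measurable]: "T R \<in> borel_measurable borel" for R unfolding T_def[abs_def] by measurable
  have Tint: "integrable lborel (T R)" for R
    unfolding T_def[abs_def]
    by (rule integrable_L2_times_bounded_support[OF u, of _ 1 R]) (auto simp: indicator_def)
  have "(\<lambda>n. tail (real n)) \<longlonglongrightarrow> 0"
    unfolding tail_def
  proof (rule L2_tendsto_zero[OF u, where C = 1])
    fix x :: 'a
    obtain n0 :: nat where "norm x < real n0" using reals_Archimedean2 by blast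
    then have "\<forall>\<^sub>F n in sequentially. indicator (- ball 0 (real n)) x = (0::complex)"
      by (intro eventually_sequentiallyI[of n0]) (simp add: indicator_def)
    then show "(\<lambda>n. indicator (- ball 0 (real n)) x :: complex) \<longlonglongrightarrow> 0" by (rule tendsto_eventually)
  qed (auto simp: indicator_def)
  then have tail0: "\<exists>n0. \<forall>n\<ge>n0. tail (real n) < e" if "e > 0" for e
    using order_tendstoD(2)[OF \<open>(\<lambda>n. tail (real n)) \<longlonglongrightarrow> 0\<close> that] by (simp add: eventually_sequentially)
  have tail_mono: "tail S \<le> tail R" if "R \<le> S" for R S
    unfolding tail_def using that by (intro nn_integral_mono ennreal_leI power_mono) (auto simp: norm_mult indicator_def)
  have FT: "sq_integral (\<lambda>\<xi>. fourier_integral (T S) \<xi> - fourier_integral (T R') \<xi>) \<le> ?c * tail R" if RS: "R \<le> S" "R \<le> R'" for R S R'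
  proof -
    have "sq_integral (\<lambda>\<xi>. fourier_integral (T S) \<xi> - fourier_integral (T R') \<xi>) \<le> ?c * sq_integral (\<lambda>x. T S x - T R' x)"
      unfolding fourier_integral_diff[OF Tint Tint, symmetric]
      by (intro plancherel_inequality Bochner_Integration.integrable_diff Tint)
    also have "\<dots> \<le> ?c * tail R"
      unfolding tail_def using RS
      by (intro mult_left_mono nn_integral_mono ennreal_leI power_mono) (auto simp: T_def norm_mult indicator_def)
    finally show ?thesis .
  qed
  have "\<exists>n0. \<forall>n\<ge>n0. tail (real n) < ennreal ((1 / 4) ^ k)" for k :: nat by (rule tail0) simp
  then obtain r where r: "\<And>k n. n \<ge> r k \<Longrightarrow> tail (real n) < ennreal ((1 / 4) ^ k)" by metis
  \<comment> \<open>Partial sums make the radii increasing, so that later truncations are comparable with earlier ones.\<close>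
  define R where "R k = (\<Sum>i\<le>k. r i)" for k :: nat
  have Rmono: "R k \<le> R m" if "k \<le> m" for k m unfolding R_def using that by (intro sum_mono2) auto
  have "r k \<le> R k" for k unfolding R_def by (rule member_le_sum) auto
  then have Rtail: "tail (real (R k)) \<le> ennreal ((1 / 4) ^ k)" for k using r less_imp_le by blast
  define g where "g k = fourier_integral (T (real (R k)))" for k
  have [measurable]: "g k \<in> borel_measurable borel" for k unfolding g_def by measurable
  obtain h where [measurable]: "h \<in> borel_measurable lborel" and h: "AE \<xi> in lborel. (\<lambda>n. g n \<xi>) \<longlonglongrightarrow> h \<xi>"
  proof (rule L2_Cauchy_AE_limit[of g lborel ?c])
    fix n
    have "sq_integral (\<lambda>\<xi>. g (Suc n) \<xi> - g n \<xi>) \<le> ?c * tail (real (R n))"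
      unfolding g_def by (rule FT) (auto intro: Rmono)
    also have "\<dots> \<le> ?c * ennreal ((1 / 4) ^ n)" by (intro mult_left_mono Rtail) simp
    finally show "sq_integral (\<lambda>\<xi>. g (Suc n) \<xi> - g n \<xi>) \<le> ?c * ennreal ((1 / 4) ^ n)" .
  qed auto
  have approx: "sq_integral (\<lambda>\<xi>. fourier_integral (T S) \<xi> - h \<xi>) \<le> ?c * ennreal ((1 / 4) ^ k)" if S: "real (R k) \<le> S" for k S
  proof -
    have "sq_integral (\<lambda>\<xi>. fourier_integral (T S) \<xi> - h \<xi>) =
        (\<integral>\<^sup>+\<xi>. liminf (\<lambda>n. ennreal ((norm (fourier_integral (T S) \<xi> - g n \<xi>))\<^sup>2)) \<partial>lborel)"
    proof (rule nn_integral_cong_AE)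
      show "AE \<xi> in lborel. ennreal ((norm (fourier_integral (T S) \<xi> - h \<xi>))\<^sup>2) =
          liminf (\<lambda>n. ennreal ((norm (fourier_integral (T S) \<xi> - g n \<xi>))\<^sup>2))"
        using h
      proof eventually_elim
        case (elim \<xi>)
        have "(\<lambda>n. ennreal ((norm (fourier_integral (T S) \<xi> - g n \<xi>))\<^sup>2)) \<longlonglongrightarrow> ennreal ((norm (fourier_integral (T S) \<xi> - h \<xi>))\<^sup>2)"
          by (intro tendsto_ennrealI tendsto_intros elim)
        then show ?case by (intro lim_imp_Liminf[symmetric]) simp_all
      qed
    qed
    also have "\<dots> \<le> liminf (\<lambda>n. sq_integral (\<lambda>\<xi>. fourier_integral (T S) \<xi> - g n \<xi>))"
      by (rule nn_integral_liminf) measurable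
    also have "\<dots> \<le> liminf (\<lambda>n::nat. ?c * ennreal ((1 / 4) ^ k))"
    proof (rule Liminf_mono, rule eventually_sequentiallyI[of k])
      fix n assume "k \<le> n"
      then have "sq_integral (\<lambda>\<xi>. fourier_integral (T S) \<xi> - g n \<xi>) \<le> ?c * tail (real (R k))"
        unfolding g_def using S Rmono by (intro FT) auto
      also have "\<dots> \<le> ?c * ennreal ((1 / 4) ^ k)" by (intro mult_left_mono Rtail) simp
      finally show "sq_integral (\<lambda>\<xi>. fourier_integral (T S) \<xi> - g n \<xi>) \<le> ?c * ennreal ((1 / 4) ^ k)" .
    qed
    also have "\<dots> = ?c * ennreal ((1 / 4) ^ k)" by (simp add: Liminf_const)
    finally show ?thesis .
  qed
  have "((\<lambda>S. sq_integral (\<lambda>\<xi>. fourier_integral (T S) \<xi> - h \<xi>)) \<longlongrightarrow> 0) at_top"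
  proof (rule order_tendstoI)
    fix e :: ennreal assume e: "0 < e"
    have "(\<lambda>k. ennreal ((2 * pi) ^ DIM('a) * (1 / 4) ^ k)) \<longlonglongrightarrow> ennreal ((2 * pi) ^ DIM('a) * 0)"
      by (intro tendsto_ennrealI tendsto_mult tendsto_const LIMSEQ_realpow_zero) auto
    then have "\<forall>\<^sub>F k in sequentially. ennreal ((2 * pi) ^ DIM('a) * (1 / 4) ^ k) < e"
      using e by (intro order_tendstoD(2)) auto
    then obtain k where "ennreal ((2 * pi) ^ DIM('a) * (1 / 4) ^ k) < e" by (auto simp: eventually_sequentially)
    then have k: "?c * ennreal ((1 / 4) ^ k) < e" by (subst ennreal_mult[symmetric]) auto
    show "\<forall>\<^sub>F S in at_top. sq_integral (\<lambda>\<xi>. fourier_integral (T S) \<xi> - h \<xi>) < e"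
      using eventually_ge_at_top[of "real (R k)"]
      by eventually_elim (rule le_less_trans[OF approx k])
  qed simp
  moreover have "L2 h"
    unfolding L2_iff_nn
  proof
    have "sq_integral h = sq_integral (\<lambda>\<xi>. fourier_integral (T (real (R 0))) \<xi> + - (fourier_integral (T (real (R 0))) \<xi> - h \<xi>))" by simp
    also have "\<dots> \<le> 2 * sq_integral (fourier_integral (T (real (R 0)))) + 2 * sq_integral (\<lambda>\<xi>. - (fourier_integral (T (real (R 0))) \<xi> - h \<xi>))"
      by (rule nn_integral_norm_sq_add_le) measurable
    also have "\<dots> \<le> 2 * (?c * sq_integral (T (real (R 0)))) + 2 * (?c * ennreal ((1 / 4) ^ 0))"
      unfolding norm_minus_cancel
      by (intro add_mono mult_left_mono plancherel_inequality approx Tint) auto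
    also have "\<dots> < \<infinity>"
    proof -
      have "sq_integral (T (real (R 0))) \<le> sq_integral u" by (intro nn_integral_mono ennreal_leI power_mono) (auto simp: T_def norm_mult indicator_def)
      also have "\<dots> < \<infinity>" using u by (simp add: L2_iff_nn)
      finally show ?thesis by (simp add: ennreal_mult_less_top)
    qed
    finally show "sq_integral h < \<infinity>" .
  qed (use \<open>h \<in> borel_measurable lborel\<close> in simp)
  ultimately have "is_fourier_L2 u h" unfolding is_fourier_L2_def T_def[abs_def] using u by blast
  then show thesis using that by blast
qed

text \<open>Smooth cutoffs may replace the sharp ones in the definition of the transform, since both
tend to \<open>u\<close> in \<open>L\<^sup>2\<close>. The weight is unbounded, so convergence in \<open>L\<^sup>2\<close> alone says nothing about the weighted
norm of the limit. With the weight cut off at a level \<open>L\<close> it does, with a bound that does not depend on \<open>L\<close>,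
and the cutoff is then removed by Fatou's lemma.\<close>
lemma sobolev_H_if_truncations_bounded:
  fixes u :: "'a::euclidean_space \<Rightarrow> complex" and \<theta> :: "nat \<Rightarrow> 'a \<Rightarrow> complex"
  assumes u: "L2 u" and [measurable]: "\<And>n. \<theta> n \<in> borel_measurable borel"
    and C: "\<And>n x. norm (\<theta> n x) \<le> C" and supp: "\<And>n x. r n \<le> norm x \<Longrightarrow> \<theta> n x = 0"
    and lim: "\<And>x. (\<lambda>n. \<theta> n x) \<longlonglongrightarrow> 1"
    and K: "K < \<infinity>"
      "\<And>n. (\<integral>\<^sup>+\<xi>. ennreal ((1 + (norm \<xi>)\<^sup>2) powr s * (norm (fourier_integral (\<lambda>x. \<theta> n x * u x) \<xi>))\<^sup>2) \<partial>lborel) \<le> K"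
  shows "u \<in> sobolev_H s"
proof -
  have [measurable]: "u \<in> borel_measurable borel" using u by (simp add: L2_def)
  obtain h where h: "is_fourier_L2 u h" by (rule fourier_L2_exists[OF u])
  have [measurable]: "h \<in> borel_measurable borel" using h by (simp add: is_fourier_L2_def L2_def)
  let ?W = "\<lambda>\<xi>::'a. (1 + (norm \<xi>)\<^sup>2) powr s"
  let ?c = "ennreal ((2 * pi) ^ DIM('a))"
  define \<iota> where "\<iota> n x = (indicator (ball 0 (real n)) x :: complex)" for n and x :: 'a
  have [measurable]: "ball (0::'a) R \<in> sets borel" for R by simp
  have [measurable]: "\<iota> n \<in> borel_measurable borel" for n unfolding \<iota>_def[abs_def] by measurable
  define P where "P n = fourier_integral (\<lambda>x. \<theta> n x * u x)" for n
  define Q where "Q n = fourier_integral (\<lambda>x. \<iota> n x * u x)" for n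
  have [measurable]: "P n \<in> borel_measurable borel" "Q n \<in> borel_measurable borel" for n unfolding P_def Q_def by measurable
  have i1: "integrable lborel (\<lambda>x. \<theta> n x * u x)" for n
    by (rule integrable_L2_times_bounded_support[OF u _ C supp]) measurable
  have i2: "integrable lborel (\<lambda>x. \<iota> n x * u x)" for n
    by (rule integrable_L2_times_bounded_support[OF u, of _ 1 "real n"]) (auto simp: indicator_def \<iota>_def)
  have Qh: "(\<lambda>n. sq_integral (\<lambda>\<xi>. Q n \<xi> - h \<xi>)) \<longlonglongrightarrow> 0"
    using filterlim_compose[OF conjunct2[OF conjunct2[OF h[unfolded is_fourier_L2_def]]] filterlim_real_sequentially]
    unfolding Q_def \<iota>_def .
  have "(\<lambda>n. sq_integral (\<lambda>x. (\<theta> n x - \<iota> n x) * u x)) \<longlonglongrightarrow> 0"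
  proof (rule L2_tendsto_zero[OF u, where C = "C + 1"])
    show "norm (\<theta> n x - \<iota> n x) \<le> C + 1" for n x
    proof -
      have "norm (\<iota> n x) \<le> 1" by (simp add: \<iota>_def indicator_def)
      then show ?thesis using C[of n x] norm_triangle_ineq4[of "\<theta> n x" "\<iota> n x"] by linarith
    qed
    fix x :: 'a
    obtain n0 :: nat where "norm x < real n0" using reals_Archimedean2 by blast
    then have "\<forall>\<^sub>F n in sequentially. \<iota> n x = 1"
      by (intro eventually_sequentiallyI[of n0]) (simp add: indicator_def \<iota>_def)
    then have "(\<lambda>n. \<iota> n x) \<longlonglongrightarrow> 1" by (rule tendsto_eventually)
    from tendsto_diff[OF lim this] show "(\<lambda>n. \<theta> n x - \<iota> n x) \<longlonglongrightarrow> 0" by simp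
  qed measurable
  then have PQ0: "(\<lambda>n. ?c * sq_integral (\<lambda>x. (\<theta> n x - \<iota> n x) * u x)) \<longlonglongrightarrow> ?c * 0"
    by (intro ennreal_tendsto_cmult) auto
  have PQ: "sq_integral (\<lambda>\<xi>. P n \<xi> - Q n \<xi>) \<le> ?c * sq_integral (\<lambda>x. (\<theta> n x - \<iota> n x) * u x)" for n
    unfolding P_def Q_def fourier_integral_diff[OF i1 i2, symmetric] left_diff_distrib
    by (intro plancherel_inequality Bochner_Integration.integrable_diff i1 i2)
  have hP: "sq_integral (\<lambda>\<xi>. h \<xi> - P n \<xi>) \<le> 2 * (?c * sq_integral (\<lambda>x. (\<theta> n x - \<iota> n x) * u x)) + 2 * sq_integral (\<lambda>\<xi>. Q n \<xi> - h \<xi>)" for n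
  proof -
    have "sq_integral (\<lambda>\<xi>. h \<xi> - P n \<xi>) = sq_integral (\<lambda>\<xi>. (P n \<xi> - Q n \<xi>) + (Q n \<xi> - h \<xi>))"
      by (simp add: norm_minus_commute)
    also have "\<dots> \<le> 2 * sq_integral (\<lambda>\<xi>. P n \<xi> - Q n \<xi>) + 2 * sq_integral (\<lambda>\<xi>. Q n \<xi> - h \<xi>)"
      by (rule nn_integral_norm_sq_add_le) measurable
    also have "\<dots> \<le> 2 * (?c * sq_integral (\<lambda>x. (\<theta> n x - \<iota> n x) * u x)) + 2 * sq_integral (\<lambda>\<xi>. Q n \<xi> - h \<xi>)"
      by (intro add_mono mult_left_mono PQ) auto
    finally show ?thesis .
  qed
  have "(\<lambda>n. 2 * (?c * sq_integral (\<lambda>x. (\<theta> n x - \<iota> n x) * u x)) + 2 * sq_integral (\<lambda>\<xi>. Q n \<xi> - h \<xi>)) \<longlonglongrightarrow> 2 * (?c * 0) + 2 * 0"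
    by (intro tendsto_add ennreal_tendsto_cmult PQ0 Qh) auto
  then have hP0: "(\<lambda>n. sq_integral (\<lambda>\<xi>. h \<xi> - P n \<xi>)) \<longlonglongrightarrow> 0"
    by (intro tendsto_sandwich[OF _ always_eventually[OF allI[OF hP]] tendsto_const]) auto
  have cut: "(\<integral>\<^sup>+\<xi>. ennreal (min (?W \<xi>) (real L) * (norm (h \<xi>))\<^sup>2) \<partial>lborel) \<le> 2 * K" for L :: nat
  proof -
    have le: "(\<integral>\<^sup>+\<xi>. ennreal (min (?W \<xi>) (real L) * (norm (h \<xi>))\<^sup>2) \<partial>lborel) \<le>
        2 * K + 2 * ennreal (real L) * sq_integral (\<lambda>\<xi>. h \<xi> - P n \<xi>)" for n
    proof -
      have "(\<integral>\<^sup>+\<xi>. ennreal (min (?W \<xi>) (real L) * (norm (h \<xi>))\<^sup>2) \<partial>lborel) \<le>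
        (\<integral>\<^sup>+\<xi>. 2 * ennreal (?W \<xi> * (norm (P n \<xi>))\<^sup>2) + 2 * ennreal (real L) * ennreal ((norm (h \<xi> - P n \<xi>))\<^sup>2) \<partial>lborel)"
      proof (rule nn_integral_mono)
        fix \<xi> :: 'a
        have "min (?W \<xi>) (real L) * (norm (h \<xi>))\<^sup>2 \<le> min (?W \<xi>) (real L) * (2 * (norm (P n \<xi>))\<^sup>2 + 2 * (norm (h \<xi> - P n \<xi>))\<^sup>2)"
          using norm_sq_add_le[of "P n \<xi>" "h \<xi> - P n \<xi>"] by (intro mult_left_mono) auto
        also have "\<dots> = min (?W \<xi>) (real L) * (2 * (norm (P n \<xi>))\<^sup>2) + min (?W \<xi>) (real L) * (2 * (norm (h \<xi> - P n \<xi>))\<^sup>2)"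
          by (rule distrib_left)
        also have "\<dots> \<le> ?W \<xi> * (2 * (norm (P n \<xi>))\<^sup>2) + real L * (2 * (norm (h \<xi> - P n \<xi>))\<^sup>2)"
          by (intro add_mono mult_right_mono) auto
        finally have "ennreal (min (?W \<xi>) (real L) * (norm (h \<xi>))\<^sup>2) \<le>
            ennreal (2 * (?W \<xi> * (norm (P n \<xi>))\<^sup>2) + 2 * real L * (norm (h \<xi> - P n \<xi>))\<^sup>2)"
          by (intro ennreal_leI) (simp add: mult_ac)
        also have "\<dots> = 2 * ennreal (?W \<xi> * (norm (P n \<xi>))\<^sup>2) + 2 * ennreal (real L) * ennreal ((norm (h \<xi> - P n \<xi>))\<^sup>2)"
          by (simp add: ennreal_plus ennreal_mult)
        finally show "ennreal (min (?W \<xi>) (real L) * (norm (h \<xi>))\<^sup>2) \<le> 2 * ennreal (?W \<xi> * (norm (P n \<xi>))\<^sup>2) + 2 * ennreal (real L) * ennreal ((norm (h \<xi> - P n \<xi>))\<^sup>2)" .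
      qed
      also have "\<dots> = 2 * (\<integral>\<^sup>+\<xi>. ennreal (?W \<xi> * (norm (P n \<xi>))\<^sup>2) \<partial>lborel) + 2 * ennreal (real L) * sq_integral (\<lambda>\<xi>. h \<xi> - P n \<xi>)"
        by (simp add: nn_integral_add nn_integral_cmult)
      also have "\<dots> \<le> 2 * K + 2 * ennreal (real L) * sq_integral (\<lambda>\<xi>. h \<xi> - P n \<xi>)"
        using K(2)[of n] unfolding P_def by (intro add_right_mono mult_left_mono) auto
      finally show ?thesis .
    qed
    have "(\<lambda>n. 2 * K + 2 * ennreal (real L) * sq_integral (\<lambda>\<xi>. h \<xi> - P n \<xi>)) \<longlonglongrightarrow> 2 * K + 2 * ennreal (real L) * 0"
      by (intro tendsto_add tendsto_const ennreal_tendsto_cmult hP0) (simp add: ennreal_mult_less_top)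
    then show ?thesis using LIMSEQ_le_const[of _ "2 * K"] le by auto
  qed
  have "(\<integral>\<^sup>+\<xi>. ennreal (?W \<xi> * (norm (h \<xi>))\<^sup>2) \<partial>lborel) =
      (\<integral>\<^sup>+\<xi>. liminf (\<lambda>L. ennreal (min (?W \<xi>) (real L) * (norm (h \<xi>))\<^sup>2)) \<partial>lborel)"
  proof (rule nn_integral_cong)
    fix \<xi> :: 'a
    obtain L0 :: nat where "?W \<xi> \<le> real L0" using real_arch_simple by blast
    then have "\<forall>\<^sub>F L in sequentially. ennreal (min (?W \<xi>) (real L) * (norm (h \<xi>))\<^sup>2) = ennreal (?W \<xi> * (norm (h \<xi>))\<^sup>2)"
      by (intro eventually_sequentiallyI[of L0]) (simp add: min_def)
    then have "(\<lambda>L. ennreal (min (?W \<xi>) (real L) * (norm (h \<xi>))\<^sup>2)) \<longlonglongrightarrow> ennreal (?W \<xi> * (norm (h \<xi>))\<^sup>2)"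
      by (rule tendsto_eventually)
    then show "ennreal (?W \<xi> * (norm (h \<xi>))\<^sup>2) = liminf (\<lambda>L. ennreal (min (?W \<xi>) (real L) * (norm (h \<xi>))\<^sup>2))"
      by (intro lim_imp_Liminf[symmetric]) simp_all
  qed
  also have "\<dots> \<le> liminf (\<lambda>L. \<integral>\<^sup>+\<xi>. ennreal (min (?W \<xi>) (real L) * (norm (h \<xi>))\<^sup>2) \<partial>lborel)"
    by (rule nn_integral_liminf) measurable
  also have "\<dots> \<le> liminf (\<lambda>L::nat. 2 * K)" by (intro Liminf_mono always_eventually allI cut)
  also have "\<dots> = 2 * K" by (simp add: Liminf_const)
  also have "\<dots> < \<infinity>" using K(1) by (simp add: ennreal_mult_less_top)
  finally have "integrable lborel (\<lambda>\<xi>. ?W \<xi> * (norm (h \<xi>))\<^sup>2)"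
    by (intro integrableI_nonneg) auto
  then show ?thesis unfolding sobolev_H_def using u h by blast
qed

section \<open>Duhamel solutions of the adjoint equation\<close>

definition phase :: "('b::euclidean_space \<Rightarrow> 'a::euclidean_space) \<Rightarrow> 'b \<Rightarrow> 'a \<Rightarrow> 'b \<Rightarrow> real \<Rightarrow> real" where
  "phase c F \<zeta> v r = integral {0..r} (\<lambda>q. c (v - q *\<^sub>R F) \<bullet> \<zeta>)"

text \<open>A superposition, with weight \<open>\<kappa>\<close>, of the values of \<open>\<psi>\<close> transported backwards along \<open>F\<close>, each with the phase
accumulated on the way. It is used for \<open>\<kappa> r = 1 - r\<close> and \<open>\<kappa> r = 1\<close>.\<close>
definition duhamel :: "(real \<Rightarrow> real) \<Rightarrow> ('b::euclidean_space \<Rightarrow> 'a::euclidean_space) \<Rightarrow> 'b \<Rightarrow> ('b \<Rightarrow> complex) \<Rightarrow> 'a \<Rightarrow> 'b \<Rightarrow> complex" where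
  "duhamel \<kappa> c F \<psi> \<zeta> v = integral {0..1} (\<lambda>r. of_real (\<kappa> r) * \<psi> (v - r *\<^sub>R F) * cis (phase c F \<zeta> v r))"

text \<open>An integral over the fixed interval \<open>[0, 1]\<close> shows the joint continuity in \<open>v\<close> and \<open>r\<close>.\<close>
lemma phase_stretch:
  assumes "0 \<le> r"
  shows "phase c F \<zeta> v r = r * integral {0..1} (\<lambda>p. c (v - (r * p) *\<^sub>R F) \<bullet> \<zeta>)"
proof (cases "r = 0")
  case False
  then have r: "r > 0" using assms by simp
  have im: "(\<lambda>x. x / r) ` {0..r} = {0..1}"
    using r by (auto simp: image_iff field_simps intro!: bexI[of _ "r * _"] mult_left_le)
  have "integral {0..1} (\<lambda>p. c (v - (r * p) *\<^sub>R F) \<bullet> \<zeta>) = (1 / \<bar>r\<bar>) *\<^sub>R integral {0..r} (\<lambda>q. c (v - q *\<^sub>R F) \<bullet> \<zeta>)"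
    using integral_stretch_real[of r 0 r "\<lambda>q. c (v - q *\<^sub>R F) \<bullet> \<zeta>"] r unfolding im by simp
  then show ?thesis using r by (simp add: phase_def)
qed (simp add: phase_def)

lemma continuous_on_phase:
  assumes c: "continuous_on UNIV c"
  shows "continuous_on (UNIV \<times> {0..1}) (\<lambda>(v, r). phase c F \<zeta> v r)"
proof -
  have "continuous_on (UNIV \<times> {0..1}) (\<lambda>x. integral (cbox 0 1) (\<lambda>p. c (fst x - (snd x * p) *\<^sub>R F) \<bullet> \<zeta>))"
    by (rule integral_continuous_on_param, unfold split_beta)
      (intro continuous_intros continuous_on_compose2[OF c]; simp)
  then have "continuous_on (UNIV \<times> {0..1}) (\<lambda>x. snd x * integral {0..1} (\<lambda>p. c (fst x - (snd x * p) *\<^sub>R F) \<bullet> \<zeta>))"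
    by (intro continuous_intros) (simp add: cbox_interval)
  then show ?thesis
    by (rule continuous_on_eq) (auto simp: phase_stretch)
qed

lemma continuous_on_duhamel:
  assumes c: "continuous_on UNIV c" and \<psi>: "continuous_on UNIV \<psi>" and \<kappa>: "continuous_on {0..1} \<kappa>"
  shows "continuous_on UNIV (duhamel \<kappa> c F \<psi> \<zeta>)"
proof -
  have "continuous_on (UNIV \<times> cbox 0 1) (\<lambda>(v, r). of_real (\<kappa> r) * \<psi> (v - r *\<^sub>R F) * cis (phase c F \<zeta> v r))"
    using continuous_on_phase[OF c, of F \<zeta>] unfolding split_beta
    by (intro continuous_intros continuous_on_compose2[OF \<psi>] continuous_on_compose2[OF \<kappa>])
      (auto simp: cbox_interval)
  from integral_continuous_on_param[OF this] show ?thesis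
    unfolding duhamel_def[abs_def] cbox_interval by simp
qed

text \<open>In \<open>duhamel_directional_derivative\<close> the arguments along a line stay between \<open>-2\<close> and \<open>1\<close>, so a
primitive on \<open>(-3, 3)\<close> is enough; it is extended by constants to be continuous everywhere.\<close>
lemma local_antiderivative:
  fixes f :: "real \<Rightarrow> 'c::banach"
  assumes f: "continuous_on UNIV f"
  obtains g where "continuous_on UNIV g" "\<And>x. x \<in> {-3<..<3} \<Longrightarrow> (g has_vector_derivative f x) (at x)"
proof
  define g where "g u = integral {-3..u} f" for u
  define clamp where "clamp x = max (- 3) (min 3 x)" for x :: real
  have gc: "continuous_on {-3..3} g"
    unfolding g_def by (intro indefinite_integral_continuous_1 integrable_continuous_real continuous_on_subset[OF f]) auto
  show "continuous_on UNIV (\<lambda>x. g (clamp x))"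
    unfolding clamp_def by (rule continuous_on_compose2[OF gc]) (auto intro!: continuous_intros)
  fix x :: real assume x: "x \<in> {-3<..<3}"
  have "(g has_vector_derivative f x) (at x within {-3..3})"
    unfolding g_def using x by (intro integral_has_vector_derivative continuous_on_subset[OF f]) auto
  then have "(g has_vector_derivative f x) (at x)"
    using x at_within_interior[of x "{-3..3}"] by (simp add: interior_atLeastAtMost_real)
  then show "((\<lambda>x. g (clamp x)) has_vector_derivative f x) (at x)"
    by (rule has_vector_derivative_transform_within_open[of _ _ _ "{-3<..<3}"])
      (use x in \<open>auto simp: clamp_def\<close>)
qed

lemma has_vector_derivative_reflect:
  fixes g :: "real \<Rightarrow> 'c::real_normed_vector"
  assumes "(g has_vector_derivative g') (at (s - r))"
  shows "((\<lambda>r. g (s - r)) has_vector_derivative - g') (at r within S)"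
proof -
  have "((\<lambda>r. s - r) has_real_derivative - 1) (at r)" by (auto intro!: derivative_eq_intros)
  then have "((\<lambda>r. s - r) has_vector_derivative - 1) (at r)" by (simp add: has_real_derivative_iff_has_vector_derivative)
  from vector_diff_chain_at[OF this assms] show ?thesis
    by (auto simp: o_def intro: has_vector_derivative_at_within)
qed

lemma has_vector_derivative_shift:
  fixes g :: "real \<Rightarrow> 'c::real_normed_vector"
  assumes "(g has_vector_derivative g') (at (s + d))"
  shows "((\<lambda>s. g (s + d)) has_vector_derivative g') (at s)"
proof -
  have "((\<lambda>r. r + d) has_real_derivative 1) (at s)" by (auto intro!: derivative_eq_intros)
  then have "((\<lambda>r. r + d) has_vector_derivative 1) (at s)" by (simp add: has_real_derivative_iff_has_vector_derivative)
  from vector_diff_chain_at[OF this assms] show ?thesis by (simp add: o_def)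
qed

lemma has_vector_derivative_cis:
  assumes "(G has_real_derivative p) (at x within S)"
  shows "((\<lambda>x. cis (G x)) has_vector_derivative \<i> * of_real p * cis (G x)) (at x within S)"
  using has_derivative_cis[OF assms[unfolded has_field_derivative_def]]
  unfolding has_vector_derivative_def by (simp add: scaleR_conv_of_real mult_ac)

text \<open>Along the line \<open>s \<mapsto> v + s F\<close> let \<open>H\<close> be a primitive of \<open>c \<cdot> \<zeta>\<close>, let \<open>A\<close> be a primitive of
\<open>P = \<psi> e^(-iH)\<close>, and \<open>A\<^sub>2\<close> one of \<open>A\<close>. The fundamental theorem evaluates the integrals over \<open>r\<close>: with weight
\<open>1 - r\<close> the value is \<open>e^(iH(s)) (A(s) - A\<^sub>2(s) + A\<^sub>2(s - 1))\<close>, and with weight \<open>1\<close> it is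
\<open>e^(iH(s)) (A(s) - A(s - 1))\<close>. Differentiating the former in \<open>s\<close> produces the latter.\<close>
lemma duhamel_directional_derivative:
  assumes c: "continuous_on UNIV c" and \<psi>: "continuous_on UNIV \<psi>"
  shows "((\<lambda>s. duhamel (\<lambda>r. 1 - r) c F \<psi> \<zeta> (v + s *\<^sub>R F)) has_vector_derivative
      \<i> * of_real (c v \<bullet> \<zeta>) * duhamel (\<lambda>r. 1 - r) c F \<psi> \<zeta> v + \<psi> v - duhamel (\<lambda>r. 1) c F \<psi> \<zeta> v) (at 0)"
proof -
  define p where "p x = c (v + x *\<^sub>R F) \<bullet> \<zeta>" for x
  have p: "continuous_on UNIV p" unfolding p_def by (intro continuous_intros continuous_on_compose2[OF c]) auto
  obtain H where Hc: "continuous_on UNIV H" and "\<And>x. x \<in> {-3<..<3} \<Longrightarrow> (H has_vector_derivative p x) (at x)"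
    using local_antiderivative[OF p] by blast
  then have H: "(H has_real_derivative p x) (at x)" if "x \<in> {-3<..<3}" for x
    using that by (simp add: has_real_derivative_iff_has_vector_derivative)
  define P where "P x = \<psi> (v + x *\<^sub>R F) * cis (- H x)" for x
  have P: "continuous_on UNIV P" unfolding P_def by (intro continuous_intros continuous_on_compose2[OF \<psi>] Hc) auto
  obtain A where Ac: "continuous_on UNIV A" and A: "\<And>x. x \<in> {-3<..<3} \<Longrightarrow> (A has_vector_derivative P x) (at x)"
    using local_antiderivative[OF P] by blast
  obtain A2 where A2: "\<And>x. x \<in> {-3<..<3} \<Longrightarrow> (A2 has_vector_derivative A x) (at x)"
    using local_antiderivative[OF Ac] by blast
  have ph: "phase c F \<zeta> (v + s *\<^sub>R F) r = H s - H (s - r)" if s: "s \<in> {-1<..<1}" and r: "r \<in> {0..1}" for s r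
  proof -
    have "((\<lambda>q. c ((v + s *\<^sub>R F) - q *\<^sub>R F) \<bullet> \<zeta>) has_integral (- H (s - r)) - (- H (s - 0))) {0..r}"
    proof (rule fundamental_theorem_of_calculus)
      fix q assume q: "q \<in> {0..r}"
      have "(H has_vector_derivative p (s - q)) (at (s - q))"
        using H[of "s - q"] s r q by (simp add: has_real_derivative_iff_has_vector_derivative)
      from has_vector_derivative_minus[OF has_vector_derivative_reflect[OF this]]
      show "((\<lambda>q. - H (s - q)) has_vector_derivative c ((v + s *\<^sub>R F) - q *\<^sub>R F) \<bullet> \<zeta>) (at q within {0..r})"
        by (simp add: p_def algebra_simps)
    qed (use r in simp)
    then show ?thesis by (simp add: phase_def integral_unique)
  qed
  have cis_split: "cis (x - y) = cis x * cis (- y)" for x y by (simp add: cis_mult)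
  have w1: "duhamel (\<lambda>r. 1) c F \<psi> \<zeta> (v + s *\<^sub>R F) = cis (H s) * (A s - A (s - 1))" if s: "s \<in> {-1<..<1}" for s
  proof -
    have "((\<lambda>r. P (s - r)) has_integral (- A (s - 1)) - (- A (s - 0))) {0..1}"
    proof (rule fundamental_theorem_of_calculus)
      fix r :: real assume "r \<in> {0..1}"
      then have "(A has_vector_derivative P (s - r)) (at (s - r))" using s by (intro A) auto
      from has_vector_derivative_minus[OF has_vector_derivative_reflect[OF this]]
      show "((\<lambda>r. - A (s - r)) has_vector_derivative P (s - r)) (at r within {0..1})" by simp
    qed simp
    then have "integral {0..1} (\<lambda>r. cis (H s) * P (s - r)) = cis (H s) * (A s - A (s - 1))"
      by (simp add: integral_unique)
    moreover have "duhamel (\<lambda>r. 1) c F \<psi> \<zeta> (v + s *\<^sub>R F) = integral {0..1} (\<lambda>r. cis (H s) * P (s - r))"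
      unfolding duhamel_def using s
      by (intro integral_cong) (auto simp: ph P_def cis_mult algebra_simps)
    ultimately show ?thesis by simp
  qed
  have w: "duhamel (\<lambda>r. 1 - r) c F \<psi> \<zeta> (v + s *\<^sub>R F) = cis (H s) * (A s - A2 s + A2 (s - 1))" if s: "s \<in> {-1<..<1}" for s
  proof -
    have "((\<lambda>r. of_real (1 - r) * P (s - r)) has_integral
        (- (of_real (1 - 1) * A (s - 1)) + A2 (s - 1)) - (- (of_real (1 - 0) * A (s - 0)) + A2 (s - 0))) {0..1}"
    proof (rule fundamental_theorem_of_calculus)
      fix r :: real assume "r \<in> {0..1}"
      then have 1: "(A has_vector_derivative P (s - r)) (at (s - r))" and 2: "(A2 has_vector_derivative A (s - r)) (at (s - r))"
        using s by (intro A A2; auto)+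
      have "((\<lambda>r. 1 - r) has_real_derivative - 1) (at r within {0..1})" by (auto intro!: derivative_eq_intros)
      then have 3: "((\<lambda>r. complex_of_real (1 - r)) has_vector_derivative of_real (- 1)) (at r within {0..1})"
        by (rule has_vector_derivative_of_real)
      from has_vector_derivative_add[OF has_vector_derivative_minus[OF has_vector_derivative_mult[OF 3 has_vector_derivative_reflect[OF 1]]]
          has_vector_derivative_reflect[OF 2]]
      show "((\<lambda>r. - (of_real (1 - r) * A (s - r)) + A2 (s - r)) has_vector_derivative of_real (1 - r) * P (s - r)) (at r within {0..1})"
        by (rule has_vector_derivative_eq_rhs) simp
    qed simp
    then have "integral {0..1} (\<lambda>r. cis (H s) * (of_real (1 - r) * P (s - r))) = cis (H s) * (A s - A2 s + A2 (s - 1))"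
      by (simp add: integral_unique)
    moreover have "duhamel (\<lambda>r. 1 - r) c F \<psi> \<zeta> (v + s *\<^sub>R F) = integral {0..1} (\<lambda>r. cis (H s) * (of_real (1 - r) * P (s - r)))"
      unfolding duhamel_def using s
      by (intro integral_cong) (simp add: ph P_def cis_split algebra_simps)
    ultimately show ?thesis by simp
  qed
  have "((\<lambda>s. cis (H s) * (A s - A2 s + A2 (s - 1))) has_vector_derivative
      cis (H 0) * (P 0 - A 0 + A (0 - 1)) + \<i> * of_real (p 0) * cis (H 0) * (A 0 - A2 0 + A2 (0 - 1))) (at 0)"
  proof (intro has_vector_derivative_mult has_vector_derivative_cis has_vector_derivative_add has_vector_derivative_diff)
    have "((\<lambda>s. A2 (s + - 1)) has_vector_derivative A (0 - 1)) (at 0)"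
      by (rule has_vector_derivative_shift) (use A2[of "-1"] in simp)
    then show "((\<lambda>s. A2 (s - 1)) has_vector_derivative A (0 - 1)) (at 0)" by simp
  qed (use A[of 0] A2[of 0] H[of 0] in auto)
  moreover have "cis (H 0) * (P 0 - A 0 + A (0 - 1)) + \<i> * of_real (p 0) * cis (H 0) * (A 0 - A2 0 + A2 (0 - 1)) =
      \<i> * of_real (c v \<bullet> \<zeta>) * duhamel (\<lambda>r. 1 - r) c F \<psi> \<zeta> v + \<psi> v - duhamel (\<lambda>r. 1) c F \<psi> \<zeta> v"
  proof -
    have \<psi>v: "\<psi> v = cis (H 0) * P 0" by (simp add: P_def cis_mult mult.left_commute)
    have w0: "duhamel (\<lambda>r. 1 - r) c F \<psi> \<zeta> v = cis (H 0) * (A 0 - A2 0 + A2 (0 - 1))"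
      and w10: "duhamel (\<lambda>r. 1) c F \<psi> \<zeta> v = cis (H 0) * (A 0 - A (0 - 1))"
      using w[of 0] w1[of 0] by simp_all
    show ?thesis unfolding w0 w10 \<psi>v by (simp add: p_def algebra_simps)
  qed
  ultimately have "((\<lambda>s. cis (H s) * (A s - A2 s + A2 (s - 1))) has_vector_derivative
      \<i> * of_real (c v \<bullet> \<zeta>) * duhamel (\<lambda>r. 1 - r) c F \<psi> \<zeta> v + \<psi> v - duhamel (\<lambda>r. 1) c F \<psi> \<zeta> v) (at 0)" by simp
  then show ?thesis
    by (rule has_vector_derivative_transform_within_open[of _ _ _ "{-1<..<1}"]) (use w in auto)
qed

lemma duhamel_support:
  assumes "\<And>v. \<rho> < norm v \<Longrightarrow> \<psi> v = 0" and v: "\<rho> + norm F < norm v"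
  shows "duhamel \<kappa> c F \<psi> \<zeta> v = 0"
proof -
  have zero: "\<psi> (v - r *\<^sub>R F) = 0" if r: "r \<in> {0..1}" for r
  proof (rule assms(1))
    have "norm v \<le> norm (v - r *\<^sub>R F) + norm (r *\<^sub>R F)"
      using norm_triangle_ineq[of "v - r *\<^sub>R F" "r *\<^sub>R F"] norm_triangle_ineq4[of v "r *\<^sub>R F"] by simp
    moreover have "norm (r *\<^sub>R F) \<le> 1 * norm F" using r by (auto simp: mult_left_le_one_le)
    ultimately show "\<rho> < norm (v - r *\<^sub>R F)" using v by simp
  qed
  have "duhamel \<kappa> c F \<psi> \<zeta> v = integral {0..1} (\<lambda>r::real. 0)"
    unfolding duhamel_def by (intro integral_cong) (simp add: zero)
  then show ?thesis by simp
qed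

text \<open>Each application of \<open>dir_deriv F\<close> uses up one order of differentiability.\<close>
lemma Ck_funpow_dir_deriv:
  "Ck k u \<Longrightarrow> j \<le> k \<Longrightarrow> Ck (k - j) ((dir_deriv F ^^ j) u)"
proof (induction j)
  case (Suc j)
  then have "Ck (Suc (k - Suc j)) ((dir_deriv F ^^ j) u)" by (simp add: Suc_diff_Suc)
  then show ?case by simp
qed simp

lemma has_vector_derivative_along_line:
  assumes "u differentiable (at (v - r *\<^sub>R F))"
  shows "((\<lambda>r. u (v - r *\<^sub>R F)) has_vector_derivative - dir_deriv F u (v - r *\<^sub>R F)) (at r within S)"
proof -
  have "((\<lambda>r. v - r *\<^sub>R F) has_derivative (\<lambda>h. - (h *\<^sub>R F))) (at r within S)"
    by (auto intro!: derivative_eq_intros)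
  from has_derivative_in_compose[OF this has_derivative_at_withinI[OF has_derivative_dir_deriv[OF assms]]]
  have "((\<lambda>r. u (v - r *\<^sub>R F)) has_derivative (\<lambda>h. dir_deriv (- (h *\<^sub>R F)) u (v - r *\<^sub>R F))) (at r within S)" .
  moreover have "dir_deriv (- (h *\<^sub>R F)) u (v - r *\<^sub>R F) = h *\<^sub>R - dir_deriv F u (v - r *\<^sub>R F)" for h
    using dir_deriv_scale_direction[OF assms, of "- h" F] by simp
  ultimately show ?thesis unfolding has_vector_derivative_def by simp
qed

text \<open>Along the backward line from \<open>v\<close>, the derivative of order \<open>j + 1\<close> of the phase is
\<open>(-1)\<^sup>j (F \<cdot> \<nabla>)\<^sup>j c \<cdot> \<zeta>\<close>. By compactness of a ball times the unit sphere, and by homogeneity in \<open>\<zeta>\<close>,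
nondegeneracy becomes a uniform lower bound by a multiple of \<open>|\<zeta>|\<close> for one of the orders \<open>j < \<gamma>\<close>; the same
expressions for \<open>1 \<le> j \<le> \<gamma>\<close> are bounded above, which limits their variation along the line. For \<open>|\<zeta>| < 1\<close> the trivial bound
by the size of the amplitude is used.\<close>
lemma duhamel_bound:
  fixes c :: "'b::euclidean_space \<Rightarrow> 'a::euclidean_space" and F :: 'b and \<psi> :: "'b \<Rightarrow> complex"
  assumes \<gamma>: "\<gamma> \<ge> 1" and c: "Ck \<gamma> c"
    and nondeg: "\<And>v \<sigma>. norm \<sigma> = 1 \<Longrightarrow> \<exists>k<\<gamma>. (dir_deriv F ^^ k) c v \<bullet> \<sigma> \<noteq> 0"
    and \<psi>: "Ck 1 \<psi>" "\<And>v. \<rho> < norm v \<Longrightarrow> \<psi> v = 0" and \<rho>: "\<rho> > 0"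
    and \<kappa>: "\<And>r. (\<kappa> has_real_derivative \<kappa>' r) (at r)" "continuous_on UNIV \<kappa>'"
  obtains C where "C \<ge> 0"
    "\<And>\<zeta> v. norm (duhamel \<kappa> c F \<psi> \<zeta> v) \<le> C * (1 + (norm \<zeta>)\<^sup>2) powr (- 1 / (2 * real \<gamma>))"
proof -
  define D where "D k = (dir_deriv F ^^ k) c" for k
  \<comment> \<open>The Duhamel integral vanishes for \<open>|v| > \<rho> + |F|\<close>, and otherwise the backward line stays in this ball.\<close>
  define \<rho>' where "\<rho>' = \<rho> + 2 * norm F"
  have Dc: "continuous_on UNIV (D k)" if "k \<le> \<gamma>" for k
    unfolding D_def using Ck_continuous[OF Ck_funpow_dir_deriv[OF c that]] .
  have Dd: "D k differentiable (at u)" if "k < \<gamma>" for k u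
  proof -
    have "Ck (Suc (\<gamma> - Suc k)) (D k)" unfolding D_def using Ck_funpow_dir_deriv[OF c, of k] that by (simp add: Suc_diff_Suc)
    then show ?thesis by simp
  qed
  have c0: "continuous_on UNIV c" using Dc[of 0] by (simp add: D_def)
  have \<psi>0: "continuous_on UNIV \<psi>" using \<psi>(1) Ck_continuous by blast
  have \<kappa>0: "continuous_on UNIV \<kappa>" using \<kappa>(1) DERIV_isCont continuous_at_imp_continuous_on by blast
  have "\<exists>m>0. \<forall>u\<in>cball 0 \<rho>'. \<forall>\<sigma>\<in>sphere 0 1. m \<le> (\<Sum>k<\<gamma>. \<bar>D k u \<bullet> \<sigma>\<bar>)"
  proof -
    let ?S = "cball (0::'b) \<rho>' \<times> sphere (0::'a) 1"
    have ne: "?S \<noteq> {}" using \<rho> norm_ge_zero[of F] by (auto simp: \<rho>'_def not_less intro!: add_nonneg_nonneg)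
    have cont: "continuous_on ?S (\<lambda>x. \<Sum>k<\<gamma>. \<bar>D k (fst x) \<bullet> snd x\<bar>)"
      by (intro continuous_intros continuous_on_compose2[OF Dc]) auto
    obtain x where x: "x \<in> ?S" "\<And>y. y \<in> ?S \<Longrightarrow> (\<Sum>k<\<gamma>. \<bar>D k (fst x) \<bullet> snd x\<bar>) \<le> (\<Sum>k<\<gamma>. \<bar>D k (fst y) \<bullet> snd y\<bar>)"
      using continuous_attains_inf[OF compact_Times[OF compact_cball compact_sphere] ne cont] by blast
    obtain k where "k < \<gamma>" "D k (fst x) \<bullet> snd x \<noteq> 0" using nondeg[of "snd x" "fst x"] x(1) by (auto simp: D_def)
    then have "0 < (\<Sum>k<\<gamma>. \<bar>D k (fst x) \<bullet> snd x\<bar>)" by (intro sum_pos2[of _ k]) auto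
    then show ?thesis using x(2) by (intro exI[of _ "\<Sum>k<\<gamma>. \<bar>D k (fst x) \<bullet> snd x\<bar>"]) force
  qed
  then obtain m where m: "m > 0" "\<And>u \<sigma>. u \<in> cball 0 \<rho>' \<Longrightarrow> norm \<sigma> = 1 \<Longrightarrow> m \<le> (\<Sum>k<\<gamma>. \<bar>D k u \<bullet> \<sigma>\<bar>)" by auto
  \<comment> \<open>A sum of \<open>\<gamma>\<close> terms that is at least \<open>m\<close> has a term of at least \<open>m / \<gamma> = 2 e\<close>.\<close>
  define e where "e = m / (2 * real \<gamma>)"
  have e: "e > 0" using m \<gamma> by (simp add: e_def)
  have large: "\<exists>k<\<gamma>. 2 * e * norm \<zeta> \<le> \<bar>D k u \<bullet> \<zeta>\<bar>" if u: "u \<in> cball 0 \<rho>'" and \<zeta>: "norm \<zeta> \<ge> 1" for u \<zeta>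
  proof (rule ccontr)
    assume "\<not> ?thesis"
    then have lt: "\<bar>D k u \<bullet> \<zeta>\<bar> < 2 * e * norm \<zeta>" if "k < \<gamma>" for k using that by force
    have "norm \<zeta> > 0" using \<zeta> by linarith
    have "m * norm \<zeta> \<le> (\<Sum>k<\<gamma>. \<bar>D k u \<bullet> (\<zeta> /\<^sub>R norm \<zeta>)\<bar>) * norm \<zeta>"
      using \<open>norm \<zeta> > 0\<close> by (intro mult_right_mono m u) auto
    also have "\<dots> = (\<Sum>k<\<gamma>. \<bar>D k u \<bullet> \<zeta>\<bar>)"
      using \<open>norm \<zeta> > 0\<close> by (auto simp: sum_divide_distrib[symmetric] abs_mult abs_inverse field_simps)
    also have "\<dots> < (\<Sum>k<\<gamma>. 2 * e * norm \<zeta>)" using \<gamma> lt by (intro sum_strict_mono) (auto simp: lessThan_empty_iff)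
    also have "\<dots> = m * norm \<zeta>" using \<gamma> by (simp add: e_def)
    finally show False by simp
  qed
  have "\<exists>B\<ge>0. \<forall>k\<le>\<gamma>. \<forall>u\<in>cball 0 \<rho>'. norm (D k u) \<le> B"
  proof -
    have "compact ((\<lambda>u. \<Sum>k\<le>\<gamma>. norm (D k u)) ` cball 0 \<rho>')"
      by (intro compact_continuous_image continuous_intros continuous_on_subset[OF Dc] compact_cball) auto
    then have "bounded ((\<lambda>u. \<Sum>k\<le>\<gamma>. norm (D k u)) ` cball 0 \<rho>')" by (rule compact_imp_bounded)
    then obtain B where B': "B > 0" "\<forall>y\<in>(\<lambda>u. \<Sum>k\<le>\<gamma>. norm (D k u)) ` cball 0 \<rho>'. norm y \<le> B"
      unfolding bounded_pos by blast
    have B: "B > 0" "\<And>u. u \<in> cball 0 \<rho>' \<Longrightarrow> \<bar>\<Sum>k\<le>\<gamma>. norm (D k u)\<bar> \<le> B"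
      using B'(1) bspec[OF B'(2) imageI] by simp_all
    have "norm (D k u) \<le> B" if "k \<le> \<gamma>" "u \<in> cball 0 \<rho>'" for k u
    proof -
      have "norm (D k u) \<le> (\<Sum>k\<le>\<gamma>. norm (D k u))" by (rule member_le_sum) (use that in auto)
      then show ?thesis using B(2)[OF that(2)] by linarith
    qed
    then show ?thesis using B(1) less_imp_le by blast
  qed
  then obtain B where B: "B \<ge> 0" "\<And>k u. k \<le> \<gamma> \<Longrightarrow> u \<in> cball 0 \<rho>' \<Longrightarrow> norm (D k u) \<le> B" by blast
  define C0 where "C0 = real (Suc (nat \<lceil>B / e\<rceil>)) * oscillation_const \<gamma> e B"
  have C0: "C0 \<ge> 0" unfolding C0_def using oscillation_const_nonneg(3)[OF e B(1)] by (intro mult_nonneg_nonneg) auto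
  define d\<psi> where "d\<psi> = dir_deriv F \<psi>"
  have d\<psi>0: "continuous_on UNIV d\<psi>" unfolding d\<psi>_def using \<psi>(1) by simp
  define amp where "amp v r = of_real (\<kappa> r) * \<psi> (v - r *\<^sub>R F)" for v and r :: real
  define amp' where "amp' v r = of_real (\<kappa> r) * - d\<psi> (v - r *\<^sub>R F) + of_real (\<kappa>' r) * \<psi> (v - r *\<^sub>R F)" for v and r :: real
  have amp: "(amp v has_vector_derivative amp' v r) (at r within {0..1})" for v r
  proof -
    have 1: "((\<lambda>r. complex_of_real (\<kappa> r)) has_vector_derivative of_real (\<kappa>' r)) (at r within {0..1})"
      by (intro has_vector_derivative_of_real DERIV_subset[OF \<kappa>(1)]) simp
    have "\<psi> differentiable (at (v - r *\<^sub>R F))" using \<psi>(1) by simp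
    from has_vector_derivative_mult[OF 1 has_vector_derivative_along_line[OF this]]
    show ?thesis unfolding amp_def amp'_def d\<psi>_def by simp
  qed
  have amp'c: "continuous_on {0..1} (amp' v)" for v
    unfolding amp'_def
    by (intro continuous_intros continuous_on_compose2[OF d\<psi>0] continuous_on_compose2[OF \<psi>0] continuous_on_compose2[OF \<kappa>0] continuous_on_compose2[OF \<kappa>(2)]) auto
  have "\<exists>M\<ge>0. \<forall>u\<in>cball 0 \<rho>'. \<forall>r\<in>{0..1}. norm (\<psi> u) * \<bar>\<kappa> r\<bar> + norm (d\<psi> u) * \<bar>\<kappa> r\<bar> + norm (\<psi> u) * \<bar>\<kappa>' r\<bar> \<le> M"
  proof -
    let ?h = "\<lambda>x. norm (\<psi> (fst x)) * \<bar>\<kappa> (snd x)\<bar> + norm (d\<psi> (fst x)) * \<bar>\<kappa> (snd x)\<bar> + norm (\<psi> (fst x)) * \<bar>\<kappa>' (snd x)\<bar>"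
    have "compact (?h ` (cball 0 \<rho>' \<times> {0..1}))"
      by (intro compact_continuous_image continuous_intros compact_Times compact_cball compact_Icc
          continuous_on_compose2[OF d\<psi>0] continuous_on_compose2[OF \<psi>0] continuous_on_compose2[OF \<kappa>0] continuous_on_compose2[OF \<kappa>(2)]) auto
    then have "bounded (?h ` (cball 0 \<rho>' \<times> {0..1}))" by (rule compact_imp_bounded)
    then obtain M where M': "M > 0" "\<forall>y\<in>?h ` (cball 0 \<rho>' \<times> {0..1}). norm y \<le> M"
      unfolding bounded_pos by blast
    have M: "M > 0" "\<And>x. x \<in> cball 0 \<rho>' \<times> {0..1} \<Longrightarrow> \<bar>?h x\<bar> \<le> M"
      using M'(1) bspec[OF M'(2) imageI] by (simp_all only: real_norm_def)
    have "?h (u, r) \<le> M" if "u \<in> cball 0 \<rho>'" "r \<in> {0..1}" for u r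
      using M(2)[of "(u, r)"] that by simp
    then show ?thesis using M(1) by (intro exI[of _ M]) auto
  qed
  then obtain M where M: "M \<ge> 0" "\<And>u r. u \<in> cball 0 \<rho>' \<Longrightarrow> r \<in> {0..1} \<Longrightarrow>
      norm (\<psi> u) * \<bar>\<kappa> r\<bar> + norm (d\<psi> u) * \<bar>\<kappa> r\<bar> + norm (\<psi> u) * \<bar>\<kappa>' r\<bar> \<le> M" by blast
  define C where "C = 2 * (2 * M * C0 + M)"
  \<comment> \<open>The factor \<open>1 / 2\<close> absorbs \<open>2^(-1/(2\<gamma>))\<close>, from \<open>1 + |\<zeta>|\<^sup>2 \<le> 2 max(1, |\<zeta>|)\<^sup>2\<close>.\<close>
  have weight: "1 / 2 * max 1 (norm \<zeta>) powr (- 1 / real \<gamma>) \<le> (1 + (norm \<zeta>)\<^sup>2) powr (- 1 / (2 * real \<gamma>))" for \<zeta> :: 'a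
  proof -
    let ?L = "max 1 (norm \<zeta>)"
    have L: "?L \<ge> 1" by simp
    have "1 + (norm \<zeta>)\<^sup>2 \<le> 2 * ?L\<^sup>2"
    proof -
      have "1 \<le> ?L\<^sup>2" using L by (simp add: one_le_power)
      moreover have "(norm \<zeta>)\<^sup>2 \<le> ?L\<^sup>2" by (intro power_mono) auto
      ultimately show ?thesis by linarith
    qed
    then have "(2 * ?L\<^sup>2) powr (- 1 / (2 * real \<gamma>)) \<le> (1 + (norm \<zeta>)\<^sup>2) powr (- 1 / (2 * real \<gamma>))"
      by (intro powr_mono2') (auto simp: add_pos_nonneg)
    moreover have "(2 * ?L\<^sup>2) powr (- 1 / (2 * real \<gamma>)) = 2 powr (- 1 / (2 * real \<gamma>)) * ?L powr (- 1 / real \<gamma>)"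
    proof -
      have "?L\<^sup>2 = ?L powr 2" using L by (subst powr_numeral) auto
      then have "(2 * ?L\<^sup>2) powr (- 1 / (2 * real \<gamma>)) = 2 powr (- 1 / (2 * real \<gamma>)) * (?L powr 2) powr (- 1 / (2 * real \<gamma>))"
        by (simp only: powr_mult)
      also have "(?L powr 2) powr (- 1 / (2 * real \<gamma>)) = ?L powr (2 * (- 1 / (2 * real \<gamma>)))" by (rule powr_powr)
      also have "2 * (- 1 / (2 * real \<gamma>)) = - 1 / real \<gamma>" by simp
      finally show ?thesis .
    qed
    moreover have "1 / 2 \<le> (2::real) powr (- 1 / (2 * real \<gamma>))"
    proof -
      have "(2::real) powr (- 1) \<le> 2 powr (- 1 / (2 * real \<gamma>))" using \<gamma> by (intro powr_mono) (auto simp: field_simps)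
      then show ?thesis by (simp add: powr_minus)
    qed
    ultimately show ?thesis by (smt (verit) mult_right_mono powr_ge_zero)
  qed
  have main: "norm (duhamel \<kappa> c F \<psi> \<zeta> v) \<le> (2 * M * C0 + M) * max 1 (norm \<zeta>) powr (- 1 / real \<gamma>)" for \<zeta> v
  proof (cases "norm v \<le> \<rho> + norm F")
    case False
    then have "duhamel \<kappa> c F \<psi> \<zeta> v = 0" using duhamel_support[of \<rho> \<psi> F v] \<psi>(2) by simp
    then show ?thesis using M C0 by simp
  next
    case True
    have u: "v - r *\<^sub>R F \<in> cball 0 \<rho>'" if "r \<in> {0..1}" for r
    proof -
      have "norm (v - r *\<^sub>R F) \<le> norm v + norm (r *\<^sub>R F)"
      using norm_triangle_ineq[of "v - r *\<^sub>R F" "r *\<^sub>R F"] norm_triangle_ineq4[of v "r *\<^sub>R F"] by simp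
      moreover have "norm (r *\<^sub>R F) \<le> 1 * norm F" using that by (auto simp: mult_left_le_one_le)
      ultimately show ?thesis using True by (simp add: \<rho>'_def)
    qed
    have ampM: "norm (amp v r) \<le> M" "norm (amp' v r) \<le> M" if r: "r \<in> {0..1}" for r
    proof -
      have "norm (amp' v r) \<le> norm (\<kappa> r * - d\<psi> (v - r *\<^sub>R F)) + norm (\<kappa>' r * \<psi> (v - r *\<^sub>R F))"
        unfolding amp'_def by (rule norm_triangle_ineq)
      also have "\<dots> = norm (d\<psi> (v - r *\<^sub>R F)) * \<bar>\<kappa> r\<bar> + norm (\<psi> (v - r *\<^sub>R F)) * \<bar>\<kappa>' r\<bar>"
        by (simp add: norm_mult)
      finally show "norm (amp' v r) \<le> M" using M(2)[OF u[OF r] r] by (smt (verit) abs_ge_zero mult_nonneg_nonneg norm_ge_zero)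
      have "norm (amp v r) = norm (\<psi> (v - r *\<^sub>R F)) * \<bar>\<kappa> r\<bar>" by (simp add: amp_def norm_mult)
      then show "norm (amp v r) \<le> M" using M(2)[OF u[OF r] r] by (smt (verit) abs_ge_zero mult_nonneg_nonneg norm_ge_zero)
    qed
    have ampc: "continuous_on {0..1} (amp v)"
      using has_vector_derivative_continuous[OF amp] by (auto simp: continuous_on_eq_continuous_within)
    have Qd: "(phase c F \<zeta> v has_real_derivative c (v - r *\<^sub>R F) \<bullet> \<zeta>) (at r within {0..1})" if "r \<in> {0..1}" for r
      unfolding phase_def[abs_def]
      by (rule integral_has_real_derivative[OF _ that]) (intro continuous_intros continuous_on_compose2[OF c0]; simp)
    have Qc: "continuous_on {0..1} (phase c F \<zeta> v)" using DERIV_continuous_on[OF Qd] by auto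
    have eq: "duhamel \<kappa> c F \<psi> \<zeta> v = integral {0..1} (\<lambda>r. amp v r * cis (phase c F \<zeta> v r))"
      by (simp add: duhamel_def amp_def)
    show ?thesis
    proof (cases "norm \<zeta> \<ge> 1")
      case False
      have "norm (duhamel \<kappa> c F \<psi> \<zeta> v) \<le> M * (1 - 0)"
        unfolding eq by (rule integral_bound) (auto intro!: continuous_intros ampc Qc simp: norm_mult ampM)
      also have "\<dots> \<le> 2 * M * C0 + M" using M C0 by simp
      finally show ?thesis using False by simp
    next
      case True
      define q where "q j r = (- 1) ^ j * (D j (v - r *\<^sub>R F) \<bullet> \<zeta>)" for j and r :: real
      have "norm (duhamel \<kappa> c F \<psi> \<zeta> v) \<le> 2 * M * (C0 * norm \<zeta> powr (- 1 / real \<gamma>))"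
        unfolding eq
      proof (rule oscillatory_amplitude[OF _ _ amp amp'c ampM])
        show "continuous_on {0..1} (\<lambda>r. cis (phase c F \<zeta> v r))" by (intro continuous_intros Qc)
        fix s :: real assume s: "s \<in> {0..1}"
        show "norm (integral {0..s} (\<lambda>r. cis (phase c F \<zeta> v r))) \<le> C0 * norm \<zeta> powr (- 1 / real \<gamma>)"
          unfolding C0_def
        proof (rule oscillatory_unit_interval[OF e B(1) \<gamma> _ _ True, where q = q])
          show "derivative_chain {0..1} \<gamma> (phase c F \<zeta> v) q"
            unfolding derivative_chain_def
          proof (intro conjI allI impI ballI)
            show "(phase c F \<zeta> v has_real_derivative q 0 x) (at x within {0..1})" if "x \<in> {0..1}" for x
              using Qd[OF that] by (simp add: q_def D_def)
            show "continuous_on {0..1} (q \<gamma>)"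
              unfolding q_def by (intro continuous_intros continuous_on_compose2[OF Dc]) auto
            fix j and x :: real assume "j < \<gamma>"
            have "((\<lambda>r. D j (v - r *\<^sub>R F)) has_vector_derivative - dir_deriv F (D j) (v - x *\<^sub>R F)) (at x within {0..1})"
              by (rule has_vector_derivative_along_line[OF Dd]) fact
            from bounded_linear.has_vector_derivative[OF bounded_linear_inner_left this, of \<zeta>]
            have "((\<lambda>r. D j (v - r *\<^sub>R F) \<bullet> \<zeta>) has_real_derivative - (D (Suc j) (v - x *\<^sub>R F) \<bullet> \<zeta>)) (at x within {0..1})"
              by (simp add: has_real_derivative_iff_has_vector_derivative D_def)
            from DERIV_cmult[OF this, of "(- 1) ^ j"]
            show "(q j has_real_derivative q (Suc j) x) (at x within {0..1})"
              unfolding q_def[abs_def] by simp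
          qed
          show "\<forall>j\<in>{1..\<gamma>}. \<forall>x\<in>{0..1}. \<bar>q j x\<bar> \<le> B * norm \<zeta>"
          proof (intro ballI)
            fix j and x :: real assume j: "j \<in> {1..\<gamma>}" and x: "x \<in> {0..1}"
            have "\<bar>q j x\<bar> = \<bar>D j (v - x *\<^sub>R F) \<bullet> \<zeta>\<bar>" by (simp add: q_def abs_mult power_abs)
            also have "\<dots> \<le> norm (D j (v - x *\<^sub>R F)) * norm \<zeta>" by (rule Cauchy_Schwarz_ineq2)
            also have "\<dots> \<le> B * norm \<zeta>" using B(2)[of j] j u[OF x] by (intro mult_right_mono) auto
            finally show "\<bar>q j x\<bar> \<le> B * norm \<zeta>" .
          qed
          show "\<forall>x\<in>{0..1}. \<exists>k<\<gamma>. 2 * e * norm \<zeta> \<le> \<bar>q k x\<bar>"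
            using large[OF u True] by (simp add: q_def abs_mult power_abs)
        qed (use s in auto)
      qed
      also have "\<dots> \<le> (2 * M * C0 + M) * norm \<zeta> powr (- 1 / real \<gamma>)"
        using M by (simp add: algebra_simps)
      finally show ?thesis using True by (simp add: max_def)
    qed
  qed
  show thesis
  proof (rule that)
    show "C \<ge> 0" using M C0 by (simp add: C_def)
    fix \<zeta> v
    have half: "C * (1 / 2 * x) = (2 * M * C0 + M) * x" for x by (simp add: C_def algebra_simps)
    have "norm (duhamel \<kappa> c F \<psi> \<zeta> v) \<le> C * (1 / 2 * max 1 (norm \<zeta>) powr (- 1 / real \<gamma>))"
      using main[of \<zeta> v] unfolding half by simp
    also have "\<dots> \<le> C * (1 + (norm \<zeta>)\<^sup>2) powr (- 1 / (2 * real \<gamma>))"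
      using M C0 by (intro mult_left_mono weight) (simp add: C_def)
    finally show "norm (duhamel \<kappa> c F \<psi> \<zeta> v) \<le> C * (1 + (norm \<zeta>)\<^sup>2) powr (- 1 / (2 * real \<gamma>))" .
  qed
qed


lemma integrable_local_times_bounded_support:
  fixes U h :: "'b::euclidean_space \<Rightarrow> complex"
  assumes U: "\<And>r. integrable lborel (\<lambda>v. indicator (cball 0 r) v *\<^sub>R U v)"
    and h: "continuous_on UNIV h" "\<And>v. r < norm v \<Longrightarrow> h v = 0"
  shows "integrable lborel (\<lambda>v. U v * h v)"
proof -
  obtain C where C: "C \<ge> 0" "\<And>v. norm (h v) \<le> C" using bounded_continuous_bounded_support[OF h] by blast
  have [measurable]: "h \<in> borel_measurable borel" by (rule borel_measurable_continuous_onI[OF h(1)])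
  have e: "(\<lambda>v. U v * h v) = (\<lambda>v. (indicator (cball 0 r) v *\<^sub>R U v) * h v)"
    using h(2) by (force simp: indicator_def)
  have [measurable]: "(\<lambda>v. indicator (cball 0 r) v *\<^sub>R U v) \<in> borel_measurable borel"
    using borel_measurable_integrable[OF U[of r]] by simp
  show ?thesis unfolding e
  proof (rule Bochner_Integration.integrable_bound)
    show "integrable lborel (\<lambda>v. C * norm (indicator (cball 0 r) v *\<^sub>R U v))"
      by (intro integrable_mult_right integrable_norm U)
    have "norm ((indicator (cball 0 r) v *\<^sub>R U v) * h v) \<le> norm (C * norm (indicator (cball 0 r) v *\<^sub>R U v))" for v
      using mult_right_mono[OF C(2)[of v], of "norm (indicator (cball 0 r) v *\<^sub>R U v)"] C(1)
      by (simp add: norm_mult mult_ac abs_mult)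
    then show "AE v in lborel. norm ((indicator (cball 0 r) v *\<^sub>R U v) * h v) \<le> norm (C * norm (indicator (cball 0 r) v *\<^sub>R U v))"
      by simp
  qed measurable
qed

text \<open>The weak equation in \<open>v\<close> is tested with mollifications of the weighted Duhamel integral. Only its derivative
along \<open>F\<close> enters the equation, so the convergence of the function and of that derivative is enough.\<close>
lemma duhamel_duality:
  fixes c :: "'b::euclidean_space \<Rightarrow> 'a::euclidean_space" and U G \<psi> :: "'b \<Rightarrow> complex"
  assumes c: "continuous_on UNIV c" and \<psi>: "continuous_on UNIV \<psi>" "\<And>v. \<rho> < norm v \<Longrightarrow> \<psi> v = 0" and \<rho>: "\<rho> > 0"
    and [measurable]: "U \<in> borel_measurable borel" "G \<in> borel_measurable borel"
    and U: "\<And>r. integrable lborel (\<lambda>v. indicator (cball 0 r) v *\<^sub>R U v)"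
    and G: "\<And>r. integrable lborel (\<lambda>v. indicator (cball 0 r) v *\<^sub>R G v)"
    and weak: "\<And>\<beta>. test_fun \<beta> \<Longrightarrow>
      (\<integral>v. U v * (dir_deriv F \<beta> v - \<i> * of_real (c v \<bullet> \<zeta>) * \<beta> v) \<partial>lborel) = - (\<integral>v. G v * \<beta> v \<partial>lborel)"
  shows "(\<integral>v. U v * \<psi> v \<partial>lborel) =
    (\<integral>v. U v * duhamel (\<lambda>r. 1) c F \<psi> \<zeta> v \<partial>lborel) - (\<integral>v. G v * duhamel (\<lambda>r. 1 - r) c F \<psi> \<zeta> v \<partial>lborel)"
proof -
  define w where "w = duhamel (\<lambda>r. 1 - r) c F \<psi> \<zeta>"
  define w1 where "w1 = duhamel (\<lambda>r. 1) c F \<psi> \<zeta>"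
  define b where "b v = complex_of_real (c v \<bullet> \<zeta>)" for v
  define D where "D v = \<i> * b v * w v + \<psi> v - w1 v" for v
  define r where "r = \<rho> + norm F"
  have r: "r > 0" "\<rho> \<le> r" using \<rho> norm_ge_zero[of F] unfolding r_def by linarith+
  have bc: "continuous_on UNIV b" unfolding b_def by (intro continuous_intros c)
  have wc: "continuous_on UNIV w" and w1c: "continuous_on UNIV w1"
    unfolding w_def w1_def by (intro continuous_on_duhamel c \<psi> continuous_intros)+
  have Dc: "continuous_on UNIV D" unfolding D_def by (intro continuous_intros bc wc w1c \<psi>)
  have ws: "w v = 0" and w1s: "w1 v = 0" if "r < norm v" for v
    unfolding w_def w1_def using that \<psi>(2) by (intro duhamel_support[of \<rho>]; simp add: r_def)+
  have Ds: "D v = 0" if "r < norm v" for v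
    using that ws w1s \<psi>(2)[of v] r unfolding D_def by simp
  have wD: "((\<lambda>s. w (v + s *\<^sub>R F)) has_vector_derivative D v) (at 0)" for v
    unfolding w_def w1_def D_def b_def by (rule duhamel_directional_derivative[OF c \<psi>(1)])
  obtain \<beta>n C where \<beta>n: "\<And>n. test_fun (\<beta>n n)"
    "\<And>v. (\<lambda>n. \<beta>n n v) \<longlonglongrightarrow> w v" "\<And>v. (\<lambda>n. dir_deriv F (\<beta>n n) v) \<longlonglongrightarrow> D v"
    "\<And>n v. norm (\<beta>n n v) \<le> C * indicator (cball 0 (r + 1)) v"
    "\<And>n v. norm (dir_deriv F (\<beta>n n) v) \<le> C * indicator (cball 0 (r + 1)) v"
    using mollification[OF wc Dc wD ws Ds r(1)] by blast
  let ?K = "cball (0::'b) (r + 1)"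
  have C0: "C \<ge> 0" using \<beta>n(4)[of 0 0] r order.trans[OF norm_ge_zero, of "\<beta>n 0 0" C] by (simp add: indicator_def)
  have "bounded (b ` ?K)"
    by (intro compact_imp_bounded compact_continuous_image continuous_on_subset[OF bc] compact_cball) auto
  then obtain B where B: "B > 0" "\<And>v. v \<in> ?K \<Longrightarrow> norm (b v) \<le> B" unfolding bounded_pos by blast
  have t0: "Ck 0 (\<beta>n n)" "\<And>w. Ck 0 (dir_deriv w (\<beta>n n))" for n
    using \<beta>n(1)[of n] unfolding test_fun_def by (metis Ck.simps(2))+
  have [measurable]: "\<beta>n n \<in> borel_measurable borel" "dir_deriv F (\<beta>n n) \<in> borel_measurable borel" for n
    using t0 by (auto intro!: borel_measurable_continuous_onI simp del: Ck.simps(2))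
  have [measurable]: "b \<in> borel_measurable borel" "w \<in> borel_measurable borel" "D \<in> borel_measurable borel"
    by (intro borel_measurable_continuous_onI bc wc Dc)+
  have 1: "(\<lambda>n. \<integral>v. U v * (dir_deriv F (\<beta>n n) v - \<i> * b v * \<beta>n n v) \<partial>lborel) \<longlonglongrightarrow> (\<integral>v. U v * (D v - \<i> * b v * w v) \<partial>lborel)"
  proof (rule integral_dominated_convergence[where w = "\<lambda>v. (C + B * C) * norm (indicator ?K v *\<^sub>R U v)"])
    show "integrable lborel (\<lambda>v. (C + B * C) * norm (indicator ?K v *\<^sub>R U v))"
      by (intro integrable_mult_right integrable_norm U)
    show "AE v in lborel. (\<lambda>n. U v * (dir_deriv F (\<beta>n n) v - \<i> * b v * \<beta>n n v)) \<longlonglongrightarrow> U v * (D v - \<i> * b v * w v)"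
      by (intro AE_I2 tendsto_intros \<beta>n)
    have "norm (U v * (dir_deriv F (\<beta>n n) v - \<i> * b v * \<beta>n n v)) \<le> (C + B * C) * norm (indicator ?K v *\<^sub>R U v)" for n v
    proof (cases "v \<in> ?K")
      case True
      have "norm (dir_deriv F (\<beta>n n) v - \<i> * b v * \<beta>n n v) \<le> norm (dir_deriv F (\<beta>n n) v) + norm (\<i> * b v * \<beta>n n v)"
        by (rule norm_triangle_ineq4)
      also have "\<dots> \<le> C + B * C"
        using \<beta>n(4)[of n v] \<beta>n(5)[of n v] True B C0 by (intro add_mono) (auto simp: norm_mult intro!: mult_mono)
      finally show ?thesis using True by (simp add: norm_mult mult.commute mult_left_mono)
    next
      case False
      then show ?thesis using \<beta>n(4)[of n v] \<beta>n(5)[of n v] by (simp add: indicator_def)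
    qed
    then show "AE v in lborel. norm (U v * (dir_deriv F (\<beta>n n) v - \<i> * b v * \<beta>n n v)) \<le> (C + B * C) * norm (indicator ?K v *\<^sub>R U v)" for n
      by simp
  qed measurable
  have 2: "(\<lambda>n. \<integral>v. G v * \<beta>n n v \<partial>lborel) \<longlonglongrightarrow> (\<integral>v. G v * w v \<partial>lborel)"
  proof (rule integral_dominated_convergence[where w = "\<lambda>v. C * norm (indicator ?K v *\<^sub>R G v)"])
    show "integrable lborel (\<lambda>v. C * norm (indicator ?K v *\<^sub>R G v))"
      by (intro integrable_mult_right integrable_norm G)
    show "AE v in lborel. (\<lambda>n. G v * \<beta>n n v) \<longlonglongrightarrow> G v * w v"
      by (intro AE_I2 tendsto_intros \<beta>n)
    have "norm (G v * \<beta>n n v) \<le> C * norm (indicator ?K v *\<^sub>R G v)" for n v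
    proof (cases "v \<in> ?K")
      case True
      then show ?thesis using mult_left_mono[OF \<beta>n(4)[of n v], of "norm (G v)"] by (simp add: norm_mult mult.commute)
    next
      case False
      then show ?thesis using \<beta>n(4)[of n v] by (simp add: indicator_def)
    qed
    then show "AE v in lborel. norm (G v * \<beta>n n v) \<le> C * norm (indicator ?K v *\<^sub>R G v)" for n by simp
  qed measurable
  have "(\<integral>v. U v * (dir_deriv F (\<beta>n n) v - \<i> * b v * \<beta>n n v) \<partial>lborel) = - (\<integral>v. G v * \<beta>n n v \<partial>lborel)" for n
    unfolding b_def by (rule weak[OF \<beta>n(1)])
  then have "(\<integral>v. U v * (D v - \<i> * b v * w v) \<partial>lborel) = - (\<integral>v. G v * w v \<partial>lborel)"
    using LIMSEQ_unique[OF 1] tendsto_minus[OF 2] by simp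
  moreover have "(\<integral>v. U v * (D v - \<i> * b v * w v) \<partial>lborel) = (\<integral>v. U v * \<psi> v - U v * w1 v \<partial>lborel)"
    by (simp add: D_def right_diff_distrib)
  moreover have "\<dots> = (\<integral>v. U v * \<psi> v \<partial>lborel) - (\<integral>v. U v * w1 v \<partial>lborel)"
    by (intro Bochner_Integration.integral_diff integrable_local_times_bounded_support[OF U \<psi>]
        integrable_local_times_bounded_support[OF U w1c w1s])
  ultimately show ?thesis by (simp add: w_def[symmetric] w1_def[symmetric] algebra_simps)
qed

section \<open>Fourier transform of the velocity average\<close>

text \<open>For a function that is not integrable the Fourier integral is the integral of a function that is not
integrable, and this has the value \<open>0\<close> by convention. Allowing this case avoids discarding null sets of \<open>v\<close> below.\<close>
lemma plancherel_inequality_measurable: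
  fixes u :: "'a::euclidean_space \<Rightarrow> complex"
  assumes [measurable]: "u \<in> borel_measurable borel"
  shows "sq_integral (fourier_integral u)
     \<le> ennreal ((2 * pi) ^ DIM('a)) * sq_integral u"
proof (cases "integrable lborel u")
  case False
  have "\<not> integrable lborel (\<lambda>x. cis (- (x \<bullet> \<xi>)) * u x)" for \<xi>
  proof
    assume "integrable lborel (\<lambda>x. cis (- (x \<bullet> \<xi>)) * u x)"
    then have "integrable lborel u"
      by (rule Bochner_Integration.integrable_bound[OF integrable_norm]) (auto simp: norm_mult)
    then show False using False by simp
  qed
  then have "fourier_integral u \<xi> = 0" for \<xi>
    unfolding fourier_integral_def by (simp add: not_integrable_integral_eq)
  then show ?thesis by simp
qed (rule plancherel_inequality)

text \<open>Fubini's theorem for the partial Fourier transform in \<open>y\<close>. The cutoffs \<open>\<Theta>\<close> and \<open>k\<close> confine the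
integrand to a bounded set, where functions in \<open>L\<^sup>2\<close> are integrable.\<close>
lemma
  fixes f :: "'a::euclidean_space \<times> 'b::euclidean_space \<Rightarrow> complex"
  assumes f: "L2 f" and \<Theta>: "\<Theta> \<in> borel_measurable borel" and k: "k \<in> borel_measurable borel"
    and C: "\<And>y v. norm (\<Theta> (y, v) * k v) \<le> C"
    and s: "\<And>y v. s \<le> norm y \<Longrightarrow> \<Theta> (y, v) = 0" and r: "\<And>v. r \<le> norm v \<Longrightarrow> k v = 0"
  shows slice_integrable_pair: "integrable lborel (\<lambda>(y, v). cis (- (y \<bullet> \<zeta>)) * (\<Theta> (y, v) * f (y, v)) * k v)" (is ?A)
    and slice_integrable: "integrable lborel (\<lambda>v. fourier_integral (\<lambda>y. \<Theta> (y, v) * f (y, v)) \<zeta> * k v)" (is ?B)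
    and slice_integral: "(\<integral>(y, v). cis (- (y \<bullet> \<zeta>)) * (\<Theta> (y, v) * f (y, v)) * k v \<partial>lborel) =
      (\<integral>v. fourier_integral (\<lambda>y. \<Theta> (y, v) * f (y, v)) \<zeta> * k v \<partial>lborel)" (is ?C)
    and slice_integral': "(\<integral>(y, v). cis (- (y \<bullet> \<zeta>)) * (\<Theta> (y, v) * f (y, v)) * k v \<partial>lborel) =
      (\<integral>y. cis (- (y \<bullet> \<zeta>)) * (\<integral>v. \<Theta> (y, v) * f (y, v) * k v \<partial>lborel) \<partial>lborel)" (is ?D)
proof -
  have [measurable]: "\<Theta> \<in> borel_measurable (borel \<Otimes>\<^sub>M borel)" "k \<in> borel_measurable borel"
    using \<Theta> k by (simp_all add: borel_prod)
  have cm: "cis \<in> borel_measurable borel" by (intro borel_measurable_continuous_onI continuous_intros)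
  note [measurable] = cm
  let ?h = "\<lambda>p. cis (- (fst p \<bullet> \<zeta>)) * (\<Theta> p * k (snd p))"
  have "integrable lborel (\<lambda>p. ?h p * f p)"
  proof (rule integrable_L2_times_bounded_support[OF f, of _ C "\<bar>s\<bar> + \<bar>r\<bar>"])
    have "?h \<in> borel_measurable (borel \<Otimes>\<^sub>M borel)" by measurable
    then show "?h \<in> borel_measurable borel" by (simp add: borel_prod)
    show "norm (?h p) \<le> C" for p using C[of "fst p" "snd p"] by (simp add: norm_mult)
    fix p :: "'a \<times> 'b" assume p: "\<bar>s\<bar> + \<bar>r\<bar> \<le> norm p"
    have "norm p \<le> norm (fst p) + norm (snd p)" by (metis norm_Pair_le prod.collapse)
    then have "s \<le> norm (fst p) \<or> r \<le> norm (snd p)" using p by linarith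
    then show "?h p = 0" using s[of "fst p" "snd p"] r[of "snd p"] by auto
  qed
  then show A: ?A by (simp add: case_prod_unfold mult_ac)
  then have A': "integrable (lborel \<Otimes>\<^sub>M lborel) (\<lambda>(y, v). cis (- (y \<bullet> \<zeta>)) * (\<Theta> (y, v) * f (y, v)) * k v)"
    by (simp add: lborel_prod)
  have e: "(\<integral>y. cis (- (y \<bullet> \<zeta>)) * (\<Theta> (y, v) * f (y, v)) * k v \<partial>lborel) =
      fourier_integral (\<lambda>y. \<Theta> (y, v) * f (y, v)) \<zeta> * k v" for v
    unfolding fourier_integral_def by (rule integral_mult_left_zero)
  show ?B using lborel_pair.integrable_snd[OF A'] unfolding e .
  show ?C using lborel_pair.integral_snd[OF A'] unfolding e by (simp add: lborel_prod)
  have e': "(\<integral>v. cis (- (y \<bullet> \<zeta>)) * (\<Theta> (y, v) * f (y, v)) * k v \<partial>lborel) =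
      cis (- (y \<bullet> \<zeta>)) * (\<integral>v. \<Theta> (y, v) * f (y, v) * k v \<partial>lborel)" for y
    by (simp only: mult.assoc integral_mult_right_zero)
  show ?D using lborel_pair.integral_fst[OF A'] unfolding e' by (simp add: lborel_prod)
qed

lemma measurable_fourier_slice:
  fixes f :: "'a::euclidean_space \<times> 'b::euclidean_space \<Rightarrow> complex"
  assumes f: "f \<in> borel_measurable borel"
  shows "(\<lambda>(\<zeta>, v). fourier_integral (\<lambda>y. f (y, v)) \<zeta>) \<in> borel_measurable (borel \<Otimes>\<^sub>M borel)"
    and "(\<lambda>v. fourier_integral (\<lambda>y. f (y, v)) \<zeta>) \<in> borel_measurable borel"
    and "(\<lambda>y. f (y, v)) \<in> borel_measurable borel"
proof -
  have [measurable]: "f \<in> borel_measurable (borel \<Otimes>\<^sub>M borel)" using f by (simp add: borel_prod)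
  have [measurable]: "cis \<in> borel_measurable borel" by (intro borel_measurable_continuous_onI continuous_intros)
  show 1: "(\<lambda>(\<zeta>, v). fourier_integral (\<lambda>y. f (y, v)) \<zeta>) \<in> borel_measurable (borel \<Otimes>\<^sub>M borel)"
    unfolding fourier_integral_def by measurable
  show "(\<lambda>v. fourier_integral (\<lambda>y. f (y, v)) \<zeta>) \<in> borel_measurable borel"
    unfolding fourier_integral_def by measurable
  show "(\<lambda>y. f (y, v)) \<in> borel_measurable borel" by measurable
qed

lemma dir_deriv_eq_sum_Basis:
  assumes "u differentiable (at x)"
  shows "dir_deriv w u x = (\<Sum>b\<in>Basis. (w \<bullet> b) *\<^sub>R dir_deriv b u x)"
proof -
  have "dir_deriv w u x = dir_deriv (\<Sum>b\<in>Basis. (w \<bullet> b) *\<^sub>R b) u x" by (simp add: euclidean_representation)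
  also have "\<dots> = (\<Sum>b\<in>Basis. (w \<bullet> b) *\<^sub>R dir_deriv b u x)"
    using assms by (simp only: dir_deriv_sum_direction dir_deriv_scale_direction)
  finally show ?thesis .
qed

lemma dir_deriv_zero_outside:
  assumes "\<And>x. r \<le> norm x \<Longrightarrow> u x = 0" and x: "r < norm x"
  shows "dir_deriv w u x = 0"
proof -
  have o: "open {x::'a. r < norm x}" by (intro open_Collect_less continuous_intros)
  have "((\<lambda>_. 0) has_derivative (\<lambda>_. 0)) (at x)" by simp
  then have "(u has_derivative (\<lambda>_. 0)) (at x)"
    by (rule has_derivative_transform_within_open[OF _ o]) (use assms in auto)
  then show ?thesis by (rule dir_deriv_eq)
qed

text \<open>The Plancherel inequality in \<open>y\<close> for fixed \<open>v\<close>, integrated over \<open>v\<close> by Tonelli's theorem.\<close>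
lemma nn_integral_fourier_slice_le:
  fixes f \<Theta> :: "'a::euclidean_space \<times> 'b::euclidean_space \<Rightarrow> complex"
  assumes f: "f \<in> borel_measurable borel" and \<Theta>: "\<Theta> \<in> borel_measurable borel" and K: "K \<in> sets borel"
    and T: "\<And>y v. v \<in> K \<Longrightarrow> norm (\<Theta> (y, v)) \<le> T"
  shows "(\<integral>\<^sup>+\<zeta>. (\<integral>\<^sup>+v. indicator K v * ennreal ((norm (fourier_integral (\<lambda>y. \<Theta> (y, v) * f (y, v)) \<zeta>))\<^sup>2) \<partial>lborel) \<partial>lborel)
    \<le> ennreal ((2 * pi) ^ DIM('a) * T\<^sup>2) * sq_integral f"
proof -
  have [measurable]: "f \<in> borel_measurable (borel \<Otimes>\<^sub>M borel)" "K \<in> sets borel" using f K by (simp_all add: borel_prod)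
  have \<Theta>f: "(\<lambda>p. \<Theta> p * f p) \<in> borel_measurable borel" using f \<Theta> by measurable
  note [measurable] = measurable_fourier_slice(1)[OF \<Theta>f]
  have "(\<integral>\<^sup>+\<zeta>. (\<integral>\<^sup>+v. indicator K v * ennreal ((norm (fourier_integral (\<lambda>y. \<Theta> (y, v) * f (y, v)) \<zeta>))\<^sup>2) \<partial>lborel) \<partial>lborel) =
     (\<integral>\<^sup>+v. (\<integral>\<^sup>+\<zeta>. indicator K v * ennreal ((norm (fourier_integral (\<lambda>y. \<Theta> (y, v) * f (y, v)) \<zeta>))\<^sup>2) \<partial>lborel) \<partial>lborel)"
    by (rule lborel_pair.Fubini'[symmetric]) measurable
  also have "\<dots> \<le> (\<integral>\<^sup>+v. ennreal ((2 * pi) ^ DIM('a) * T\<^sup>2) * sq_integral (\<lambda>y. f (y, v)) \<partial>lborel)"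
  proof (rule nn_integral_mono)
    fix v
    have m: "(\<lambda>y. \<Theta> (y, v) * f (y, v)) \<in> borel_measurable borel" using measurable_fourier_slice(3)[OF \<Theta>f] .
    note [measurable] = m
    show "(\<integral>\<^sup>+\<zeta>. indicator K v * ennreal ((norm (fourier_integral (\<lambda>y. \<Theta> (y, v) * f (y, v)) \<zeta>))\<^sup>2) \<partial>lborel)
        \<le> ennreal ((2 * pi) ^ DIM('a) * T\<^sup>2) * sq_integral (\<lambda>y. f (y, v))"
    proof (cases "v \<in> K")
      case True
      have "sq_integral (\<lambda>\<zeta>. fourier_integral (\<lambda>y. \<Theta> (y, v) * f (y, v)) \<zeta>)
        \<le> ennreal ((2 * pi) ^ DIM('a)) * sq_integral (\<lambda>y. \<Theta> (y, v) * f (y, v))"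
        by (rule plancherel_inequality_measurable[OF m])
      also have "sq_integral (\<lambda>y. \<Theta> (y, v) * f (y, v)) \<le> (\<integral>\<^sup>+y. ennreal (T\<^sup>2) * ennreal ((norm (f (y, v)))\<^sup>2) \<partial>lborel)"
      proof (rule nn_integral_mono)
        fix y
        have "(norm (\<Theta> (y, v) * f (y, v)))\<^sup>2 \<le> T\<^sup>2 * (norm (f (y, v)))\<^sup>2"
          using T[OF True, of y] by (simp add: norm_mult power_mult_distrib mult_right_mono power_mono)
        then show "ennreal ((norm (\<Theta> (y, v) * f (y, v)))\<^sup>2) \<le> ennreal (T\<^sup>2) * ennreal ((norm (f (y, v)))\<^sup>2)"
          by (simp add: ennreal_mult[symmetric] ennreal_leI)
      qed
      also have "\<dots> = ennreal (T\<^sup>2) * sq_integral (\<lambda>y. f (y, v))" by (rule nn_integral_cmult) measurable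
      finally show ?thesis using True by (simp add: ennreal_mult mult.assoc mult_left_mono)
    qed simp
  qed
  also have "\<dots> = ennreal ((2 * pi) ^ DIM('a) * T\<^sup>2) * (\<integral>\<^sup>+v. sq_integral (\<lambda>y. f (y, v)) \<partial>lborel)"
    by (rule nn_integral_cmult) measurable
  also have "(\<integral>\<^sup>+v. sq_integral (\<lambda>y. f (y, v)) \<partial>lborel) = (\<integral>\<^sup>+p. ennreal ((norm (f p))\<^sup>2) \<partial>(lborel \<Otimes>\<^sub>M lborel))"
    by (rule lborel_pair.nn_integral_snd[where f = "\<lambda>p. ennreal ((norm (f p))\<^sup>2)", simplified split_beta]) measurable
  finally show ?thesis by (simp add: lborel_prod)
qed

lemma L2_velocity_average:
  fixes f :: "'a::euclidean_space \<times> 'b::euclidean_space \<Rightarrow> complex"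
  assumes f: "L2 f" and \<psi>: "continuous_on UNIV \<psi>" "\<And>v. \<rho> < norm v \<Longrightarrow> \<psi> v = 0"
  shows "L2 (\<lambda>y. \<integral>v. f (y, v) * \<psi> v \<partial>lborel)"
proof -
  have f': "f \<in> borel_measurable borel" "sq_integral f < \<infinity>" using f by (simp_all add: L2_iff_nn)
  have [measurable]: "f \<in> borel_measurable (borel \<Otimes>\<^sub>M borel)" using f'(1) by (simp add: borel_prod)
  have [measurable]: "\<psi> \<in> borel_measurable borel" by (rule borel_measurable_continuous_onI[OF \<psi>(1)])
  let ?P = "sq_integral \<psi>"
  have "integrable lborel (\<lambda>v. (norm (\<psi> v))\<^sup>2)"
    by (rule integrable_continuous_bounded_support[where r = \<rho>]) (auto intro!: continuous_intros \<psi>)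
  then have P: "?P < \<infinity>" by (simp add: integrable_iff_bounded)
  show ?thesis unfolding L2_iff_nn
  proof
    show "(\<lambda>y. \<integral>v. f (y, v) * \<psi> v \<partial>lborel) \<in> borel_measurable borel" by measurable
    have "sq_integral (\<lambda>y. \<integral>v. f (y, v) * \<psi> v \<partial>lborel) \<le>
        (\<integral>\<^sup>+y. sq_integral (\<lambda>v. f (y, v)) * ?P \<partial>lborel)"
    proof (rule nn_integral_mono)
      fix y
      have "ennreal (norm (\<integral>v. f (y, v) * \<psi> v \<partial>lborel)) \<le> (\<integral>\<^sup>+v. ennreal (norm (f (y, v) * \<psi> v)) \<partial>lborel)"
        by (cases "integrable lborel (\<lambda>v. f (y, v) * \<psi> v)")
          (auto intro: integral_norm_bound_ennreal simp: not_integrable_integral_eq)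
      then have "(ennreal (norm (\<integral>v. f (y, v) * \<psi> v \<partial>lborel)))\<^sup>2 \<le> (\<integral>\<^sup>+v. ennreal (norm (f (y, v))) * ennreal (norm (\<psi> v)) \<partial>lborel)\<^sup>2"
        by (intro power_mono) (simp_all add: norm_mult ennreal_mult)
      also have "\<dots> \<le> (\<integral>\<^sup>+v. (ennreal (norm (f (y, v))))\<^sup>2 \<partial>lborel) * (\<integral>\<^sup>+v. (ennreal (norm (\<psi> v)))\<^sup>2 \<partial>lborel)"
        by (rule Cauchy_Schwarz_nn_integral) measurable
      finally show "ennreal ((norm (\<integral>v. f (y, v) * \<psi> v \<partial>lborel))\<^sup>2) \<le> sq_integral (\<lambda>v. f (y, v)) * ?P"
        by (simp add: ennreal_power)
    qed
    also have "\<dots> = (\<integral>\<^sup>+y. sq_integral (\<lambda>v. f (y, v)) \<partial>lborel) * ?P"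
      by (rule nn_integral_multc) measurable
    also have "(\<integral>\<^sup>+y. sq_integral (\<lambda>v. f (y, v)) \<partial>lborel) = (\<integral>\<^sup>+p. ennreal ((norm (f p))\<^sup>2) \<partial>(lborel \<Otimes>\<^sub>M lborel))"
      by (rule lborel.nn_integral_fst[where f = "\<lambda>p. ennreal ((norm (f p))\<^sup>2)"]) measurable
    also have "\<dots> * ?P < \<infinity>" using f'(2) P by (simp add: lborel_prod ennreal_mult_less_top)
    finally show "sq_integral (\<lambda>y. \<integral>v. f (y, v) * \<psi> v \<partial>lborel) < \<infinity>" .
  qed
qed

text \<open>Testing the equation with \<open>\<alpha>(y) \<beta>(v)\<close>, where \<open>\<alpha>(y) = \<theta>(y) e^(-iy\<cdot>\<zeta>)\<close>, gives the weak
form of the transformed equation in \<open>v\<close> for the transform \<open>U\<close> of the localised function \<open>\<theta> f\<close>. The product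
rule puts two terms next to \<open>g\<close>'s: the one with \<open>c \<cdot> \<zeta>\<close> belongs to the operator, and the one in which the
derivative falls on \<open>\<theta>\<close> is counted as a part of the source \<open>G\<close>.\<close>
lemma fourier_average_identity:
  fixes c :: "'b::euclidean_space \<Rightarrow> 'a::euclidean_space" and f g :: "'a \<times> 'b \<Rightarrow> complex" and \<psi> :: "'b \<Rightarrow> complex"
  assumes c: "continuous_on UNIV c" and f: "L2 f" and g: "L2 g"
    and weak: "\<And>\<alpha> \<beta>. test_fun \<alpha> \<Longrightarrow> test_fun \<beta> \<Longrightarrow>
      (\<integral>(y, v). f (y, v) * (dir_deriv (c v) \<alpha> y * \<beta> v + \<alpha> y * dir_deriv F \<beta> v) \<partial>lborel) =
      - (\<integral>(y, v). g (y, v) * (\<alpha> y * \<beta> v) \<partial>lborel)"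
    and \<psi>: "continuous_on UNIV \<psi>" "\<And>v. \<rho> < norm v \<Longrightarrow> \<psi> v = 0" and \<rho>: "\<rho> > 0"
    and \<theta>: "test_fun \<theta>"
  defines "U \<equiv> \<lambda>\<zeta> v. fourier_integral (\<lambda>y. \<theta> y * f (y, v)) \<zeta>"
    and "G \<equiv> \<lambda>\<zeta> v. fourier_integral (\<lambda>y. \<theta> y * g (y, v)) \<zeta> + fourier_integral (\<lambda>y. dir_deriv (c v) \<theta> y * f (y, v)) \<zeta>"
  shows "fourier_integral (\<lambda>y. \<theta> y * (\<integral>v. f (y, v) * \<psi> v \<partial>lborel)) \<zeta> =
    (\<integral>v. U \<zeta> v * duhamel (\<lambda>r. 1) c F \<psi> \<zeta> v \<partial>lborel) - (\<integral>v. G \<zeta> v * duhamel (\<lambda>r. 1 - r) c F \<psi> \<zeta> v \<partial>lborel)"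
proof -
  have sm: "Ck k \<theta>" for k using \<theta> by (simp add: test_fun_def)
  have \<theta>d: "\<theta> differentiable (at y)" for y using sm[of 1] by simp
  have \<theta>c: "continuous_on UNIV \<theta>" using sm Ck_continuous by blast
  have \<theta>'c: "continuous_on UNIV (dir_deriv w \<theta>)" for w using sm[of 1] by simp
  obtain s where s: "s > 0" "\<And>y. s \<le> norm y \<Longrightarrow> \<theta> y = 0"
    using compactly_supportedE[of \<theta>] \<theta> unfolding test_fun_def by blast
  have s': "\<And>y w. s + 1 \<le> norm y \<Longrightarrow> dir_deriv w \<theta> y = 0"
    using dir_deriv_zero_outside[of s \<theta>] s(2) by force
  define \<Theta>1 where "\<Theta>1 p = \<theta> (fst p)" for p :: "'a \<times> 'b"
  define \<Theta>2 where "\<Theta>2 p = dir_deriv (c (snd p)) \<theta> (fst p)" for p :: "'a \<times> 'b"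
  have \<Theta>1c: "continuous_on UNIV \<Theta>1"
    unfolding \<Theta>1_def by (intro continuous_on_compose2[OF \<theta>c] continuous_intros) auto
  have \<Theta>2c: "continuous_on UNIV \<Theta>2"
    unfolding \<Theta>2_def dir_deriv_eq_sum_Basis[OF \<theta>d, of "c _"]
    by (intro continuous_intros continuous_on_compose2[OF \<theta>'c] continuous_on_compose2[OF c]) auto
  have \<Theta>m: "\<Theta>1 \<in> borel_measurable borel" "\<Theta>2 \<in> borel_measurable borel"
    by (intro borel_measurable_continuous_onI \<Theta>1c \<Theta>2c)+
  have supp: "\<Theta>1 (y, v) = 0" "\<Theta>2 (y, v) = 0" if "s + 1 \<le> norm y" for y v
    using that s(2)[of y] s'[of y] by (simp_all add: \<Theta>1_def \<Theta>2_def)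
  have bnd: "\<exists>C. \<forall>y v. norm (\<Theta> (y, v) * k v) \<le> C"
    if \<Theta>: "continuous_on UNIV \<Theta>" "\<And>y v. s + 1 \<le> norm y \<Longrightarrow> \<Theta> (y, v) = 0" and k: "\<And>v. norm (k v) \<le> M" "\<And>v. r \<le> norm v \<Longrightarrow> k v = 0"
    for \<Theta> :: "'a \<times> 'b \<Rightarrow> complex" and k :: "'b \<Rightarrow> complex" and M r
  proof -
    let ?S = "cball (0::'a) (s + 1) \<times> cball (0::'b) r"
    have "bounded (\<Theta> ` ?S)"
      by (intro compact_imp_bounded compact_continuous_image continuous_on_subset[OF \<Theta>(1)] compact_Times compact_cball) auto
    then obtain B where B: "B > 0" "\<forall>x\<in>\<Theta> ` ?S. norm x \<le> B" unfolding bounded_pos by blast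
    have M: "M \<ge> 0" using k(1)[of 0] norm_ge_zero order.trans by blast
    have "norm (\<Theta> (y, v) * k v) \<le> B * M" for y v
    proof (cases "(y, v) \<in> ?S")
      case True
      then have "norm (\<Theta> (y, v)) \<le> B" using B(2) by blast
      then show ?thesis unfolding norm_mult using k(1)[of v] B(1) by (intro mult_mono) auto
    next
      case False
      then have "\<Theta> (y, v) = 0 \<or> k v = 0" using \<Theta>(2)[of y v] k(2)[of v] by auto
      then show ?thesis using B(1) M by auto
    qed
    then show ?thesis by blast
  qed
  have slices: "integrable lborel (\<lambda>(y, v). cis (- (y \<bullet> \<zeta>)) * (\<Theta> (y, v) * h (y, v)) * k v)"
      "integrable lborel (\<lambda>v. fourier_integral (\<lambda>y. \<Theta> (y, v) * h (y, v)) \<zeta> * k v)"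
      "(\<integral>(y, v). cis (- (y \<bullet> \<zeta>)) * (\<Theta> (y, v) * h (y, v)) * k v \<partial>lborel) =
        (\<integral>v. fourier_integral (\<lambda>y. \<Theta> (y, v) * h (y, v)) \<zeta> * k v \<partial>lborel)"
      "(\<integral>(y, v). cis (- (y \<bullet> \<zeta>)) * (\<Theta> (y, v) * h (y, v)) * k v \<partial>lborel) =
        (\<integral>y. cis (- (y \<bullet> \<zeta>)) * (\<integral>v. \<Theta> (y, v) * h (y, v) * k v \<partial>lborel) \<partial>lborel)"
    if h: "L2 h" and \<Theta>: "\<Theta> = \<Theta>1 \<or> \<Theta> = \<Theta>2" and k: "k \<in> borel_measurable borel" "\<And>v. norm (k v) \<le> M" "\<And>v. r \<le> norm v \<Longrightarrow> k v = 0"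
    for h :: "'a \<times> 'b \<Rightarrow> complex" and \<Theta> k M r
  proof -
    have 1: "\<Theta> \<in> borel_measurable borel" "continuous_on UNIV \<Theta>" "\<And>y v. s + 1 \<le> norm y \<Longrightarrow> \<Theta> (y, v) = 0"
      using \<Theta> \<Theta>m \<Theta>1c \<Theta>2c supp by blast+
    obtain C where C: "\<And>y v. norm (\<Theta> (y, v) * k v) \<le> C" using bnd[where \<Theta> = \<Theta> and k = k and M = M and r = r] 1(2,3) k(2,3) by blast
    show "integrable lborel (\<lambda>(y, v). cis (- (y \<bullet> \<zeta>)) * (\<Theta> (y, v) * h (y, v)) * k v)"
      by (rule slice_integrable_pair[OF h 1(1) k(1) C 1(3) k(3)])
    show "integrable lborel (\<lambda>v. fourier_integral (\<lambda>y. \<Theta> (y, v) * h (y, v)) \<zeta> * k v)"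
      by (rule slice_integrable[OF h 1(1) k(1) C 1(3) k(3)])
    show "(\<integral>(y, v). cis (- (y \<bullet> \<zeta>)) * (\<Theta> (y, v) * h (y, v)) * k v \<partial>lborel) =
        (\<integral>v. fourier_integral (\<lambda>y. \<Theta> (y, v) * h (y, v)) \<zeta> * k v \<partial>lborel)"
      by (rule slice_integral[OF h 1(1) k(1) C 1(3) k(3)])
    show "(\<integral>(y, v). cis (- (y \<bullet> \<zeta>)) * (\<Theta> (y, v) * h (y, v)) * k v \<partial>lborel) =
        (\<integral>y. cis (- (y \<bullet> \<zeta>)) * (\<integral>v. \<Theta> (y, v) * h (y, v) * k v \<partial>lborel) \<partial>lborel)"
      by (rule slice_integral'[OF h 1(1) k(1) C 1(3) k(3)])
  qed
  have meas: "(\<lambda>v. fourier_integral (\<lambda>y. \<Theta> (y, v) * h (y, v)) \<zeta>) \<in> borel_measurable borel"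
    if "L2 h" "\<Theta> \<in> borel_measurable borel" for h \<Theta> :: "'a \<times> 'b \<Rightarrow> complex"
  proof -
    have "(\<lambda>p. \<Theta> p * h p) \<in> borel_measurable borel" using that by (auto simp: L2_def)
    from measurable_fourier_slice(2)[OF this] show ?thesis .
  qed
  define U1 where "U1 v = fourier_integral (\<lambda>y. \<Theta>1 (y, v) * f (y, v)) \<zeta>" for v
  define G1 where "G1 v = fourier_integral (\<lambda>y. \<Theta>1 (y, v) * g (y, v)) \<zeta>" for v
  define G2 where "G2 v = fourier_integral (\<lambda>y. \<Theta>2 (y, v) * f (y, v)) \<zeta>" for v
  have UG: "U \<zeta> = U1" "G \<zeta> = (\<lambda>v. G1 v + G2 v)"
    by (simp_all add: fun_eq_iff U_def G_def U1_def G1_def G2_def \<Theta>1_def \<Theta>2_def)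
  have [measurable]: "U1 \<in> borel_measurable borel" "G1 \<in> borel_measurable borel" "G2 \<in> borel_measurable borel"
    unfolding U1_def G1_def G2_def by (intro meas f g \<Theta>m)+
  have ind: "integrable lborel (\<lambda>v. fourier_integral (\<lambda>y. \<Theta> (y, v) * h (y, v)) \<zeta> * indicator (cball 0 r) v)"
    if "L2 h" "\<Theta> = \<Theta>1 \<or> \<Theta> = \<Theta>2" for h \<Theta> r
    by (rule slices(2)[OF that, of _ 1 "r + 1"]) (auto simp: indicator_def)
  have loc: "integrable lborel (\<lambda>v. indicator (cball 0 r) v *\<^sub>R U1 v)" "integrable lborel (\<lambda>v. indicator (cball 0 r) v *\<^sub>R (G1 v + G2 v))" for r
  proof -
    have 1: "integrable lborel (\<lambda>v. U1 v * indicator (cball 0 r) v)" "integrable lborel (\<lambda>v. G1 v * indicator (cball 0 r) v)"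
       "integrable lborel (\<lambda>v. G2 v * indicator (cball 0 r) v)"
      unfolding U1_def G1_def G2_def by (intro ind f g; simp)+
    have e: "indicator (cball 0 r) v *\<^sub>R z = z * indicator (cball 0 r) v" for z :: complex and v :: 'b
      by (simp add: indicator_def)
    show "integrable lborel (\<lambda>v. indicator (cball 0 r) v *\<^sub>R U1 v)" unfolding e by (rule 1)
    show "integrable lborel (\<lambda>v. indicator (cball 0 r) v *\<^sub>R (G1 v + G2 v))"
      unfolding e distrib_right by (intro Bochner_Integration.integrable_add 1)
  qed
  have W: "(\<integral>v. U1 v * (dir_deriv F \<beta> v - \<i> * of_real (c v \<bullet> \<zeta>) * \<beta> v) \<partial>lborel) = - (\<integral>v. (G1 v + G2 v) * \<beta> v \<partial>lborel)"
    if \<beta>: "test_fun \<beta>" for \<beta>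
  proof -
    have \<beta>sm: "Ck k \<beta>" for k using \<beta> by (simp add: test_fun_def)
    have \<beta>c: "continuous_on UNIV \<beta>" using \<beta>sm Ck_continuous by blast
    have \<beta>'c: "continuous_on UNIV (dir_deriv F \<beta>)" using \<beta>sm[of 1] by simp
    obtain r where r: "r > 0" "\<And>v. r \<le> norm v \<Longrightarrow> \<beta> v = 0"
      using compactly_supportedE[of \<beta>] \<beta> unfolding test_fun_def by blast
    define k1 where "k1 v = - \<i> * of_real (c v \<bullet> \<zeta>) * \<beta> v" for v
    have k1c: "continuous_on UNIV k1" unfolding k1_def by (intro continuous_intros c \<beta>c)
    have z: "\<beta> v = 0" "k1 v = 0" "dir_deriv F \<beta> v = 0" if "r + 1 \<le> norm v" for v
      using that r(2)[of v] dir_deriv_zero_outside[of r \<beta>] r(2) by (auto simp: k1_def)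
    have bd: "\<exists>B. \<forall>v. norm (k v) \<le> B" if "continuous_on UNIV k" "\<And>v. r + 1 \<le> norm v \<Longrightarrow> k v = 0" for k :: "'b \<Rightarrow> complex"
      using bounded_continuous_bounded_support[OF that(1), of "r + 1"] that(2) by (metis less_imp_le)
    obtain B1 B2 B3 where B: "\<And>v. norm (\<beta> v) \<le> B1" "\<And>v. norm (k1 v) \<le> B2" "\<And>v. norm (dir_deriv F \<beta> v) \<le> B3"
      using bd[OF \<beta>c z(1)] bd[OF k1c z(2)] bd[OF \<beta>'c z(3)] by blast
    have m: "\<beta> \<in> borel_measurable borel" "k1 \<in> borel_measurable borel" "dir_deriv F \<beta> \<in> borel_measurable borel"
      by (intro borel_measurable_continuous_onI \<beta>c k1c \<beta>'c)+
    note s1 = slices[OF f disjI2[OF refl] m(1) B(1) z(1)]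
    note s2 = slices[OF f disjI1[OF refl] m(2) B(2) z(2)]
    note s3 = slices[OF f disjI1[OF refl] m(3) B(3) z(3)]
    note s4 = slices[OF g disjI1[OF refl] m(1) B(1) z(1)]
    \<comment> \<open>The factor \<open>1\<close> is the constant in \<open>dir_deriv_cis_inner\<close>.\<close>
    define \<alpha> where "\<alpha> y = 1 * cis (- (y \<bullet> \<zeta>)) * \<theta> y" for y
    have "test_fun \<alpha>" unfolding test_fun_def
    proof (intro conjI allI)
      show "Ck k \<alpha>" for k unfolding \<alpha>_def by (intro Ck_mult Ck_cis_inner(1) sm)
      show "compactly_supported \<alpha>" by (rule compactly_supportedI[of s]) (simp add: \<alpha>_def s(2))
    qed
    from weak[OF this \<beta>]
    have wk: "(\<integral>(y, v). f (y, v) * (dir_deriv (c v) \<alpha> y * \<beta> v + \<alpha> y * dir_deriv F \<beta> v) \<partial>lborel) =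
      - (\<integral>(y, v). g (y, v) * (\<alpha> y * \<beta> v) \<partial>lborel)" .
    have d\<alpha>: "dir_deriv w \<alpha> y = cis (- (y \<bullet> \<zeta>)) * dir_deriv w \<theta> y - \<i> * of_real (w \<bullet> \<zeta>) * cis (- (y \<bullet> \<zeta>)) * \<theta> y" for w y
    proof -
      have "(\<lambda>y. 1 * cis (- (y \<bullet> \<zeta>))) differentiable (at y)" using Ck_cis_inner(1)[where k = 1 and c = 1 and \<zeta> = \<zeta>] by simp
      from dir_deriv_mult[OF this \<theta>d, of w] show ?thesis
        unfolding \<alpha>_def by (simp only: dir_deriv_cis_inner) simp
    qed
    have "(\<lambda>(y, v). f (y, v) * (dir_deriv (c v) \<alpha> y * \<beta> v + \<alpha> y * dir_deriv F \<beta> v)) =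
        (\<lambda>p. (case p of (y, v) \<Rightarrow> cis (- (y \<bullet> \<zeta>)) * (\<Theta>2 (y, v) * f (y, v)) * \<beta> v)
          + ((case p of (y, v) \<Rightarrow> cis (- (y \<bullet> \<zeta>)) * (\<Theta>1 (y, v) * f (y, v)) * k1 v)
          + (case p of (y, v) \<Rightarrow> cis (- (y \<bullet> \<zeta>)) * (\<Theta>1 (y, v) * f (y, v)) * dir_deriv F \<beta> v)))"
      by (auto simp: fun_eq_iff d\<alpha> \<alpha>_def \<Theta>1_def \<Theta>2_def k1_def algebra_simps)
    then have "(\<integral>(y, v). f (y, v) * (dir_deriv (c v) \<alpha> y * \<beta> v + \<alpha> y * dir_deriv F \<beta> v) \<partial>lborel) =
        (\<integral>v. G2 v * \<beta> v \<partial>lborel) + ((\<integral>v. U1 v * k1 v \<partial>lborel) + (\<integral>v. U1 v * dir_deriv F \<beta> v \<partial>lborel))"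
      using s1(1,3) s2(1,3) s3(1,3) by (simp add: U1_def G2_def)
    moreover have "(\<integral>(y, v). g (y, v) * (\<alpha> y * \<beta> v) \<partial>lborel) = (\<integral>v. G1 v * \<beta> v \<partial>lborel)"
      using s4(3) by (simp add: G1_def \<alpha>_def \<Theta>1_def mult_ac)
    moreover have "(\<integral>v. U1 v * (dir_deriv F \<beta> v - \<i> * of_real (c v \<bullet> \<zeta>) * \<beta> v) \<partial>lborel) =
        (\<integral>v. U1 v * k1 v \<partial>lborel) + (\<integral>v. U1 v * dir_deriv F \<beta> v \<partial>lborel)"
    proof -
      have "(\<lambda>v. U1 v * (dir_deriv F \<beta> v - \<i> * of_real (c v \<bullet> \<zeta>) * \<beta> v)) = (\<lambda>v. U1 v * k1 v + U1 v * dir_deriv F \<beta> v)"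
        by (simp add: fun_eq_iff k1_def algebra_simps)
      then show ?thesis using s2(2) s3(2) by (simp add: U1_def)
    qed
    moreover have "(\<integral>v. (G1 v + G2 v) * \<beta> v \<partial>lborel) = (\<integral>v. G1 v * \<beta> v \<partial>lborel) + (\<integral>v. G2 v * \<beta> v \<partial>lborel)"
      unfolding distrib_right using s1(2) s4(2) by (simp add: G1_def G2_def)
    ultimately show ?thesis using wk by (simp add: algebra_simps eq_neg_iff_add_eq_0)
  qed
  have "(\<integral>v. U1 v * \<psi> v \<partial>lborel) =
    (\<integral>v. U1 v * duhamel (\<lambda>r. 1) c F \<psi> \<zeta> v \<partial>lborel) - (\<integral>v. (G1 v + G2 v) * duhamel (\<lambda>r. 1 - r) c F \<psi> \<zeta> v \<partial>lborel)"
    by (rule duhamel_duality[OF c \<psi> \<rho> _ _ loc W]) measurable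
  moreover have "(\<integral>v. U1 v * \<psi> v \<partial>lborel) = fourier_integral (\<lambda>y. \<theta> y * (\<integral>v. f (y, v) * \<psi> v \<partial>lborel)) \<zeta>"
  proof -
    obtain B where B: "\<And>v. norm (\<psi> v) \<le> B" using bounded_continuous_bounded_support[OF \<psi>] by blast
    have m: "\<psi> \<in> borel_measurable borel" by (rule borel_measurable_continuous_onI[OF \<psi>(1)])
    have z: "\<psi> v = 0" if "\<rho> + 1 \<le> norm v" for v using \<psi>(2)[of v] that by simp
    note s = slices(3,4)[OF f disjI1[OF refl] m B z]
    have "(\<integral>v. U1 v * \<psi> v \<partial>lborel) = (\<integral>y. cis (- (y \<bullet> \<zeta>)) * (\<integral>v. \<Theta>1 (y, v) * f (y, v) * \<psi> v \<partial>lborel) \<partial>lborel)"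
      unfolding U1_def using s by simp
    also have "\<dots> = fourier_integral (\<lambda>y. \<theta> y * (\<integral>v. f (y, v) * \<psi> v \<partial>lborel)) \<zeta>"
      unfolding fourier_integral_def by (simp add: \<Theta>1_def mult.assoc)
    finally show ?thesis .
  qed
  ultimately show ?thesis unfolding UG by simp
qed

section \<open>The averaging estimate\<close>

text \<open>The Cauchy--Schwarz inequality on the bounded set \<open>K\<close> that carries both test functions.\<close>
lemma nn_integral_norm_Cauchy_Schwarz_bound:
  fixes U G w w1 :: "'b::euclidean_space \<Rightarrow> complex"
  assumes [measurable]: "U \<in> borel_measurable borel" "G \<in> borel_measurable borel" "K \<in> sets borel"
    and b: "\<And>v. norm (w v) \<le> B * indicator K v" "\<And>v. norm (w1 v) \<le> B * indicator K v" and B: "B \<ge> 0"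
  shows "ennreal ((norm ((\<integral>v. U v * w1 v \<partial>lborel) - (\<integral>v. G v * w v \<partial>lborel)))\<^sup>2) \<le>
    ennreal (B\<^sup>2) * emeasure lborel K * (\<integral>\<^sup>+v. indicator K v * ennreal (2 * (norm (U v))\<^sup>2 + 2 * (norm (G v))\<^sup>2) \<partial>lborel)"
proof -
  have le: "ennreal (norm (\<integral>v. h v * k v \<partial>lborel)) \<le> (\<integral>\<^sup>+v. ennreal (B * indicator K v) * ennreal (indicator K v * norm (h v)) \<partial>lborel)"
    if k: "\<And>v. norm (k v) \<le> B * indicator K v" for h k :: "'b \<Rightarrow> complex"
  proof -
    have "ennreal (norm (\<integral>v. h v * k v \<partial>lborel)) \<le> (\<integral>\<^sup>+v. ennreal (norm (h v * k v)) \<partial>lborel)"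
      by (cases "integrable lborel (\<lambda>v. h v * k v)")
        (auto intro: integral_norm_bound_ennreal simp: not_integrable_integral_eq)
    also have "\<dots> \<le> (\<integral>\<^sup>+v. ennreal (B * indicator K v) * ennreal (indicator K v * norm (h v)) \<partial>lborel)"
    proof (rule nn_integral_mono)
      fix v
      have "norm (h v * k v) \<le> (B * indicator K v) * (indicator K v * norm (h v))"
        using mult_left_mono[OF k[of v], of "norm (h v)"] by (cases "v \<in> K") (simp_all add: norm_mult mult.commute)
      then show "ennreal (norm (h v * k v)) \<le> ennreal (B * indicator K v) * ennreal (indicator K v * norm (h v))"
        using B by (simp add: ennreal_mult[symmetric] ennreal_leI)
    qed
    finally show ?thesis .
  qed
  let ?I = "(\<integral>v. U v * w1 v \<partial>lborel) - (\<integral>v. G v * w v \<partial>lborel)"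
  have "ennreal (norm ?I) \<le> ennreal (norm (\<integral>v. U v * w1 v \<partial>lborel)) + ennreal (norm (\<integral>v. G v * w v \<partial>lborel))"
    by (simp add: ennreal_plus[symmetric] ennreal_leI norm_triangle_ineq4 del: ennreal_plus)
  also have "\<dots> \<le> (\<integral>\<^sup>+v. ennreal (B * indicator K v) * ennreal (indicator K v * norm (U v)) \<partial>lborel)
      + (\<integral>\<^sup>+v. ennreal (B * indicator K v) * ennreal (indicator K v * norm (G v)) \<partial>lborel)"
    by (intro add_mono le b)
  also have "\<dots> = (\<integral>\<^sup>+v. ennreal (B * indicator K v) * (ennreal (indicator K v * norm (U v)) + ennreal (indicator K v * norm (G v))) \<partial>lborel)"
    unfolding distrib_left by (rule nn_integral_add[symmetric]) measurable
  finally have "(ennreal (norm ?I))\<^sup>2 \<le> (\<integral>\<^sup>+v. ennreal (B * indicator K v) * (ennreal (indicator K v * norm (U v)) + ennreal (indicator K v * norm (G v))) \<partial>lborel)\<^sup>2"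
    by (intro power_mono) auto
  also have "\<dots> \<le> (\<integral>\<^sup>+v. (ennreal (B * indicator K v))\<^sup>2 \<partial>lborel) *
      (\<integral>\<^sup>+v. (ennreal (indicator K v * norm (U v)) + ennreal (indicator K v * norm (G v)))\<^sup>2 \<partial>lborel)"
    by (rule Cauchy_Schwarz_nn_integral) measurable
  also have "(\<integral>\<^sup>+v. (ennreal (B * indicator K v))\<^sup>2 \<partial>lborel) = (\<integral>\<^sup>+v. ennreal (B\<^sup>2) * indicator K v \<partial>lborel)"
    using B by (intro nn_integral_cong) (auto simp: indicator_def ennreal_power)
  also have "\<dots> = ennreal (B\<^sup>2) * emeasure lborel K" by (rule nn_integral_cmult_indicator) simp
  also have "(\<integral>\<^sup>+v. (ennreal (indicator K v * norm (U v)) + ennreal (indicator K v * norm (G v)))\<^sup>2 \<partial>lborel) \<le>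
      (\<integral>\<^sup>+v. indicator K v * ennreal (2 * (norm (U v))\<^sup>2 + 2 * (norm (G v))\<^sup>2) \<partial>lborel)"
  proof (rule nn_integral_mono)
    fix v
    have "(norm (U v) + norm (G v))\<^sup>2 \<le> 2 * (norm (U v))\<^sup>2 + 2 * (norm (G v))\<^sup>2"
      using sum_squares_bound[of "norm (U v)" "norm (G v)"] by (simp add: power2_sum)
    then show "(ennreal (indicator K v * norm (U v)) + ennreal (indicator K v * norm (G v)))\<^sup>2 \<le>
        indicator K v * ennreal (2 * (norm (U v))\<^sup>2 + 2 * (norm (G v))\<^sup>2)"
      by (cases "v \<in> K") (simp_all add: ennreal_plus[symmetric] ennreal_power ennreal_leI del: ennreal_plus)
  qed
  finally show ?thesis by (simp add: ennreal_power mult_left_mono)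
qed

text \<open>The square of the decay rate of the Duhamel integrals cancels the Sobolev weight exactly, and what is left
is integrated in \<open>\<zeta>\<close> with the Plancherel inequality. One constant serves all cutoffs \<open>\<theta>\<close> with the given bounds
on the function and its gradient, which is what the passage to the limit requires.\<close>
lemma weighted_fourier_average_bound:
  fixes c :: "'b::euclidean_space \<Rightarrow> 'a::euclidean_space" and f g :: "'a \<times> 'b \<Rightarrow> complex" and \<psi> :: "'b \<Rightarrow> complex"
  assumes \<gamma>: "\<gamma> \<ge> 1" and c: "Ck \<gamma> c"
    and nondeg: "\<And>v \<sigma>. norm \<sigma> = 1 \<Longrightarrow> \<exists>k<\<gamma>. (dir_deriv F ^^ k) c v \<bullet> \<sigma> \<noteq> 0"
    and f: "L2 f" and g: "L2 g"
    and weak: "\<And>\<alpha> \<beta>. test_fun \<alpha> \<Longrightarrow> test_fun \<beta> \<Longrightarrow>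
      (\<integral>(y, v). f (y, v) * (dir_deriv (c v) \<alpha> y * \<beta> v + \<alpha> y * dir_deriv F \<beta> v) \<partial>lborel) =
      - (\<integral>(y, v). g (y, v) * (\<alpha> y * \<beta> v) \<partial>lborel)"
    and \<psi>: "Ck_compact 1 \<psi>" and T: "T \<ge> 0"
  shows "\<exists>A<\<infinity>. \<forall>\<theta>. test_fun \<theta> \<longrightarrow> (\<forall>y. norm (\<theta> y) \<le> T) \<longrightarrow> (\<forall>w y. norm (dir_deriv w \<theta> y) \<le> T * norm w) \<longrightarrow>
    (\<integral>\<^sup>+\<zeta>. ennreal ((1 + (norm \<zeta>)\<^sup>2) powr (1 / real \<gamma>) *
      (norm (fourier_integral (\<lambda>y. \<theta> y * (\<integral>v. f (y, v) * \<psi> v \<partial>lborel)) \<zeta>))\<^sup>2) \<partial>lborel) \<le> A"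
proof -
  obtain \<rho> where \<rho>: "\<rho> > 0" "\<And>v. \<rho> \<le> norm v \<Longrightarrow> \<psi> v = 0"
    using compactly_supportedE[of \<psi>] \<psi> unfolding Ck_compact_def by blast
  have \<psi>1: "Ck 1 \<psi>" using \<psi> by (simp add: Ck_compact_def)
  have \<psi>c: "continuous_on UNIV \<psi>" using \<psi>1 Ck_continuous by blast
  have \<psi>s: "\<psi> v = 0" if "\<rho> < norm v" for v using \<rho>(2)[of v] that by simp
  have cc: "continuous_on UNIV c" using c Ck_continuous by blast
  obtain C1 where C1: "C1 \<ge> 0" "\<And>\<zeta> v. norm (duhamel (\<lambda>r. 1) c F \<psi> \<zeta> v) \<le> C1 * (1 + (norm \<zeta>)\<^sup>2) powr (- 1 / (2 * real \<gamma>))"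
    by (rule duhamel_bound[OF \<gamma> c nondeg \<psi>1 \<psi>s \<rho>(1), of "\<lambda>r. 1" "\<lambda>r. 0"]) (auto intro!: derivative_eq_intros)
  obtain C2 where C2: "C2 \<ge> 0" "\<And>\<zeta> v. norm (duhamel (\<lambda>r. 1 - r) c F \<psi> \<zeta> v) \<le> C2 * (1 + (norm \<zeta>)\<^sup>2) powr (- 1 / (2 * real \<gamma>))"
    by (rule duhamel_bound[OF \<gamma> c nondeg \<psi>1 \<psi>s \<rho>(1), of "\<lambda>r. 1 - r" "\<lambda>r. - 1"]) (auto intro!: derivative_eq_intros)
  define C where "C = C1 + C2"
  define K where "K = cball (0::'b) (\<rho> + norm F)"
  have Km: "K \<in> sets borel" by (simp add: K_def)
  have Kfin: "emeasure lborel K < \<infinity>" unfolding K_def by (rule emeasure_compact_finite) simp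
  have "bounded (c ` K)" unfolding K_def
    by (intro compact_imp_bounded compact_continuous_image continuous_on_subset[OF cc] compact_cball) auto
  then obtain B where B: "B > 0" "\<And>v. v \<in> K \<Longrightarrow> norm (c v) \<le> B" unfolding bounded_pos by blast
  let ?P = "\<lambda>T. ennreal ((2 * pi) ^ DIM('a) * T\<^sup>2)"
  define A where "A = ennreal (C\<^sup>2) * emeasure lborel K * (2 * (?P T * sq_integral f) + (4 * (?P T * sq_integral g) + 4 * (?P (T * B) * sq_integral f)))"
  have "A < \<infinity>"
    using f g Kfin unfolding A_def L2_iff_nn by (simp add: ennreal_mult_less_top)
  moreover have "(\<integral>\<^sup>+\<zeta>. ennreal ((1 + (norm \<zeta>)\<^sup>2) powr (1 / real \<gamma>) *
      (norm (fourier_integral (\<lambda>y. \<theta> y * (\<integral>v. f (y, v) * \<psi> v \<partial>lborel)) \<zeta>))\<^sup>2) \<partial>lborel) \<le> A"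
    if \<theta>: "test_fun \<theta>" and T1: "\<And>y. norm (\<theta> y) \<le> T" and T2: "\<And>w y. norm (dir_deriv w \<theta> y) \<le> T * norm w" for \<theta>
  proof -
    have sm: "Ck k \<theta>" for k using \<theta> by (simp add: test_fun_def)
    have \<theta>d: "\<theta> differentiable (at y)" for y using sm[of 1] by simp
    have \<theta>c: "continuous_on UNIV \<theta>" using sm Ck_continuous by blast
    have \<theta>'c: "continuous_on UNIV (dir_deriv w \<theta>)" for w using sm[of 1] by simp
    define \<Theta>1 where "\<Theta>1 p = \<theta> (fst p)" for p :: "'a \<times> 'b"
    define \<Theta>2 where "\<Theta>2 p = dir_deriv (c (snd p)) \<theta> (fst p)" for p :: "'a \<times> 'b"
    have \<Theta>1m: "\<Theta>1 \<in> borel_measurable borel"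
      unfolding \<Theta>1_def by (intro borel_measurable_continuous_onI continuous_on_compose2[OF \<theta>c] continuous_intros) auto
    have \<Theta>2m: "\<Theta>2 \<in> borel_measurable borel"
      unfolding \<Theta>2_def dir_deriv_eq_sum_Basis[OF \<theta>d, of "c _"]
      by (intro borel_measurable_continuous_onI continuous_intros continuous_on_compose2[OF \<theta>'c] continuous_on_compose2[OF cc]) auto
    have fm: "f \<in> borel_measurable borel" "g \<in> borel_measurable borel" using f g by (simp_all add: L2_def)
    define U where "U \<zeta> v = fourier_integral (\<lambda>y. \<Theta>1 (y, v) * f (y, v)) \<zeta>" for \<zeta> v
    define G1 where "G1 \<zeta> v = fourier_integral (\<lambda>y. \<Theta>1 (y, v) * g (y, v)) \<zeta>" for \<zeta> v
    define G2 where "G2 \<zeta> v = fourier_integral (\<lambda>y. \<Theta>2 (y, v) * f (y, v)) \<zeta>" for \<zeta> v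
    have pm: "(\<lambda>p. \<Theta>1 p * f p) \<in> borel_measurable borel" "(\<lambda>p. \<Theta>1 p * g p) \<in> borel_measurable borel"
        "(\<lambda>p. \<Theta>2 p * f p) \<in> borel_measurable borel"
      using fm \<Theta>1m \<Theta>2m by simp_all
    have [measurable]: "U \<zeta> \<in> borel_measurable borel" "G1 \<zeta> \<in> borel_measurable borel" "G2 \<zeta> \<in> borel_measurable borel" for \<zeta>
      unfolding U_def G1_def G2_def by (rule measurable_fourier_slice(2)[OF pm(1)] measurable_fourier_slice(2)[OF pm(2)] measurable_fourier_slice(2)[OF pm(3)])+
    have jm: "(\<lambda>(\<zeta>, v). U \<zeta> v) \<in> borel_measurable (borel \<Otimes>\<^sub>M borel)" "(\<lambda>(\<zeta>, v). G1 \<zeta> v) \<in> borel_measurable (borel \<Otimes>\<^sub>M borel)"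
        "(\<lambda>(\<zeta>, v). G2 \<zeta> v) \<in> borel_measurable (borel \<Otimes>\<^sub>M borel)"
      unfolding U_def G1_def G2_def
      by (rule measurable_fourier_slice(1)[OF pm(1)] measurable_fourier_slice(1)[OF pm(2)] measurable_fourier_slice(1)[OF pm(3)])+
    note [measurable] = jm Km
    have pt: "ennreal ((1 + (norm \<zeta>)\<^sup>2) powr (1 / real \<gamma>) *
        (norm (fourier_integral (\<lambda>y. \<theta> y * (\<integral>v. f (y, v) * \<psi> v \<partial>lborel)) \<zeta>))\<^sup>2) \<le>
        ennreal (C\<^sup>2) * emeasure lborel K *
        (\<integral>\<^sup>+v. 2 * (indicator K v * ennreal ((norm (U \<zeta> v))\<^sup>2)) + (4 * (indicator K v * ennreal ((norm (G1 \<zeta> v))\<^sup>2))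
          + 4 * (indicator K v * ennreal ((norm (G2 \<zeta> v))\<^sup>2))) \<partial>lborel)" for \<zeta>
    proof -
      let ?W = "1 + (norm \<zeta>)\<^sup>2"
      let ?w1 = "duhamel (\<lambda>r. 1) c F \<psi> \<zeta>" and ?w = "duhamel (\<lambda>r. 1 - r) c F \<psi> \<zeta>"
      define b where "b = C * ?W powr (- 1 / (2 * real \<gamma>))"
      have b0: "b \<ge> 0" using C1(1) C2(1) by (simp add: b_def C_def)
      have bw: "norm (?w v) \<le> b * indicator K v" "norm (?w1 v) \<le> b * indicator K v" for v
      proof -
        have "norm (?w v) \<le> b" using C2(2)[of \<zeta> v] C1(1) unfolding b_def C_def distrib_right by (smt (verit) mult_nonneg_nonneg powr_ge_zero)
        moreover have "norm (?w1 v) \<le> b" using C1(2)[of \<zeta> v] C2(1) unfolding b_def C_def distrib_right by (smt (verit) mult_nonneg_nonneg powr_ge_zero)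
        moreover have "?w v = 0" "?w1 v = 0" if "v \<notin> K"
          using that duhamel_support[of \<rho> \<psi> F v] \<psi>s by (simp_all add: K_def)
        ultimately show "norm (?w v) \<le> b * indicator K v" "norm (?w1 v) \<le> b * indicator K v"
          by (cases "v \<in> K"; simp)+
      qed
      have id: "fourier_integral (\<lambda>y. \<theta> y * (\<integral>v. f (y, v) * \<psi> v \<partial>lborel)) \<zeta> =
          (\<integral>v. U \<zeta> v * ?w1 v \<partial>lborel) - (\<integral>v. (G1 \<zeta> v + G2 \<zeta> v) * ?w v \<partial>lborel)"
        using fourier_average_identity[OF cc f g weak \<psi>c \<psi>s \<rho>(1) \<theta>, of \<zeta>]
        by (simp add: U_def G1_def G2_def \<Theta>1_def \<Theta>2_def)
      have "ennreal ((norm (fourier_integral (\<lambda>y. \<theta> y * (\<integral>v. f (y, v) * \<psi> v \<partial>lborel)) \<zeta>))\<^sup>2) \<le>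
          ennreal (b\<^sup>2) * emeasure lborel K * (\<integral>\<^sup>+v. indicator K v * ennreal (2 * (norm (U \<zeta> v))\<^sup>2 + 2 * (norm (G1 \<zeta> v + G2 \<zeta> v))\<^sup>2) \<partial>lborel)"
        unfolding id by (rule nn_integral_norm_Cauchy_Schwarz_bound[OF _ _ _ bw b0]) measurable
      also have "(\<integral>\<^sup>+v. indicator K v * ennreal (2 * (norm (U \<zeta> v))\<^sup>2 + 2 * (norm (G1 \<zeta> v + G2 \<zeta> v))\<^sup>2) \<partial>lborel) \<le>
          (\<integral>\<^sup>+v. 2 * (indicator K v * ennreal ((norm (U \<zeta> v))\<^sup>2)) + (4 * (indicator K v * ennreal ((norm (G1 \<zeta> v))\<^sup>2))
          + 4 * (indicator K v * ennreal ((norm (G2 \<zeta> v))\<^sup>2))) \<partial>lborel)" (is "_ \<le> ?R")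
      proof (rule nn_integral_mono)
        fix v
        have "ennreal (2 * (norm (U \<zeta> v))\<^sup>2 + 2 * (norm (G1 \<zeta> v + G2 \<zeta> v))\<^sup>2) \<le>
            ennreal (2 * (norm (U \<zeta> v))\<^sup>2 + (4 * (norm (G1 \<zeta> v))\<^sup>2 + 4 * (norm (G2 \<zeta> v))\<^sup>2))"
          using norm_sq_add_le[of "G1 \<zeta> v" "G2 \<zeta> v"] by (intro ennreal_leI) linarith
        also have "\<dots> = 2 * ennreal ((norm (U \<zeta> v))\<^sup>2) + (4 * ennreal ((norm (G1 \<zeta> v))\<^sup>2) + 4 * ennreal ((norm (G2 \<zeta> v))\<^sup>2))"
          by (simp add: ennreal_plus ennreal_mult)
        finally show "indicator K v * ennreal (2 * (norm (U \<zeta> v))\<^sup>2 + 2 * (norm (G1 \<zeta> v + G2 \<zeta> v))\<^sup>2) \<le>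
            2 * (indicator K v * ennreal ((norm (U \<zeta> v))\<^sup>2)) + (4 * (indicator K v * ennreal ((norm (G1 \<zeta> v))\<^sup>2))
          + 4 * (indicator K v * ennreal ((norm (G2 \<zeta> v))\<^sup>2)))"
          by (cases "v \<in> K") simp_all
      qed
      finally have 1: "ennreal ((norm (fourier_integral (\<lambda>y. \<theta> y * (\<integral>v. f (y, v) * \<psi> v \<partial>lborel)) \<zeta>))\<^sup>2) \<le>
          ennreal (b\<^sup>2) * emeasure lborel K * ?R" by (simp add: mult_left_mono)
      have W: "?W powr (1 / real \<gamma>) * b\<^sup>2 = C\<^sup>2"
      proof -
        have W0: "?W > 0" by (simp add: add_pos_nonneg)
        have "(?W powr (- 1 / (2 * real \<gamma>)))\<^sup>2 = ?W powr (2 * (- 1 / (2 * real \<gamma>)))"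
          using W0 by (simp add: powr_power mult.commute)
        also have "2 * (- 1 / (2 * real \<gamma>)) = - (1 / real \<gamma>)" by simp
        finally show ?thesis using W0 by (simp add: b_def power_mult_distrib powr_minus field_simps)
      qed
      have "ennreal (?W powr (1 / real \<gamma>) *
        (norm (fourier_integral (\<lambda>y. \<theta> y * (\<integral>v. f (y, v) * \<psi> v \<partial>lborel)) \<zeta>))\<^sup>2) =
        ennreal (?W powr (1 / real \<gamma>)) * ennreal ((norm (fourier_integral (\<lambda>y. \<theta> y * (\<integral>v. f (y, v) * \<psi> v \<partial>lborel)) \<zeta>))\<^sup>2)"
        by (rule ennreal_mult) auto
      also have "\<dots> \<le> ennreal (?W powr (1 / real \<gamma>)) * (ennreal (b\<^sup>2) * emeasure lborel K * ?R)"
        by (intro mult_left_mono 1) simp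
      also have "\<dots> = ennreal (?W powr (1 / real \<gamma>) * b\<^sup>2) * emeasure lborel K * ?R"
        by (subst ennreal_mult) (auto simp: mult.assoc)
      finally show ?thesis unfolding W .
    qed
    have "(\<integral>\<^sup>+\<zeta>. ennreal ((1 + (norm \<zeta>)\<^sup>2) powr (1 / real \<gamma>) *
        (norm (fourier_integral (\<lambda>y. \<theta> y * (\<integral>v. f (y, v) * \<psi> v \<partial>lborel)) \<zeta>))\<^sup>2) \<partial>lborel) \<le>
      (\<integral>\<^sup>+\<zeta>. ennreal (C\<^sup>2) * emeasure lborel K *
        (\<integral>\<^sup>+v. 2 * (indicator K v * ennreal ((norm (U \<zeta> v))\<^sup>2)) + (4 * (indicator K v * ennreal ((norm (G1 \<zeta> v))\<^sup>2))
          + 4 * (indicator K v * ennreal ((norm (G2 \<zeta> v))\<^sup>2))) \<partial>lborel) \<partial>lborel)"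
      by (intro nn_integral_mono pt)
    also have "\<dots> = ennreal (C\<^sup>2) * emeasure lborel K *
        (2 * (\<integral>\<^sup>+\<zeta>. (\<integral>\<^sup>+v. indicator K v * ennreal ((norm (U \<zeta> v))\<^sup>2) \<partial>lborel) \<partial>lborel)
        + (4 * (\<integral>\<^sup>+\<zeta>. (\<integral>\<^sup>+v. indicator K v * ennreal ((norm (G1 \<zeta> v))\<^sup>2) \<partial>lborel) \<partial>lborel)
        + 4 * (\<integral>\<^sup>+\<zeta>. (\<integral>\<^sup>+v. indicator K v * ennreal ((norm (G2 \<zeta> v))\<^sup>2) \<partial>lborel) \<partial>lborel)))"
      by (simp add: nn_integral_cmult nn_integral_add)
    also have "\<dots> \<le> A"
      unfolding A_def
    proof (intro mult_left_mono add_mono)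
      show "(\<integral>\<^sup>+\<zeta>. (\<integral>\<^sup>+v. indicator K v * ennreal ((norm (U \<zeta> v))\<^sup>2) \<partial>lborel) \<partial>lborel) \<le> ?P T * sq_integral f"
        unfolding U_def by (rule nn_integral_fourier_slice_le[OF fm(1) \<Theta>1m Km]) (simp add: \<Theta>1_def T1)
      show "(\<integral>\<^sup>+\<zeta>. (\<integral>\<^sup>+v. indicator K v * ennreal ((norm (G1 \<zeta> v))\<^sup>2) \<partial>lborel) \<partial>lborel) \<le> ?P T * sq_integral g"
        unfolding G1_def by (rule nn_integral_fourier_slice_le[OF fm(2) \<Theta>1m Km]) (simp add: \<Theta>1_def T1)
      show "(\<integral>\<^sup>+\<zeta>. (\<integral>\<^sup>+v. indicator K v * ennreal ((norm (G2 \<zeta> v))\<^sup>2) \<partial>lborel) \<partial>lborel) \<le> ?P (T * B) * sq_integral f"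
        unfolding G2_def
      proof (rule nn_integral_fourier_slice_le[OF fm(1) \<Theta>2m Km])
        fix y v assume "v \<in> K"
        then show "norm (\<Theta>2 (y, v)) \<le> T * B"
          using T2[of "c v" y] mult_left_mono[OF B(2)[of v] T] by (simp add: \<Theta>2_def)
      qed
    qed auto
    finally show ?thesis .
  qed
  ultimately show ?thesis by blast
qed

text \<open>The dilates \<open>\<theta>\<^sub>n(y) = \<theta>(y / (n + 1))\<close> of one bump function that equals \<open>1\<close> at \<open>0\<close> tend to \<open>1\<close>, and dilation by a
factor of at least \<open>1\<close> does not increase the gradient; so all of them obey the same bounds.\<close>
theorem velocity_average_sobolev:
  fixes c :: "'b::euclidean_space \<Rightarrow> 'a::euclidean_space" and f g :: "'a \<times> 'b \<Rightarrow> complex" and \<psi> :: "'b \<Rightarrow> complex"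
  assumes \<gamma>: "\<gamma> \<ge> 1" and c: "Ck \<gamma> c"
    and nondeg: "\<And>v \<sigma>. norm \<sigma> = 1 \<Longrightarrow> \<exists>k<\<gamma>. (dir_deriv F ^^ k) c v \<bullet> \<sigma> \<noteq> 0"
    and f: "L2 f" and g: "L2 g"
    and weak: "\<And>\<alpha> \<beta>. test_fun \<alpha> \<Longrightarrow> test_fun \<beta> \<Longrightarrow>
      (\<integral>(y, v). f (y, v) * (dir_deriv (c v) \<alpha> y * \<beta> v + \<alpha> y * dir_deriv F \<beta> v) \<partial>lborel) =
      - (\<integral>(y, v). g (y, v) * (\<alpha> y * \<beta> v) \<partial>lborel)"
    and \<psi>: "Ck_compact 1 \<psi>"
  shows "(\<lambda>y. \<integral>v. f (y, v) * \<psi> v \<partial>lborel) \<in> sobolev_H (1 / real \<gamma>)"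
proof -
  obtain \<eta> :: "'a \<Rightarrow> real" where \<eta>: "\<And>k. Ck k \<eta>" "\<And>x. 0 \<le> \<eta> x" "0 < \<eta> 0" "\<And>x. 1 \<le> norm x \<Longrightarrow> \<eta> x = 0"
    using smooth_bump[of 1] by auto
  define \<eta>0 where "\<eta>0 y = complex_of_real (1 / \<eta> 0 * \<eta> y)" for y
  have sm: "Ck k \<eta>0" for k unfolding \<eta>0_def
    by (intro Ck_linear_compose[OF bounded_linear_of_real] Ck_mult Ck_const \<eta>(1))
  have \<eta>d: "\<eta>0 differentiable (at y)" for y using sm[of 1] by simp
  have \<eta>c: "continuous_on UNIV \<eta>0" using sm Ck_continuous by blast
  have \<eta>'c: "continuous_on UNIV (dir_deriv w \<eta>0)" for w using sm[of 1] by simp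
  have \<eta>s: "\<eta>0 y = 0" if "1 \<le> norm y" for y using \<eta>(4)[OF that] by (simp add: \<eta>0_def)
  have \<eta>'s: "dir_deriv w \<eta>0 y = 0" if "1 < norm y" for w y by (rule dir_deriv_zero_outside[OF \<eta>s that])
  obtain T0 where T0: "T0 \<ge> 0" "\<And>y. norm (\<eta>0 y) \<le> T0"
    using bounded_continuous_bounded_support[OF \<eta>c, of 1] \<eta>s by (metis less_imp_le)
  have "\<exists>C\<ge>0. \<forall>y. norm (dir_deriv b \<eta>0 y) \<le> C" for b
    using bounded_continuous_bounded_support[OF \<eta>'c, of 1] \<eta>'s by metis
  then obtain Cb where Cb: "\<And>b. Cb b \<ge> 0" "\<And>b y. norm (dir_deriv b \<eta>0 y) \<le> Cb b" by metis
  \<comment> \<open>One constant bounds the bump and, through its partial derivatives, its gradient.\<close>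
  define T where "T = T0 + (\<Sum>b\<in>Basis. Cb b)"
  have T: "T \<ge> 0" "T0 \<le> T" using T0 Cb by (auto simp: T_def sum_nonneg)
  have grad: "norm (dir_deriv w \<eta>0 y) \<le> T * norm w" for w y
  proof -
    have "norm (dir_deriv w \<eta>0 y) \<le> (\<Sum>b\<in>Basis. norm ((w \<bullet> b) *\<^sub>R dir_deriv b \<eta>0 y))"
      unfolding dir_deriv_eq_sum_Basis[OF \<eta>d, of w] by (rule norm_sum)
    also have "\<dots> \<le> (\<Sum>b\<in>Basis. norm w * Cb b)"
      by (intro sum_mono) (auto intro!: mult_mono Cb simp: Basis_le_norm)
    also have "\<dots> = (\<Sum>b\<in>Basis. Cb b) * norm w" by (simp add: sum_distrib_left mult.commute)
    also have "\<dots> \<le> T * norm w" using T0 by (intro mult_right_mono) (auto simp: T_def)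
    finally show ?thesis .
  qed
  define \<theta> where "\<theta> n y = \<eta>0 (0 + (1 / real (Suc n)) *\<^sub>R y)" for n y
  have L: "bounded_linear (\<lambda>y::'a. (1 / real (Suc n)) *\<^sub>R y)" for n by (rule bounded_linear_scaleR_right)
  have \<theta>sm: "Ck k (\<theta> n)" for k n unfolding \<theta>_def by (rule Ck_compose_affine[OF L sm])
  have \<theta>s: "\<theta> n y = 0" if "real (Suc n) \<le> norm y" for n y
    unfolding \<theta>_def using that by (intro \<eta>s) (simp add: field_simps)
  have test: "test_fun (\<theta> n)" for n
    unfolding test_fun_def using \<theta>sm by (auto intro!: compactly_supportedI[of "real (Suc n)"] \<theta>s)
  have \<theta>T: "norm (\<theta> n y) \<le> T" for n y
    unfolding \<theta>_def using T0(2) T(2) by (rule order.trans)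
  have \<theta>'T: "norm (dir_deriv w (\<theta> n) y) \<le> T * norm w" for n w y
  proof -
    have "norm (dir_deriv w (\<theta> n) y) = norm (dir_deriv ((1 / real (Suc n)) *\<^sub>R w) \<eta>0 (0 + (1 / real (Suc n)) *\<^sub>R y))"
      unfolding \<theta>_def by (subst dir_deriv_compose_affine[OF L \<eta>d]) (rule refl)
    also have "\<dots> \<le> T * norm ((1 / real (Suc n)) *\<^sub>R w)" by (rule grad)
    also have "\<dots> \<le> T * norm w"
    proof (rule mult_left_mono)
      have "norm ((1 / real (Suc n)) *\<^sub>R w) = 1 / real (Suc n) * norm w" by simp
      also have "\<dots> \<le> 1 * norm w" by (intro mult_right_mono) auto
      finally show "norm ((1 / real (Suc n)) *\<^sub>R w) \<le> norm w" by simp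
    qed (rule T)
    finally show ?thesis .
  qed
  obtain A where A: "A < \<infinity>" "\<And>\<theta>. test_fun \<theta> \<Longrightarrow> (\<forall>y. norm (\<theta> y) \<le> T) \<Longrightarrow> (\<forall>w y. norm (dir_deriv w \<theta> y) \<le> T * norm w) \<Longrightarrow>
    (\<integral>\<^sup>+\<zeta>. ennreal ((1 + (norm \<zeta>)\<^sup>2) powr (1 / real \<gamma>) *
      (norm (fourier_integral (\<lambda>y. \<theta> y * (\<integral>v. f (y, v) * \<psi> v \<partial>lborel)) \<zeta>))\<^sup>2) \<partial>lborel) \<le> A"
    using weighted_fourier_average_bound[OF \<gamma> c nondeg f g weak \<psi> T(1)] by blast
  obtain \<rho> where \<rho>: "\<rho> > 0" "\<And>v. \<rho> \<le> norm v \<Longrightarrow> \<psi> v = 0"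
    using compactly_supportedE[of \<psi>] \<psi> unfolding Ck_compact_def by blast
  have "Ck 1 \<psi>" using \<psi> by (simp add: Ck_compact_def)
  then have \<psi>c: "continuous_on UNIV \<psi>" using Ck_continuous by blast
  show ?thesis
  proof (rule sobolev_H_if_truncations_bounded[where \<theta> = \<theta> and C = T and r = "\<lambda>n. real (Suc n)" and K = A])
    show "L2 (\<lambda>y. \<integral>v. f (y, v) * \<psi> v \<partial>lborel)"
      by (rule L2_velocity_average[OF f \<psi>c, of \<rho>]) (use \<rho>(2) in auto)
    show "\<theta> n \<in> borel_measurable borel" for n
      by (rule borel_measurable_continuous_onI) (rule Ck_continuous[OF \<theta>sm])
    fix y :: 'a
    have l: "(\<lambda>n. 1 / real (Suc n)) \<longlonglongrightarrow> 0" by (rule LIMSEQ_Suc[OF lim_const_over_n])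
    have "(\<lambda>n. 0 + (1 / real (Suc n)) *\<^sub>R y) \<longlonglongrightarrow> 0 + 0 *\<^sub>R y"
      by (intro tendsto_intros l)
    then have "(\<lambda>n. \<eta>0 (0 + (1 / real (Suc n)) *\<^sub>R y)) \<longlonglongrightarrow> \<eta>0 (0 + 0 *\<^sub>R y)"
      by (intro continuous_on_tendsto_compose[OF \<eta>c]) auto
    then show "(\<lambda>n. \<theta> n y) \<longlonglongrightarrow> 1" using \<eta>(3) by (simp add: \<theta>_def \<eta>0_def)
  qed (use A test \<theta>T \<theta>'T \<theta>s in auto)
qed

section \<open>The kinetic equation as a transport equation in product form\<close>

text \<open>The kinetic equation lives on \<open>t, x, v\<close> grouped as \<open>(t, (x, v))\<close>, while the transform is taken in \<open>(t, x)\<close>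
jointly. This regrouping preserves Lebesgue measure.\<close>
definition assoc3 :: "(('a \<times> 'b) \<times> 'c) \<Rightarrow> 'a \<times> 'b \<times> 'c" where
  "assoc3 p = (fst (fst p), snd (fst p), snd p)"

lemma box_Times: "box (a, b) (a', b') = box a a' \<times> box b (b' :: 'b::euclidean_space)"
  for a a' :: "'a::euclidean_space"
  by (auto simp: box_def Basis_prod_def ball_Un)

lemma distr_assoc3:
  "distr lborel borel assoc3 = (lborel :: ('a::euclidean_space \<times> 'b::euclidean_space \<times> 'c::euclidean_space) measure)"
proof (rule lborel_eqI[symmetric])
  have cont: "continuous_on UNIV (assoc3 :: ('a \<times> 'b) \<times> 'c \<Rightarrow> _)"
    unfolding assoc3_def[abs_def] by (intro continuous_intros)
  then have m: "assoc3 \<in> borel_measurable (borel :: (('a \<times> 'b) \<times> 'c) measure)" by (rule borel_measurable_continuous_onI)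
  have times: "emeasure lborel (X \<times> Y) = emeasure lborel X * emeasure lborel Y"
    if "X \<in> sets borel" "Y \<in> sets borel" for X :: "'d::euclidean_space set" and Y :: "'e::euclidean_space set"
    using lborel.emeasure_pair_measure_Times[of X lborel Y] that by (simp add: lborel_prod)
  fix l u :: "'a \<times> 'b \<times> 'c" assume le: "\<And>b. b \<in> Basis \<Longrightarrow> l \<bullet> b \<le> u \<bullet> b"
  obtain l1 l2 l3 where l: "l = (l1, l2, l3)" by (cases l)
  obtain u1 u2 u3 where u: "u = (u1, u2, u3)" by (cases u)
  have "emeasure (distr lborel borel assoc3) (box l u) = emeasure lborel (assoc3 -` box l u)"
    using m by (simp add: emeasure_distr)
  also have "assoc3 -` box l u = (box l1 u1 \<times> box l2 u2) \<times> box l3 u3"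
    by (auto simp: l u box_Times assoc3_def)
  also have "emeasure lborel \<dots> = emeasure lborel (box l1 u1) * emeasure lborel (box l2 u2) * emeasure lborel (box l3 u3)"
    by (simp add: times borel_Times)
  also have "\<dots> = emeasure lborel (box l u)"
    by (simp add: l u box_Times times borel_Times mult.assoc)
  also have "\<dots> = (\<Prod>b\<in>Basis. (u - l) \<bullet> b)" using le by (rule emeasure_lborel_box)
  finally show "emeasure (distr lborel borel assoc3) (box l u) = (\<Prod>b\<in>Basis. (u - l) \<bullet> b)" .
qed simp

lemma measurable_assoc3:
  "(assoc3 :: ('a::euclidean_space \<times> 'b::euclidean_space) \<times> 'c::euclidean_space \<Rightarrow> _) \<in> borel_measurable borel"
  unfolding assoc3_def[abs_def] by (intro borel_measurable_continuous_onI continuous_intros)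

lemma integral_assoc3:
  fixes H :: "'a::euclidean_space \<times> 'b::euclidean_space \<times> 'c::euclidean_space \<Rightarrow> complex"
  assumes "H \<in> borel_measurable borel"
  shows "(\<integral>p. H (assoc3 p) \<partial>lborel) = (\<integral>p. H p \<partial>lborel)"
proof -
  have "(\<integral>p. H p \<partial>lborel) = (\<integral>p. H p \<partial>distr lborel borel assoc3)" by (simp only: distr_assoc3)
  also have "\<dots> = (\<integral>p. H (assoc3 p) \<partial>lborel)"
    by (rule integral_distr) (use measurable_assoc3 assms in auto)
  finally show ?thesis by simp
qed

lemma L2_assoc3:
  assumes "L2 f" shows "L2 (\<lambda>p. f (assoc3 p))"
proof -
  have f: "f \<in> borel_measurable borel" "sq_integral f < \<infinity>" using assms by (simp_all add: L2_iff_nn)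
  note [measurable] = f(1) measurable_assoc3
  have "sq_integral f = (\<integral>\<^sup>+p. ennreal ((norm (f p))\<^sup>2) \<partial>distr lborel borel assoc3)"
    by (simp only: distr_assoc3)
  also have "\<dots> = sq_integral (\<lambda>p. f (assoc3 p))"
    by (rule nn_integral_distr) (use measurable_assoc3 f in auto)
  finally show ?thesis using f unfolding L2_iff_nn by (auto intro: measurable_compose[OF measurable_assoc3])
qed

lemma dir_deriv_Pair_const:
  assumes "u differentiable (at x)"
  shows "dir_deriv w (\<lambda>v. (k, u v)) x = (0, dir_deriv w u x)"
  by (rule dir_deriv_eq, rule has_derivative_Pair[OF has_derivative_const has_derivative_dir_deriv[OF assms]])

text \<open>The constant first component of \<open>c v = (1, a v)\<close> disappears after one derivative. This matches the
nondegeneracy hypothesis, in which \<open>\<sigma>\<^sub>0\<close> occurs only in the term of order \<open>0\<close>.\<close>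
lemma funpow_dir_deriv_Pair_const:
  "Ck n u \<Longrightarrow> 1 \<le> k \<Longrightarrow> k \<le> n \<Longrightarrow> (dir_deriv F ^^ k) (\<lambda>v. (q, u v)) = (\<lambda>v. (0, (dir_deriv F ^^ k) u v))"
proof (induction k)
  case (Suc k)
  have "Ck (n - k) ((dir_deriv F ^^ k) u)" using Suc.prems by (intro Ck_funpow_dir_deriv) auto
  then have "Ck (Suc (n - Suc k)) ((dir_deriv F ^^ k) u)" using Suc.prems by (simp add: Suc_diff_Suc)
  then have d: "(dir_deriv F ^^ k) u differentiable (at v)" for v by simp
  show ?case
  proof (cases "k = 0")
    case True
    then show ?thesis using d by (simp add: fun_eq_iff dir_deriv_Pair_const)
  next
    case False
    then have IH: "(dir_deriv F ^^ k) (\<lambda>v. (q, u v)) = (\<lambda>v. (0, (dir_deriv F ^^ k) u v))" using Suc by simp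
    show ?thesis by (rule ext) (simp add: IH dir_deriv_Pair_const[OF d])
  qed
qed simp

text \<open>For a product test function, the coordinate derivatives of the kinetic equation combine, by linearity in the
direction, into one derivative along \<open>(1, a(v), F)\<close>, and the product rule splits this one again.\<close>
lemma kinetic_eq_tensor:
  fixes a :: "real^'m \<Rightarrow> real^'n" and F :: "real^'m" and f g :: "real \<times> (real^'n) \<times> (real^'m) \<Rightarrow> complex"
  assumes eq: "kinetic_eq a F f g" and a: "continuous_on UNIV a" and f: "f \<in> borel_measurable borel" and g: "g \<in> borel_measurable borel"
    and \<alpha>: "test_fun \<alpha>" and \<beta>: "test_fun \<beta>"
  shows "(\<integral>(y, v). f (assoc3 (y, v)) * (dir_deriv (1, a v) \<alpha> y * \<beta> v + \<alpha> y * dir_deriv F \<beta> v) \<partial>lborel) =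
      - (\<integral>(y, v). g (assoc3 (y, v)) * (\<alpha> y * \<beta> v) \<partial>lborel)"
proof -
  define Py :: "real \<times> (real^'n) \<times> (real^'m) \<Rightarrow> real \<times> (real^'n)" where "Py p = (fst p, fst (snd p))" for p
  define Pv :: "real \<times> (real^'n) \<times> (real^'m) \<Rightarrow> real^'m" where "Pv p = snd (snd p)" for p
  have bl: "bounded_linear Py" "bounded_linear Pv"
    unfolding Py_def[abs_def] Pv_def[abs_def]
    by (intro bounded_linear_intros bounded_linear_compose[OF bounded_linear_fst bounded_linear_snd] bounded_linear_compose[OF bounded_linear_snd bounded_linear_snd])+
  define \<phi> where "\<phi> p = \<alpha> (0 + Py p) * \<beta> (0 + Pv p)" for p
  have \<alpha>sm: "Ck k \<alpha>" and \<beta>sm: "Ck k \<beta>" for k using \<alpha> \<beta> by (simp_all add: test_fun_def)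
  have \<alpha>d: "\<alpha> differentiable (at y)" for y using \<alpha>sm[of 1] unfolding One_nat_def Ck.simps by blast
  have \<beta>d: "\<beta> differentiable (at v)" for v using \<beta>sm[of 1] by simp
  have \<phi>sm: "Ck k \<phi>" for k unfolding \<phi>_def
    by (intro Ck_mult Ck_compose_affine bl \<alpha>sm \<beta>sm)
  have \<phi>d: "\<phi> differentiable (at p)" for p using \<phi>sm[of 1] unfolding One_nat_def Ck.simps by blast
  obtain r where r: "r > 0" "\<And>y. r \<le> norm y \<Longrightarrow> \<alpha> y = 0"
    using compactly_supportedE[of \<alpha>] \<alpha> unfolding test_fun_def by blast
  obtain s where s: "s > 0" "\<And>v. s \<le> norm v \<Longrightarrow> \<beta> v = 0"
    using compactly_supportedE[of \<beta>] \<beta> unfolding test_fun_def by blast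
  have \<phi>test: "test_fun \<phi>" unfolding test_fun_def
  proof (intro conjI allI \<phi>sm compactly_supportedI[of "r + s"])
    fix p :: "real \<times> (real^'n) \<times> (real^'m)" assume p: "r + s < norm p"
    have "norm p \<le> norm (Py p) + norm (Pv p)"
    proof -
      have "norm p = norm ((fst p, fst (snd p), 0) + (0, 0, snd (snd p)))" by (simp add: prod_eq_iff)
      also have "\<dots> \<le> norm (fst p, fst (snd p), 0::real^'m) + norm (0::real, 0::real^'n, snd (snd p))" by (rule norm_triangle_ineq)
      finally show ?thesis by (simp add: Py_def Pv_def norm_Pair)
    qed
    then have "r \<le> norm (Py p) \<or> s \<le> norm (Pv p)" using p by linarith
    then show "\<phi> p = 0" using r(2)[of "Py p"] s(2)[of "Pv p"] by (auto simp: \<phi>_def)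
  qed
  have d\<phi>: "dir_deriv w \<phi> p = \<alpha> (Py p) * dir_deriv (Pv w) \<beta> (Pv p) + dir_deriv (Py w) \<alpha> (Py p) * \<beta> (Pv p)" for w p
  proof -
    have 1: "(\<lambda>p. \<alpha> (0 + Py p)) differentiable (at p)" "(\<lambda>p. \<beta> (0 + Pv p)) differentiable (at p)"
      by (rule Ck_Suc_differentiable[OF Ck_compose_affine[OF bl(1) \<alpha>sm]],
          rule Ck_Suc_differentiable[OF Ck_compose_affine[OF bl(2) \<beta>sm]])
    show ?thesis unfolding \<phi>_def dir_deriv_mult[OF 1]
      using dir_deriv_compose_affine[OF bl(1) \<alpha>d, of w 0 p] dir_deriv_compose_affine[OF bl(2) \<beta>d, of w 0 p] by simp
  qed
  have sums: "dir_deriv (1, 0, 0) \<phi> (t, x, v)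
           + (\<Sum>i\<in>UNIV. a v $ i *\<^sub>R dir_deriv (0, axis i 1, 0) \<phi> (t, x, v))
           + (\<Sum>j\<in>UNIV. F $ j *\<^sub>R dir_deriv (0, 0, axis j 1) \<phi> (t, x, v))
       = dir_deriv (1, a v) \<alpha> (t, x) * \<beta> v + \<alpha> (t, x) * dir_deriv F \<beta> v" for t x v
  proof -
    have "(\<Sum>i\<in>UNIV. a v $ i *\<^sub>R dir_deriv (0, axis i 1, 0) \<phi> (t, x, v)) = dir_deriv (\<Sum>i\<in>UNIV. a v $ i *\<^sub>R (0, axis i 1, 0)) \<phi> (t, x, v)"
      by (simp only: dir_deriv_sum_direction[OF \<phi>d] dir_deriv_scale_direction[OF \<phi>d])
    also have "(\<Sum>i\<in>UNIV. a v $ i *\<^sub>R (0::real, axis i 1 :: real^'n, 0::real^'m)) = (0, a v, 0)"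
      by (simp add: prod_eq_iff fst_sum snd_sum basis_expansion flip: scalar_mult_eq_scaleR)
    finally have 1: "(\<Sum>i\<in>UNIV. a v $ i *\<^sub>R dir_deriv (0, axis i 1, 0) \<phi> (t, x, v)) = dir_deriv (0, a v, 0) \<phi> (t, x, v)" .
    have "(\<Sum>j\<in>UNIV. F $ j *\<^sub>R dir_deriv (0, 0, axis j 1) \<phi> (t, x, v)) = dir_deriv (\<Sum>j\<in>UNIV. F $ j *\<^sub>R (0, 0, axis j 1)) \<phi> (t, x, v)"
      by (simp only: dir_deriv_sum_direction[OF \<phi>d] dir_deriv_scale_direction[OF \<phi>d])
    also have "(\<Sum>j\<in>UNIV. F $ j *\<^sub>R (0::real, 0 :: real^'n, axis j 1::real^'m)) = (0, 0, F)"
      by (simp add: prod_eq_iff fst_sum snd_sum basis_expansion flip: scalar_mult_eq_scaleR)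
    finally have 2: "(\<Sum>j\<in>UNIV. F $ j *\<^sub>R dir_deriv (0, 0, axis j 1) \<phi> (t, x, v)) = dir_deriv (0, 0, F) \<phi> (t, x, v)" .
    have "dir_deriv (1, 0, 0) \<phi> (t, x, v) + dir_deriv (0, a v, 0) \<phi> (t, x, v) + dir_deriv (0, 0, F) \<phi> (t, x, v) = dir_deriv (1, a v, F) \<phi> (t, x, v)"
      unfolding dir_deriv_add_direction[OF \<phi>d, symmetric] by simp
    then show ?thesis unfolding 1 2 by (simp add: d\<phi> Py_def Pv_def)
  qed
  have \<alpha>'c: "continuous_on UNIV (dir_deriv w \<alpha>)" for w using \<alpha>sm[of 1] unfolding One_nat_def Ck.simps by blast
  have \<beta>'c: "continuous_on UNIV (dir_deriv w \<beta>)" for w using \<beta>sm[of 1] by simp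
  have \<alpha>c: "continuous_on UNIV \<alpha>" and \<beta>c: "continuous_on UNIV \<beta>" using \<alpha>sm \<beta>sm Ck_continuous by blast+
  define D where "D p = dir_deriv (1, a (Pv p)) \<alpha> (Py p) * \<beta> (Pv p) + \<alpha> (Py p) * dir_deriv F \<beta> (Pv p)" for p
  have Py_cont: "continuous_on UNIV Py" and Pv_cont: "continuous_on UNIV Pv"
    using bl by (auto intro: linear_continuous_on)
  have "continuous_on UNIV D"
    unfolding D_def dir_deriv_eq_sum_Basis[OF \<alpha>d, of "(1, a _)"]
    by (intro continuous_intros continuous_on_compose2[OF \<alpha>'c] continuous_on_compose2[OF \<beta>'c] continuous_on_compose2[OF \<alpha>c]
        continuous_on_compose2[OF \<beta>c] continuous_on_compose2[OF a] Py_cont Pv_cont) auto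
  then have Dm: "D \<in> borel_measurable borel" by (rule borel_measurable_continuous_onI)
  have "continuous_on UNIV \<phi>" using \<phi>sm Ck_continuous by blast
  then have \<phi>m: "\<phi> \<in> borel_measurable borel" by (rule borel_measurable_continuous_onI)
  have e0: "- (\<integral>p. f p * D p \<partial>lborel) = (\<integral>p. g p * \<phi> p \<partial>lborel)"
  proof -
    have "- (\<integral>(t, x, v). f (t, x, v) *
          (dir_deriv (1, 0, 0) \<phi> (t, x, v)
           + (\<Sum>i\<in>UNIV. a v $ i *\<^sub>R dir_deriv (0, axis i 1, 0) \<phi> (t, x, v))
           + (\<Sum>j\<in>UNIV. F $ j *\<^sub>R dir_deriv (0, 0, axis j 1) \<phi> (t, x, v))) \<partial>lborel)
     = (\<integral>p. g p * \<phi> p \<partial>lborel)" using eq \<phi>test unfolding kinetic_eq_def by blast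
    moreover have "(\<lambda>(t, x, v). f (t, x, v) *
          (dir_deriv (1, 0, 0) \<phi> (t, x, v)
           + (\<Sum>i\<in>UNIV. a v $ i *\<^sub>R dir_deriv (0, axis i 1, 0) \<phi> (t, x, v))
           + (\<Sum>j\<in>UNIV. F $ j *\<^sub>R dir_deriv (0, 0, axis j 1) \<phi> (t, x, v)))) = (\<lambda>p. f p * D p)"
      unfolding sums by (auto simp: fun_eq_iff D_def Py_def Pv_def)
    ultimately show ?thesis by simp
  qed
  have e1: "(\<integral>p. f p * D p \<partial>lborel) = (\<integral>(y, v). f (assoc3 (y, v)) * (dir_deriv (1, a v) \<alpha> y * \<beta> v + \<alpha> y * dir_deriv F \<beta> v) \<partial>lborel)"
    using integral_assoc3[OF borel_measurable_times[OF f Dm]]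
    by (simp add: D_def Py_def Pv_def assoc3_def case_prod_unfold)
  have e2: "(\<integral>p. g p * \<phi> p \<partial>lborel) = (\<integral>(y, v). g (assoc3 (y, v)) * (\<alpha> y * \<beta> v) \<partial>lborel)"
    using integral_assoc3[OF borel_measurable_times[OF g \<phi>m]]
    by (simp add: \<phi>_def Py_def Pv_def assoc3_def case_prod_unfold)
  show ?thesis unfolding e1[symmetric] e2[symmetric] e0[symmetric] by simp
qed

theorem theorem2:
  fixes \<gamma> :: nat
    and a :: "real^'m \<Rightarrow> real^'n"
    and F :: "real^'m"
    and f g :: "real \<times> (real^'n) \<times> (real^'m) \<Rightarrow> complex"
    and \<psi> :: "real^'m \<Rightarrow> complex"
  assumes "\<gamma> \<ge> 1"
    and "Ck \<gamma> a"
    and "F \<noteq> 0"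
    and "L2 f" and "L2 g"
    and "kinetic_eq a F f g"
    and "\<And>v \<sigma>0 \<sigma>'. (\<sigma>0, \<sigma>') \<in> sphere (0 :: real \<times> (real^'n)) 1 \<Longrightarrow>
           \<bar>\<sigma>0 + a v \<bullet> \<sigma>'\<bar> + (\<Sum>k = 1..\<gamma> - 1. \<bar>(dir_deriv F ^^ k) a v \<bullet> \<sigma>'\<bar>) > 0"
    and "Ck_compact 1 \<psi>"
  shows "average f \<psi> \<in> sobolev_H (1 / real \<gamma>)"
proof -
  define c :: "real^'m \<Rightarrow> real \<times> (real^'n)" where "c v = (1, a v)" for v
  have "Ck \<gamma> (\<lambda>v. (1::real, 0::real^'n) + (0, a v))"
    by (intro Ck_add Ck_const Ck_linear_compose[where T = "Pair 0"] assms(2))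
      (auto intro!: bounded_linear_Pair bounded_linear_zero bounded_linear_ident)
  then have c: "Ck \<gamma> c" by (simp add: c_def[abs_def])
  have nondeg: "\<exists>k<\<gamma>. (dir_deriv F ^^ k) c v \<bullet> \<sigma> \<noteq> 0" if \<sigma>: "norm \<sigma> = 1" for v and \<sigma> :: "real \<times> (real^'n)"
  proof (rule ccontr)
    assume "\<not> ?thesis"
    then have z: "(dir_deriv F ^^ k) c v \<bullet> \<sigma> = 0" if "k < \<gamma>" for k using that by blast
    obtain \<sigma>0 \<sigma>' where s: "\<sigma> = (\<sigma>0, \<sigma>')" by (cases \<sigma>)
    have "\<sigma>0 + a v \<bullet> \<sigma>' = 0" using z[of 0] assms(1) by (simp add: c_def s)
    moreover have "(dir_deriv F ^^ k) a v \<bullet> \<sigma>' = 0" if "k \<in> {1..\<gamma> - 1}" for k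
    proof -
      have k: "1 \<le> k" "k < \<gamma>" "k \<le> \<gamma>" using that assms(1) by auto
      show ?thesis
        using z[OF k(2)] unfolding c_def[abs_def] funpow_dir_deriv_Pair_const[OF assms(2) k(1,3)] by (simp add: s)
    qed
    ultimately have "\<bar>\<sigma>0 + a v \<bullet> \<sigma>'\<bar> + (\<Sum>k = 1..\<gamma> - 1. \<bar>(dir_deriv F ^^ k) a v \<bullet> \<sigma>'\<bar>) = 0" by simp
    moreover have "(\<sigma>0, \<sigma>') \<in> sphere 0 1" using \<sigma> by (simp add: s)
    ultimately show False using assms(7)[of \<sigma>0 \<sigma>' v] by linarith
  qed
  have "(\<lambda>y. \<integral>v. f (assoc3 (y, v)) * \<psi> v \<partial>lborel) \<in> sobolev_H (1 / real \<gamma>)"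
  proof (rule velocity_average_sobolev[OF assms(1) c nondeg L2_assoc3[OF assms(4)] L2_assoc3[OF assms(5)] _ assms(8)])
    fix \<alpha> :: "real \<times> (real^'n) \<Rightarrow> complex" and \<beta> :: "real^'m \<Rightarrow> complex"
    assume t: "test_fun \<alpha>" "test_fun \<beta>"
    show "(\<integral>(y, v). f (assoc3 (y, v)) * (dir_deriv (c v) \<alpha> y * \<beta> v + \<alpha> y * dir_deriv F \<beta> v) \<partial>lborel) =
      - (\<integral>(y, v). g (assoc3 (y, v)) * (\<alpha> y * \<beta> v) \<partial>lborel)"
      unfolding c_def
      by (rule kinetic_eq_tensor[OF assms(6) Ck_continuous[OF assms(2)] _ _ t]) (use assms(4,5) in \<open>simp_all add: L2_def\<close>)
  qed
  moreover have "(\<lambda>y. \<integral>v. f (assoc3 (y, v)) * \<psi> v \<partial>lborel) = average f \<psi>"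
    by (auto simp: fun_eq_iff average_def assoc3_def)
  ultimately show ?thesis by simp
qed

end
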